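(* Let $G=G_1\times G_2\times\cdots\times G_r$ and $H=H_1\times H_2\times\cdots\times H_r$ be two finite groups such that $|G_i|=|H_i|=k_i$ for each $i$ and $\gcd(k_i,k_j)=1$ whenever $i\neq j$. Then $G\sim_{\mathbb C}H$ if and only if $G_i\sim_{\mathbb C}H_i$ for all $i=1,2,\dots,r$.
   Context: For a finite group $G$, $Z^2(G,\mathbb C^\times)$ is the group of $2$-cocycles with trivial $G$-action on $\mathbb C^\times$, and $H^2(G,\mathbb C^\times)$ is the second cohomology group. For $\alpha\in Z^2(G,\mathbb C^\times)$, the twisted group algebra $\mathbb C^\alpha G$ is the $\mathbb C$-vector space with basis $\{\bar g: g\in G\}$ and multiplication determined by $\bar g\,\bar h=\alpha(g,h)\overline{gh}$; up to isomorphism it depends only on the class $[\alpha]$. For finite groups $G,H$ we write $G\sim_{\mathbb C}H$ if there is a group isomorphism $\psi:H^2(G,\mathbb C^\times)\to H^2(H,\mathbb C^\times)$ such that $\mathbb C^\alpha G\cong\mathbb C^{\psi(\alpha)}H$ (as $\mathbb C$-algebras) for every $[\alpha]\in H^2(G,\mathbb C^\times)$, where $\psi(\alpha)$ denotes a cocycle representing $\psi([\alpha])$. *)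

theory Defs
  imports Complex_Main "HOL-Algebra.Algebra"
begin

section \<open>Second cohomology with trivial action on the nonzero complex numbers\<close>

text \<open>Cochains are extensional functions (value \<^term>\<open>undefined\<close> off the carrier), so that
  equality of cochains is equality on the group.\<close>

definition cocycles2 :: "('a, 'm) monoid_scheme \<Rightarrow> ('a \<times> 'a \<Rightarrow> complex) monoid" where
  "cocycles2 G = \<lparr>
     carrier = {\<alpha> \<in> carrier G \<times> carrier G \<rightarrow>\<^sub>E UNIV - {0}.
       \<forall>g\<in>carrier G. \<forall>h\<in>carrier G. \<forall>k\<in>carrier G.
         \<alpha> (g, h) * \<alpha> (g \<otimes>\<^bsub>G\<^esub> h, k) = \<alpha> (g, h \<otimes>\<^bsub>G\<^esub> k) * \<alpha> (h, k)},
     monoid.mult = (\<lambda>\<alpha> \<beta>. \<lambda>p\<in>carrier G \<times> carrier G. \<alpha> p * \<beta> p),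
     one = (\<lambda>p\<in>carrier G \<times> carrier G. 1)\<rparr>"

definition coboundary2 :: "('a, 'm) monoid_scheme \<Rightarrow> ('a \<Rightarrow> complex) \<Rightarrow> 'a \<times> 'a \<Rightarrow> complex" where
  "coboundary2 G l = (\<lambda>(g, h)\<in>carrier G \<times> carrier G. l g * l h / l (g \<otimes>\<^bsub>G\<^esub> h))"

definition coboundaries2 :: "('a, 'm) monoid_scheme \<Rightarrow> ('a \<times> 'a \<Rightarrow> complex) set" where
  "coboundaries2 G = coboundary2 G ` (carrier G \<rightarrow>\<^sub>E UNIV - {0})"

definition H2 :: "('a, 'm) monoid_scheme \<Rightarrow> ('a \<times> 'a \<Rightarrow> complex) set monoid" where
  "H2 G = cocycles2 G Mod coboundaries2 G"

section \<open>Twisted group algebras\<close>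

text \<open>Writing \<open>u\<^sub>g\<close> for the basis element of \<open>g\<close>, the element \<open>\<Sum>g. a g \<cdot> u\<^sub>g\<close> is represented by its
  coefficient function \<open>a\<close>; the product is the bilinear extension of \<open>u\<^sub>g \<cdot> u\<^sub>h = \<alpha>(g,h) \<cdot> u\<^sub>g\<^sub>h\<close>
  (see \<open>twisted_group_algebra_mult_basis\<close> below). Cocycles need not be normalised, so the unit is
  \<open>\<alpha>(1,1)\<inverse> \<cdot> u\<^sub>1\<close>. The \<open>module\<close> record carries both the ring structure and the scalar
  multiplication; the \<open>algebra\<close> locale is not used because it requires commutativity.\<close>

definition twisted_group_algebra ::
    "('a, 'm) monoid_scheme \<Rightarrow> ('a \<times> 'a \<Rightarrow> complex) \<Rightarrow> (complex, 'a \<Rightarrow> complex) module" where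
  "twisted_group_algebra G \<alpha> = \<lparr>
     carrier = (carrier G \<rightarrow>\<^sub>E UNIV),
     monoid.mult = (\<lambda>a b. \<lambda>x\<in>carrier G.
       \<Sum>(g, h) | g \<in> carrier G \<and> h \<in> carrier G \<and> g \<otimes>\<^bsub>G\<^esub> h = x. \<alpha> (g, h) * a g * b h),
     one = (\<lambda>x\<in>carrier G. if x = \<one>\<^bsub>G\<^esub> then inverse (\<alpha> (\<one>\<^bsub>G\<^esub>, \<one>\<^bsub>G\<^esub>)) else 0),
     ring.zero = (\<lambda>x\<in>carrier G. 0),
     ring.add = (\<lambda>a b. \<lambda>x\<in>carrier G. a x + b x),
     smult = (\<lambda>c a. \<lambda>x\<in>carrier G. c * a x)\<rparr>"

definition complex_algebra_iso ::
    "(complex, 'a, 'm) module_scheme \<Rightarrow> (complex, 'b, 'n) module_scheme \<Rightarrow> ('a \<Rightarrow> 'b) set" where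
  "complex_algebra_iso A B =
     {f \<in> ring_iso A B. \<forall>c. \<forall>x\<in>carrier A. f (c \<odot>\<^bsub>A\<^esub> x) = c \<odot>\<^bsub>B\<^esub> f x}"

section \<open>The relation on finite groups\<close>

text \<open>Cohomology classes are cosets, so a cocycle represents a class iff it is an element of it.
  Since the isomorphism type of a twisted group algebra depends only on the class, quantifying
  over all representatives is the same as choosing one of each class
  (see \<open>twisted_group_algebra_cohomologous\<close> below).\<close>

definition twisted_equivalent ::
    "('a, 'm) monoid_scheme \<Rightarrow> ('b, 'n) monoid_scheme \<Rightarrow> bool" (infix \<open>\<sim>\<^sub>\<complex>\<close> 50) where
  "G \<sim>\<^sub>\<complex> H \<longleftrightarrow>
     (\<exists>\<psi> \<in> iso (H2 G) (H2 H).
        \<forall>c \<in> carrier (H2 G). \<forall>\<alpha> \<in> c. \<forall>\<beta> \<in> \<psi> c.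
          complex_algebra_iso (twisted_group_algebra G \<alpha>) (twisted_group_algebra H \<beta>) \<noteq> {})"

section \<open>Well-definedness\<close>

lemma comm_group_cocycles2:
  assumes "group G"
  shows "comm_group (cocycles2 G)"
proof -
  interpret group G by fact
  show ?thesis
  proof (rule comm_groupI)
    fix x assume x: "x \<in> carrier (cocycles2 G)"
    define y where "y = (\<lambda>p\<in>carrier G \<times> carrier G. inverse (x p))"
    have "y \<in> carrier (cocycles2 G)"
      using x unfolding y_def cocycles2_def
      by (auto simp: PiE_iff field_simps simp flip: inverse_mult_distrib)
    moreover have "y \<otimes>\<^bsub>cocycles2 G\<^esub> x = \<one>\<^bsub>cocycles2 G\<^esub>"
      using x unfolding y_def cocycles2_def by (auto simp: fun_eq_iff PiE_iff)
    ultimately show "\<exists>y\<in>carrier (cocycles2 G). y \<otimes>\<^bsub>cocycles2 G\<^esub> x = \<one>\<^bsub>cocycles2 G\<^esub>"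
      by blast
  next
    fix x y assume xy: "x \<in> carrier (cocycles2 G)" "y \<in> carrier (cocycles2 G)"
    let ?z = "\<lambda>p\<in>carrier G \<times> carrier G. x p * y p"
    have "?z (g, h) * ?z (g \<otimes>\<^bsub>G\<^esub> h, k) = ?z (g, h \<otimes>\<^bsub>G\<^esub> k) * ?z (h, k)"
      if g: "g \<in> carrier G" "h \<in> carrier G" "k \<in> carrier G" for g h k
    proof -
      have "x (g, h) * x (g \<otimes>\<^bsub>G\<^esub> h, k) = x (g, h \<otimes>\<^bsub>G\<^esub> k) * x (h, k)"
        and "y (g, h) * y (g \<otimes>\<^bsub>G\<^esub> h, k) = y (g, h \<otimes>\<^bsub>G\<^esub> k) * y (h, k)"
        using xy g by (auto simp: cocycles2_def)
      hence "(x (g, h) * x (g \<otimes>\<^bsub>G\<^esub> h, k)) * (y (g, h) * y (g \<otimes>\<^bsub>G\<^esub> h, k))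
        = (x (g, h \<otimes>\<^bsub>G\<^esub> k) * x (h, k)) * (y (g, h \<otimes>\<^bsub>G\<^esub> k) * y (h, k))"
        by simp
      thus ?thesis using g by (simp add: mult_ac)
    qed
    moreover have "?z \<in> carrier G \<times> carrier G \<rightarrow>\<^sub>E UNIV - {0}"
      using xy by (auto simp: cocycles2_def PiE_iff)
    ultimately show "x \<otimes>\<^bsub>cocycles2 G\<^esub> y \<in> carrier (cocycles2 G)"
      by (simp add: cocycles2_def)
  next
    fix x assume "x \<in> carrier (cocycles2 G)"
    thus "\<one>\<^bsub>cocycles2 G\<^esub> \<otimes>\<^bsub>cocycles2 G\<^esub> x = x"
      unfolding cocycles2_def by (auto simp: PiE_iff extensional_def fun_eq_iff)
  qed (auto simp: cocycles2_def fun_eq_iff)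
qed

lemma subgroup_coboundaries2:
  assumes "group G"
  shows "subgroup (coboundaries2 G) (cocycles2 G)"
proof -
  interpret group G by fact
  interpret Z: comm_group "cocycles2 G" by (rule comm_group_cocycles2) fact
  have sub: "coboundary2 G l \<in> carrier (cocycles2 G)" if "l \<in> carrier G \<rightarrow>\<^sub>E UNIV - {0}" for l
    using that unfolding cocycles2_def coboundary2_def by (auto simp: PiE_iff m_assoc)
  show ?thesis
  proof (rule Z.subgroupI)
    show "coboundaries2 G \<subseteq> carrier (cocycles2 G)"
      using sub by (auto simp: coboundaries2_def)
    show "coboundaries2 G \<noteq> {}"
    proof -
      have "(\<lambda>x\<in>carrier G. 1) \<in> carrier G \<rightarrow>\<^sub>E UNIV - {0::complex}" by auto
      thus ?thesis unfolding coboundaries2_def by blast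
    qed
  next
    fix a b assume "a \<in> coboundaries2 G" "b \<in> coboundaries2 G"
    then obtain l m where l: "l \<in> carrier G \<rightarrow>\<^sub>E UNIV - {0}" "a = coboundary2 G l"
      and m: "m \<in> carrier G \<rightarrow>\<^sub>E UNIV - {0}" "b = coboundary2 G m"
      by (auto simp: coboundaries2_def)
    have "a \<otimes>\<^bsub>cocycles2 G\<^esub> b = coboundary2 G (\<lambda>x\<in>carrier G. l x * m x)"
      using l m by (auto simp: cocycles2_def coboundary2_def fun_eq_iff)
    thus "a \<otimes>\<^bsub>cocycles2 G\<^esub> b \<in> coboundaries2 G"
      using l m by (auto simp: coboundaries2_def PiE_iff intro!: imageI)
  next
    fix a assume "a \<in> coboundaries2 G"
    then obtain l where l: "l \<in> carrier G \<rightarrow>\<^sub>E UNIV - {0}" "a = coboundary2 G l"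
      by (auto simp: coboundaries2_def)
    let ?b = "coboundary2 G (\<lambda>x\<in>carrier G. inverse (l x))"
    have l': "(\<lambda>x\<in>carrier G. inverse (l x)) \<in> carrier G \<rightarrow>\<^sub>E UNIV - {0}"
      using l by (auto simp: PiE_iff)
    have "?b \<otimes>\<^bsub>cocycles2 G\<^esub> a = \<one>\<^bsub>cocycles2 G\<^esub>"
      using l by (auto simp: cocycles2_def coboundary2_def fun_eq_iff PiE_iff field_simps)
    hence "inv\<^bsub>cocycles2 G\<^esub> a = ?b"
      using sub[OF l'] sub[OF l(1)] l(2) Z.inv_equality by blast
    thus "inv\<^bsub>cocycles2 G\<^esub> a \<in> coboundaries2 G"
      using l' by (auto simp: coboundaries2_def)
  qed
qed

lemma comm_group_H2:
  assumes "group G"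
  shows "comm_group (H2 G)"
  unfolding H2_def
  using comm_group.abelian_FactGroup comm_group_cocycles2[OF assms] subgroup_coboundaries2[OF assms]
  by blast

lemma twisted_group_algebra_mult_basis:
  assumes "group G" and "finite (carrier G)" and "g \<in> carrier G" and "h \<in> carrier G"
  shows "(\<lambda>x\<in>carrier G. of_bool (x = g)) \<otimes>\<^bsub>twisted_group_algebra G \<alpha>\<^esub> (\<lambda>x\<in>carrier G. of_bool (x = h))
    = \<alpha> (g, h) \<odot>\<^bsub>twisted_group_algebra G \<alpha>\<^esub> (\<lambda>x\<in>carrier G. of_bool (x = g \<otimes>\<^bsub>G\<^esub> h))"
proof -
  have "(\<Sum>(u, v) | u \<in> carrier G \<and> v \<in> carrier G \<and> u \<otimes>\<^bsub>G\<^esub> v = x.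
      \<alpha> (u, v) * (\<lambda>x\<in>carrier G. of_bool (x = g)) u * (\<lambda>x\<in>carrier G. of_bool (x = h)) v)
    = \<alpha> (g, h) * of_bool (x = g \<otimes>\<^bsub>G\<^esub> h)" for x
  proof -
    let ?S = "{(u, v). u \<in> carrier G \<and> v \<in> carrier G \<and> u \<otimes>\<^bsub>G\<^esub> v = x}"
    have "finite ?S"
      by (rule finite_subset[of _ "carrier G \<times> carrier G"]) (use assms in auto)
    hence "(\<Sum>p\<in>?S. if p = (g, h) then \<alpha> (g, h) else 0) = \<alpha> (g, h) * of_bool (x = g \<otimes>\<^bsub>G\<^esub> h)"
      using assms by (auto simp: sum.delta)
    moreover have "(\<Sum>(u, v)\<in>?S.
      \<alpha> (u, v) * (\<lambda>x\<in>carrier G. of_bool (x = g)) u * (\<lambda>x\<in>carrier G. of_bool (x = h)) v)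
      = (\<Sum>p\<in>?S. if p = (g, h) then \<alpha> (g, h) else 0)"
      by (rule sum.cong) auto
    ultimately show ?thesis by simp
  qed
  thus ?thesis
    unfolding twisted_group_algebra_def by (auto simp: fun_eq_iff)
qed

lemma twisted_group_algebra_mult_apply:
  assumes "group G" and "x \<in> carrier G"
  shows "(a \<otimes>\<^bsub>twisted_group_algebra G \<alpha>\<^esub> b) x =
    (\<Sum>g\<in>carrier G. \<alpha> (g, inv\<^bsub>G\<^esub> g \<otimes>\<^bsub>G\<^esub> x) * a g * b (inv\<^bsub>G\<^esub> g \<otimes>\<^bsub>G\<^esub> x))"
proof -
  interpret group G by fact
  have "(\<Sum>(g, h) | g \<in> carrier G \<and> h \<in> carrier G \<and> g \<otimes>\<^bsub>G\<^esub> h = x. \<alpha> (g, h) * a g * b h)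
    = (\<Sum>g\<in>carrier G. \<alpha> (g, inv\<^bsub>G\<^esub> g \<otimes>\<^bsub>G\<^esub> x) * a g * b (inv\<^bsub>G\<^esub> g \<otimes>\<^bsub>G\<^esub> x))"
    by (rule sum.reindex_bij_witness[where j = fst and i = "\<lambda>g. (g, inv\<^bsub>G\<^esub> g \<otimes>\<^bsub>G\<^esub> x)"])
       (use assms in \<open>auto simp: m_assoc [symmetric]\<close>)
  thus ?thesis
    using assms by (simp add: twisted_group_algebra_def)
qed

lemma ring_twisted_group_algebra:
  assumes "group G" and "finite (carrier G)" and \<alpha>: "\<alpha> \<in> carrier (cocycles2 G)"
  shows "ring (twisted_group_algebra G \<alpha>)"
proof -
  interpret group G by fact
  let ?A = "twisted_group_algebra G \<alpha>"
  note mult = twisted_group_algebra_mult_apply[OF \<open>group G\<close>]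
  have nz: "\<alpha> (g, h) \<noteq> 0" if "g \<in> carrier G" "h \<in> carrier G" for g h
    using \<alpha> that by (auto simp: cocycles2_def PiE_iff)
  have coc: "\<alpha> (g, h) * \<alpha> (g \<otimes>\<^bsub>G\<^esub> h, k) = \<alpha> (g, h \<otimes>\<^bsub>G\<^esub> k) * \<alpha> (h, k)"
    if "g \<in> carrier G" "h \<in> carrier G" "k \<in> carrier G" for g h k
    using \<alpha> that by (auto simp: cocycles2_def)
  define e where "e = \<alpha> (\<one>\<^bsub>G\<^esub>, \<one>\<^bsub>G\<^esub>)"
  have e: "e \<noteq> 0" by (simp add: e_def nz)
  have one_l: "\<alpha> (\<one>\<^bsub>G\<^esub>, x) = e" if "x \<in> carrier G" for x
    using coc[of "\<one>\<^bsub>G\<^esub>" "\<one>\<^bsub>G\<^esub>" x] nz[of "\<one>\<^bsub>G\<^esub>" x] that by (simp add: e_def)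
  have one_r: "\<alpha> (x, \<one>\<^bsub>G\<^esub>) = e" if "x \<in> carrier G" for x
    using coc[of x "\<one>\<^bsub>G\<^esub>" "\<one>\<^bsub>G\<^esub>"] nz[of x "\<one>\<^bsub>G\<^esub>"] that by (simp add: e_def)
  have carr: "carrier ?A = carrier G \<rightarrow>\<^sub>E UNIV"
    and one: "\<one>\<^bsub>?A\<^esub> = (\<lambda>x\<in>carrier G. if x = \<one>\<^bsub>G\<^esub> then inverse e else 0)"
    and add: "\<And>a b. a \<oplus>\<^bsub>?A\<^esub> b = (\<lambda>x\<in>carrier G. a x + b x)"
    and zero: "\<zero>\<^bsub>?A\<^esub> = (\<lambda>x\<in>carrier G. 0)"
    unfolding e_def by (simp_all add: twisted_group_algebra_def)
  have mult_closed: "a \<otimes>\<^bsub>?A\<^esub> b \<in> carrier ?A" for a b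
    by (simp add: twisted_group_algebra_def)
  have eqI: "a = b" if "a \<in> carrier ?A" "b \<in> carrier ?A" "\<And>x. x \<in> carrier G \<Longrightarrow> a x = b x" for a b
    using that unfolding carr by (auto intro: PiE_ext)
  show ?thesis
  proof (rule ringI)
    show "abelian_group ?A"
    proof (rule abelian_groupI)
      fix a assume a: "a \<in> carrier ?A"
      show "\<exists>b\<in>carrier ?A. b \<oplus>\<^bsub>?A\<^esub> a = \<zero>\<^bsub>?A\<^esub>"
        by (rule bexI[of _ "\<lambda>x\<in>carrier G. - a x"]) (auto simp: carr add zero)
      show "\<zero>\<^bsub>?A\<^esub> \<oplus>\<^bsub>?A\<^esub> a = a"
        using a by (intro eqI) (auto simp: carr add zero)
    qed (auto simp: carr add zero fun_eq_iff add_ac)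
  next
    show "monoid ?A"
    proof (rule monoidI)
      show "\<one>\<^bsub>?A\<^esub> \<in> carrier ?A" by (auto simp: carr one)
    next
      fix a assume a: "a \<in> carrier ?A"
      have "(\<one>\<^bsub>?A\<^esub> \<otimes>\<^bsub>?A\<^esub> a) x = a x" if x: "x \<in> carrier G" for x
      proof -
        have "(\<one>\<^bsub>?A\<^esub> \<otimes>\<^bsub>?A\<^esub> a) x = (\<Sum>g\<in>carrier G. if g = \<one>\<^bsub>G\<^esub> then a x else 0)"
          unfolding mult[OF x] by (rule sum.cong) (use x in \<open>auto simp: one one_l e\<close>)
        thus ?thesis using assms(2) by simp
      qed
      thus "\<one>\<^bsub>?A\<^esub> \<otimes>\<^bsub>?A\<^esub> a = a" using a mult_closed by (intro eqI)
      have "(a \<otimes>\<^bsub>?A\<^esub> \<one>\<^bsub>?A\<^esub>) x = a x" if x: "x \<in> carrier G" for x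
      proof -
        have "(a \<otimes>\<^bsub>?A\<^esub> \<one>\<^bsub>?A\<^esub>) x = (\<Sum>g\<in>carrier G. if g = x then a x else 0)"
          unfolding mult[OF x]
        proof (rule sum.cong)
          fix g assume g: "g \<in> carrier G"
          have "inv\<^bsub>G\<^esub> g \<otimes>\<^bsub>G\<^esub> x = \<one>\<^bsub>G\<^esub> \<longleftrightarrow> g = x"
            using g x by (metis inv_closed inv_inv inv_equality l_inv)
          thus "\<alpha> (g, inv\<^bsub>G\<^esub> g \<otimes>\<^bsub>G\<^esub> x) * a g * \<one>\<^bsub>?A\<^esub> (inv\<^bsub>G\<^esub> g \<otimes>\<^bsub>G\<^esub> x) = (if g = x then a x else 0)"
            using x g by (auto simp: one one_r e)
        qed simp
        thus ?thesis using x assms(2) by simp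
      qed
      thus "a \<otimes>\<^bsub>?A\<^esub> \<one>\<^bsub>?A\<^esub> = a" using a mult_closed by (intro eqI)
    next
      fix a b c
      show "(a \<otimes>\<^bsub>?A\<^esub> b) \<otimes>\<^bsub>?A\<^esub> c = a \<otimes>\<^bsub>?A\<^esub> (b \<otimes>\<^bsub>?A\<^esub> c)"
      proof (intro eqI mult_closed)
        fix x assume x: "x \<in> carrier G"
        let ?i = "\<lambda>g. inv\<^bsub>G\<^esub> g"
        have "((a \<otimes>\<^bsub>?A\<^esub> b) \<otimes>\<^bsub>?A\<^esub> c) x = (\<Sum>y\<in>carrier G. \<Sum>g\<in>carrier G.
            \<alpha> (y, ?i y \<otimes>\<^bsub>G\<^esub> x) * (\<alpha> (g, ?i g \<otimes>\<^bsub>G\<^esub> y) * a g * b (?i g \<otimes>\<^bsub>G\<^esub> y)) * c (?i y \<otimes>\<^bsub>G\<^esub> x))"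
          unfolding mult[OF x]
          by (rule sum.cong) (simp_all add: mult sum_distrib_left sum_distrib_right)
        also have "\<dots> = (\<Sum>g\<in>carrier G. \<Sum>y\<in>carrier G.
            \<alpha> (y, ?i y \<otimes>\<^bsub>G\<^esub> x) * (\<alpha> (g, ?i g \<otimes>\<^bsub>G\<^esub> y) * a g * b (?i g \<otimes>\<^bsub>G\<^esub> y)) * c (?i y \<otimes>\<^bsub>G\<^esub> x))"
          by (rule sum.swap)
        also have "\<dots> = (\<Sum>g\<in>carrier G. \<Sum>h\<in>carrier G. \<alpha> (g, ?i g \<otimes>\<^bsub>G\<^esub> x) * a g *
            (\<alpha> (h, ?i h \<otimes>\<^bsub>G\<^esub> (?i g \<otimes>\<^bsub>G\<^esub> x)) * b h * c (?i h \<otimes>\<^bsub>G\<^esub> (?i g \<otimes>\<^bsub>G\<^esub> x))))"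
        proof (rule sum.cong)
          fix g assume g: "g \<in> carrier G"
          show "(\<Sum>y\<in>carrier G. \<alpha> (y, ?i y \<otimes>\<^bsub>G\<^esub> x) *
              (\<alpha> (g, ?i g \<otimes>\<^bsub>G\<^esub> y) * a g * b (?i g \<otimes>\<^bsub>G\<^esub> y)) * c (?i y \<otimes>\<^bsub>G\<^esub> x))
            = (\<Sum>h\<in>carrier G. \<alpha> (g, ?i g \<otimes>\<^bsub>G\<^esub> x) * a g *
              (\<alpha> (h, ?i h \<otimes>\<^bsub>G\<^esub> (?i g \<otimes>\<^bsub>G\<^esub> x)) * b h * c (?i h \<otimes>\<^bsub>G\<^esub> (?i g \<otimes>\<^bsub>G\<^esub> x))))"
          proof (rule sum.reindex_bij_witness[where j = "\<lambda>y. ?i g \<otimes>\<^bsub>G\<^esub> y" and i = "\<lambda>h. g \<otimes>\<^bsub>G\<^esub> h"])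
            fix y assume y: "y \<in> carrier G"
            define h k where "h = ?i g \<otimes>\<^bsub>G\<^esub> y" and "k = ?i y \<otimes>\<^bsub>G\<^esub> x"
            have hk: "h \<in> carrier G" "k \<in> carrier G" "y = g \<otimes>\<^bsub>G\<^esub> h"
              using g x y by (auto simp: h_def k_def m_assoc [symmetric])
            have "h \<otimes>\<^bsub>G\<^esub> k = ?i g \<otimes>\<^bsub>G\<^esub> x"
              using g x y by (simp add: h_def k_def m_assoc) (simp add: m_assoc [symmetric])
            moreover have "?i h \<otimes>\<^bsub>G\<^esub> (?i g \<otimes>\<^bsub>G\<^esub> x) = k"
              using g x y hk by (simp add: k_def inv_mult_group m_assoc)
            ultimately show "\<alpha> (g, ?i g \<otimes>\<^bsub>G\<^esub> x) * a g *
              (\<alpha> (?i g \<otimes>\<^bsub>G\<^esub> y, ?i (?i g \<otimes>\<^bsub>G\<^esub> y) \<otimes>\<^bsub>G\<^esub> (?i g \<otimes>\<^bsub>G\<^esub> x)) * b (?i g \<otimes>\<^bsub>G\<^esub> y) *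
                c (?i (?i g \<otimes>\<^bsub>G\<^esub> y) \<otimes>\<^bsub>G\<^esub> (?i g \<otimes>\<^bsub>G\<^esub> x))) =
              \<alpha> (y, ?i y \<otimes>\<^bsub>G\<^esub> x) * (\<alpha> (g, ?i g \<otimes>\<^bsub>G\<^esub> y) * a g * b (?i g \<otimes>\<^bsub>G\<^esub> y)) * c (?i y \<otimes>\<^bsub>G\<^esub> x)"
              using coc[OF g hk(1,2)] hk(3)
              unfolding h_def [symmetric] k_def [symmetric]
              by (simp add: mult_ac)
          qed (use g in \<open>auto simp: m_assoc [symmetric]\<close>)
        qed simp
        also have "\<dots> = (a \<otimes>\<^bsub>?A\<^esub> (b \<otimes>\<^bsub>?A\<^esub> c)) x"
          unfolding mult[OF x] by (rule sum.cong) (simp_all add: mult x sum_distrib_left)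
        finally show "((a \<otimes>\<^bsub>?A\<^esub> b) \<otimes>\<^bsub>?A\<^esub> c) x = (a \<otimes>\<^bsub>?A\<^esub> (b \<otimes>\<^bsub>?A\<^esub> c)) x" .
      qed
    qed (rule mult_closed)
  next
    fix a b c
    show "(a \<oplus>\<^bsub>?A\<^esub> b) \<otimes>\<^bsub>?A\<^esub> c = a \<otimes>\<^bsub>?A\<^esub> c \<oplus>\<^bsub>?A\<^esub> b \<otimes>\<^bsub>?A\<^esub> c"
      by (rule eqI[OF mult_closed])
         (auto simp: carr mult add algebra_simps sum.distrib intro!: mult_closed)
    show "c \<otimes>\<^bsub>?A\<^esub> (a \<oplus>\<^bsub>?A\<^esub> b) = c \<otimes>\<^bsub>?A\<^esub> a \<oplus>\<^bsub>?A\<^esub> c \<otimes>\<^bsub>?A\<^esub> b"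
      by (rule eqI[OF mult_closed])
         (auto simp: carr mult add algebra_simps sum.distrib intro!: mult_closed)
  qed
qed

lemma twisted_group_algebra_cohomologous:
  assumes "group G" and "l \<in> carrier G \<rightarrow>\<^sub>E UNIV - {0}"
    and "\<alpha> \<in> carrier (cocycles2 G)"
  shows "complex_algebra_iso
    (twisted_group_algebra G (\<alpha> \<otimes>\<^bsub>cocycles2 G\<^esub> coboundary2 G l)) (twisted_group_algebra G \<alpha>) \<noteq> {}"
proof -
  interpret group G by fact
  let ?\<beta> = "\<alpha> \<otimes>\<^bsub>cocycles2 G\<^esub> coboundary2 G l"
  let ?A = "twisted_group_algebra G ?\<beta>" and ?B = "twisted_group_algebra G \<alpha>"
  define f where "f a = (\<lambda>x\<in>carrier G. l x * a x)" for a
  have l: "l x \<noteq> 0" if "x \<in> carrier G" for x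
    using assms(2) that by (auto simp: PiE_iff)
  have \<beta>: "?\<beta> (g, h) = \<alpha> (g, h) * (l g * l h / l (g \<otimes>\<^bsub>G\<^esub> h))"
    if "g \<in> carrier G" "h \<in> carrier G" for g h
    using that by (simp add: cocycles2_def coboundary2_def)
  have carr: "carrier ?A = carrier G \<rightarrow>\<^sub>E UNIV" "carrier ?B = carrier G \<rightarrow>\<^sub>E UNIV"
    by (simp_all add: twisted_group_algebra_def)
  have "f (a \<otimes>\<^bsub>?A\<^esub> b) = f a \<otimes>\<^bsub>?B\<^esub> f b" for a b
  proof
    fix x
    show "f (a \<otimes>\<^bsub>?A\<^esub> b) x = (f a \<otimes>\<^bsub>?B\<^esub> f b) x"
    proof (cases "x \<in> carrier G")
      case True
      have "l x * (?\<beta> (g, inv\<^bsub>G\<^esub> g \<otimes>\<^bsub>G\<^esub> x) * a g * b (inv\<^bsub>G\<^esub> g \<otimes>\<^bsub>G\<^esub> x))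
          = \<alpha> (g, inv\<^bsub>G\<^esub> g \<otimes>\<^bsub>G\<^esub> x) * f a g * f b (inv\<^bsub>G\<^esub> g \<otimes>\<^bsub>G\<^esub> x)"
        if g: "g \<in> carrier G" for g
      proof -
        have "g \<otimes>\<^bsub>G\<^esub> (inv\<^bsub>G\<^esub> g \<otimes>\<^bsub>G\<^esub> x) = x"
          using g True by (simp add: m_assoc [symmetric])
        thus ?thesis
          using g True l[OF True] by (simp add: \<beta> f_def)
      qed
      thus ?thesis
        using True
        by (simp add: f_def[of "a \<otimes>\<^bsub>?A\<^esub> b"] twisted_group_algebra_mult_apply[OF \<open>group G\<close>]
            sum_distrib_left)
    qed (simp add: f_def twisted_group_algebra_def)
  qed
  moreover have "f (a \<oplus>\<^bsub>?A\<^esub> b) = f a \<oplus>\<^bsub>?B\<^esub> f b" for a b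
    by (auto simp: f_def twisted_group_algebra_def fun_eq_iff algebra_simps)
  moreover have "f \<one>\<^bsub>?A\<^esub> = \<one>\<^bsub>?B\<^esub>"
    using l[of "\<one>\<^bsub>G\<^esub>"] \<beta>[of "\<one>\<^bsub>G\<^esub>" "\<one>\<^bsub>G\<^esub>"]
    by (auto simp: f_def twisted_group_algebra_def fun_eq_iff field_simps)
  moreover have "f (c \<odot>\<^bsub>?A\<^esub> a) = c \<odot>\<^bsub>?B\<^esub> f a" for c a
    by (auto simp: f_def twisted_group_algebra_def fun_eq_iff algebra_simps)
  moreover have "bij_betw f (carrier ?A) (carrier ?B)"
    unfolding carr
    by (rule bij_betw_byWitness[where f' = "\<lambda>a. \<lambda>x\<in>carrier G. a x / l x"])
       (auto simp: f_def l fun_eq_iff PiE_iff extensional_def)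
  moreover have "f a \<in> carrier ?B" for a
    by (simp add: carr f_def)
  ultimately have "f \<in> complex_algebra_iso ?A ?B"
    by (auto simp: complex_algebra_iso_def ring_iso_def ring_hom_def)
  thus ?thesis by blast
qed

end

theory Submission
  imports "HOL-Library.Function_Algebras" "Jordan_Normal_Form.Char_Poly" Defs
begin

text \<open>By induction on the number of factors it suffices to treat two factors \<open>G\<close> and \<open>K\<close> of
  coprime orders. Since \<open>H\<^sup>2(G)\<close> is annihilated by \<open>|G|\<close> and the commutator pairing
  \<open>\<gamma>(g,h) / \<gamma>(h,g)\<close> of a cocycle on \<open>G \<times> K\<close> is trivial, \<open>H\<^sup>2(G \<times> K) = H\<^sup>2(G) \<times> H\<^sup>2(K)\<close>, and
  \<open>H\<^sup>2(G)\<close> is the \<open>|G|\<close>-torsion part; moreover the twisted group algebra of a product cocycle is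
  the tensor product of the two twisted group algebras. This gives one direction, and reduces the
  other one to a cancellation statement: if \<open>A \<otimes> B \<cong> A' \<otimes> B'\<close>, where \<open>A, A'\<close> belong to groups of order
  \<open>k\<close> and \<open>B, B'\<close> are untwisted group algebras of groups of order prime to \<open>k\<close>, then \<open>A \<cong> A'\<close>.

  For this, split the algebras into blocks, one for every primitive central idempotent. The blocks of
  \<open>A \<otimes> B\<close> are the tensor products of blocks, and the dimension of a block divides the square of the
  group order. So the blocks of \<open>A \<otimes> B\<close> whose dimension is prime to the order of the second group are
  the products of a block of \<open>A\<close> with a one-dimensional block of \<open>B\<close>, and such a product is isomorphic
  to the block of \<open>A\<close>. Hence every isomorphism type of blocks occurs in \<open>A\<close> and in \<open>A'\<close> with the same
  multiplicity, up to a common factor, which is \<open>1\<close> by comparing total dimensions.\<close>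

section \<open>Cohomology classes and pullbacks\<close>

text \<open>The isomorphism of cohomology groups in the relation is arbitrary, so it can be compared
  with the factors only through intrinsic data. Torsion is such data: it forces classes inflated
  from one factor to correspond to classes inflated from the matching factor. The algebras to be
  cancelled then carry the trivial cocycle on the second factor. These second factors have equal
  order, but no isomorphism between them is given, so there is no common tensor factor to cancel;
  even the numbers of their one-dimensional blocks are compared only through total dimensions.
  Triviality of the cocycle guarantees at least one such block, from the trivial representation.
  Blocks are never identified with matrix algebras: primitive central idempotents, their traces and
  the dimensions of their ideals suffice, and semisimplicity enters as the absence of nonzero
  central elements of square zero. Divisibility by the dimension is an integrality statement; it
  becomes visible after passing to a cohomologous cocycle with values in roots of unity, because
  multiplication then acts on a finite set of multiples of basis elements.\<close>

lemma cocycle2_nz: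
  "\<alpha> \<in> carrier (cocycles2 G) \<Longrightarrow> g \<in> carrier G \<Longrightarrow> h \<in> carrier G \<Longrightarrow> \<alpha> (g, h) \<noteq> 0"
  by (auto simp: cocycles2_def PiE_iff)

lemma cocycle2_assoc:
  assumes "\<alpha> \<in> carrier (cocycles2 G)" "g \<in> carrier G" "h \<in> carrier G" "k \<in> carrier G"
  shows "\<alpha> (g, h) * \<alpha> (g \<otimes>\<^bsub>G\<^esub> h, k) = \<alpha> (g, h \<otimes>\<^bsub>G\<^esub> k) * \<alpha> (h, k)"
  using assms by (auto simp: cocycles2_def)

lemma restrict_mem_cocycles2:
  assumes "\<And>g h. g \<in> carrier G \<Longrightarrow> h \<in> carrier G \<Longrightarrow> \<alpha> (g, h) \<noteq> 0"
    and "\<And>g h k. g \<in> carrier G \<Longrightarrow> h \<in> carrier G \<Longrightarrow> k \<in> carrier G \<Longrightarrow>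
      \<alpha> (g, h) * \<alpha> (g \<otimes>\<^bsub>G\<^esub> h, k) = \<alpha> (g, h \<otimes>\<^bsub>G\<^esub> k) * \<alpha> (h, k)"
    and "group G"
  shows "restrict \<alpha> (carrier G \<times> carrier G) \<in> carrier (cocycles2 G)"
proof -
  interpret group G by fact
  show ?thesis using assms(1,2) by (auto simp: cocycles2_def)
qed

lemma cocycles2_mult_apply:
  "g \<in> carrier G \<Longrightarrow> h \<in> carrier G \<Longrightarrow> (\<alpha> \<otimes>\<^bsub>cocycles2 G\<^esub> \<beta>) (g, h) = \<alpha> (g, h) * \<beta> (g, h)"
  by (simp add: cocycles2_def)

lemma cocycles2_one_apply:
  "g \<in> carrier G \<Longrightarrow> h \<in> carrier G \<Longrightarrow> \<one>\<^bsub>cocycles2 G\<^esub> (g, h) = 1"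
  by (simp add: cocycles2_def)

lemma cocycles2_pow_apply:
  "g \<in> carrier G \<Longrightarrow> h \<in> carrier G \<Longrightarrow> (\<alpha> [^]\<^bsub>cocycles2 G\<^esub> (n::nat)) (g, h) = \<alpha> (g, h) ^ n"
proof (induction n)
  case 0
  thus ?case by (simp add: nat_pow_def cocycles2_one_apply)
next
  case (Suc n)
  thus ?case by (simp add: nat_pow_def cocycles2_mult_apply)
qed

lemma cocycles2_eqI:
  assumes "\<alpha> \<in> carrier (cocycles2 G)" "\<beta> \<in> carrier (cocycles2 G)"
    and "\<And>g h. g \<in> carrier G \<Longrightarrow> h \<in> carrier G \<Longrightarrow> \<alpha> (g, h) = \<beta> (g, h)"
  shows "\<alpha> = \<beta>"
proof (rule PiE_ext)
  show "\<alpha> \<in> carrier G \<times> carrier G \<rightarrow>\<^sub>E UNIV - {0}" "\<beta> \<in> carrier G \<times> carrier G \<rightarrow>\<^sub>E UNIV - {0}"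
    using assms(1,2) by (auto simp: cocycles2_def)
qed (use assms(3) in auto)

definition cohomology_class :: "('a, 'm) monoid_scheme \<Rightarrow> ('a \<times> 'a \<Rightarrow> complex) \<Rightarrow> ('a \<times> 'a \<Rightarrow> complex) set"
  where "cohomology_class G \<alpha> = coboundaries2 G #>\<^bsub>cocycles2 G\<^esub> \<alpha>"

lemma normal_coboundaries2:
  assumes "group G"
  shows "coboundaries2 G \<lhd> cocycles2 G"
proof -
  interpret Z: comm_group "cocycles2 G" by (rule comm_group_cocycles2) fact
  show ?thesis using Z.subgroup_imp_normal subgroup_coboundaries2[OF assms] by blast
qed

lemma carrier_H2: "carrier (H2 G) = cohomology_class G ` carrier (cocycles2 G)"
  by (simp add: H2_def carrier_FactGroup cohomology_class_def)

lemma cohomology_class_mult: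
  assumes "group G" "\<alpha> \<in> carrier (cocycles2 G)" "\<beta> \<in> carrier (cocycles2 G)"
  shows "cohomology_class G \<alpha> \<otimes>\<^bsub>H2 G\<^esub> cohomology_class G \<beta> = cohomology_class G (\<alpha> \<otimes>\<^bsub>cocycles2 G\<^esub> \<beta>)"
  using normal.rcos_sum[OF normal_coboundaries2[OF assms(1)] assms(2,3)]
  by (simp add: H2_def cohomology_class_def)

lemma cohomology_class_one:
  assumes "group G"
  shows "cohomology_class G \<one>\<^bsub>cocycles2 G\<^esub> = \<one>\<^bsub>H2 G\<^esub>"
proof -
  interpret Z: comm_group "cocycles2 G" by (rule comm_group_cocycles2) fact
  show ?thesis
    unfolding H2_def cohomology_class_def one_FactGroup
    using subgroup_coboundaries2[OF assms] Z.coset_mult_one subgroup.subset by blast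
qed

lemma cohomology_class_pow:
  assumes "group G" "\<alpha> \<in> carrier (cocycles2 G)"
  shows "cohomology_class G \<alpha> [^]\<^bsub>H2 G\<^esub> (n::nat) = cohomology_class G (\<alpha> [^]\<^bsub>cocycles2 G\<^esub> n)"
  using normal.FactGroup_pow[OF normal_coboundaries2[OF assms(1)] assms(2)]
  by (simp add: H2_def cohomology_class_def)

lemma coboundaries2_alt:
  assumes "group G"
  shows "coboundaries2 G = coboundary2 G ` (carrier G \<rightarrow> UNIV - {0})"
proof -
  interpret group G by fact
  show ?thesis
  proof
    show "coboundaries2 G \<subseteq> coboundary2 G ` (carrier G \<rightarrow> UNIV - {0})"
      unfolding coboundaries2_def by (rule image_mono) auto
    show "coboundary2 G ` (carrier G \<rightarrow> UNIV - {0}) \<subseteq> coboundaries2 G"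
    proof
      fix x assume "x \<in> coboundary2 G ` (carrier G \<rightarrow> UNIV - {0})"
      then obtain l where l: "l \<in> carrier G \<rightarrow> UNIV - {0}" "x = coboundary2 G l" by auto
      hence "x = coboundary2 G (restrict l (carrier G))" "restrict l (carrier G) \<in> carrier G \<rightarrow>\<^sub>E UNIV - {0}"
        by (auto simp: coboundary2_def fun_eq_iff)
      thus "x \<in> coboundaries2 G" unfolding coboundaries2_def by blast
    qed
  qed
qed

text \<open>The coboundary factor is multiplied out, which leaves no division: comparing two
  cocycles later amounts to checking a monomial identity for a guessed \<open>l\<close>.\<close>

lemma mem_cohomology_class:
  assumes "group G" "\<alpha> \<in> carrier (cocycles2 G)"
  shows "\<beta> \<in> cohomology_class G \<alpha> \<longleftrightarrow> \<beta> \<in> carrier (cocycles2 G) \<and>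
    (\<exists>l\<in>carrier G \<rightarrow> UNIV - {0}. \<forall>g\<in>carrier G. \<forall>h\<in>carrier G.
      \<beta> (g, h) * l (g \<otimes>\<^bsub>G\<^esub> h) = \<alpha> (g, h) * l g * l h)"
    (is "_ \<longleftrightarrow> _ \<and> ?R")
proof -
  interpret G: group G by fact
  interpret Z: comm_group "cocycles2 G" by (rule comm_group_cocycles2) fact
  have *: "\<beta> \<in> cohomology_class G \<alpha> \<longleftrightarrow> (\<exists>l\<in>carrier G \<rightarrow> UNIV - {0}. \<beta> = coboundary2 G l \<otimes>\<^bsub>cocycles2 G\<^esub> \<alpha>)"
    unfolding cohomology_class_def r_coset_def coboundaries2_alt[OF assms(1)] by auto
  have cb: "coboundary2 G l \<in> carrier (cocycles2 G)" if "l \<in> carrier G \<rightarrow> UNIV - {0}" for l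
    using subgroup.subset[OF subgroup_coboundaries2[OF assms(1)]] that
    unfolding coboundaries2_alt[OF assms(1)] by blast
  have nz: "l \<in> carrier G \<rightarrow> UNIV - {0} \<Longrightarrow> x \<in> carrier G \<Longrightarrow> l x \<noteq> 0" for l :: "'a \<Rightarrow> complex" and x
    by auto
  have ap: "(coboundary2 G l \<otimes>\<^bsub>cocycles2 G\<^esub> \<alpha>) (g, h) * l (g \<otimes>\<^bsub>G\<^esub> h) = \<alpha> (g, h) * l g * l h"
    if "l \<in> carrier G \<rightarrow> UNIV - {0}" "g \<in> carrier G" "h \<in> carrier G" for l g h
    using that nz[OF that(1), of "g \<otimes>\<^bsub>G\<^esub> h"] by (simp add: cocycles2_mult_apply coboundary2_def)
  show ?thesis
  proof
    assume "\<beta> \<in> cohomology_class G \<alpha>"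
    then obtain l where l: "l\<in>carrier G \<rightarrow> UNIV - {0}" "\<beta> = coboundary2 G l \<otimes>\<^bsub>cocycles2 G\<^esub> \<alpha>"
      unfolding * by blast
    show "\<beta> \<in> carrier (cocycles2 G) \<and> ?R"
      using l cb[OF l(1)] assms(2) ap[OF l(1)] by blast
  next
    assume R: "\<beta> \<in> carrier (cocycles2 G) \<and> ?R"
    then obtain l where l: "l\<in>carrier G \<rightarrow> UNIV - {0}" 
      "\<And>g h. g \<in> carrier G \<Longrightarrow> h \<in> carrier G \<Longrightarrow> \<beta> (g, h) * l (g \<otimes>\<^bsub>G\<^esub> h) = \<alpha> (g, h) * l g * l h"
      by blast
    have "\<beta> = coboundary2 G l \<otimes>\<^bsub>cocycles2 G\<^esub> \<alpha>"
    proof (rule cocycles2_eqI)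
      fix g h assume gh: "g \<in> carrier G" "h \<in> carrier G"
      show "\<beta> (g, h) = (coboundary2 G l \<otimes>\<^bsub>cocycles2 G\<^esub> \<alpha>) (g, h)"
        using ap[OF l(1) gh] l(2)[OF gh] nz[OF l(1), of "g \<otimes>\<^bsub>G\<^esub> h"] gh
          by (metis G.m_closed mult_right_cancel)
    qed (use R cb[OF l(1)] assms(2) in auto)
    thus "\<beta> \<in> cohomology_class G \<alpha>" unfolding * using l(1) by blast
  qed
qed

lemma cohomology_class_self:
  assumes "group G" "\<alpha> \<in> carrier (cocycles2 G)"
  shows "\<alpha> \<in> cohomology_class G \<alpha>"
proof -
  interpret Z: comm_group "cocycles2 G" by (rule comm_group_cocycles2) fact
  show ?thesis unfolding cohomology_class_def
    using Z.rcos_self[OF _ subgroup_coboundaries2[OF assms(1)]] assms(2) by simp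
qed

lemma cohomology_class_eq_iff_mem:
  assumes "group G" "\<alpha> \<in> carrier (cocycles2 G)" "\<beta> \<in> carrier (cocycles2 G)"
  shows "cohomology_class G \<beta> = cohomology_class G \<alpha> \<longleftrightarrow> \<beta> \<in> cohomology_class G \<alpha>"
proof -
  interpret Z: comm_group "cocycles2 G" by (rule comm_group_cocycles2) fact
  show ?thesis
  proof
    assume "cohomology_class G \<beta> = cohomology_class G \<alpha>"
    thus "\<beta> \<in> cohomology_class G \<alpha>" using cohomology_class_self[OF assms(1,3)] by simp
  next
    assume "\<beta> \<in> cohomology_class G \<alpha>"
    thus "cohomology_class G \<beta> = cohomology_class G \<alpha>" unfolding cohomology_class_def
      by (intro Z.repr_independence[OF _ assms(2) subgroup_coboundaries2[OF assms(1)], symmetric])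
  qed
qed

lemma cohomology_class_eq_iff:
  assumes "group G" "\<alpha> \<in> carrier (cocycles2 G)" "\<beta> \<in> carrier (cocycles2 G)"
  shows "cohomology_class G \<beta> = cohomology_class G \<alpha> \<longleftrightarrow>
    (\<exists>l\<in>carrier G \<rightarrow> UNIV - {0}. \<forall>g\<in>carrier G. \<forall>h\<in>carrier G.
      \<beta> (g, h) * l (g \<otimes>\<^bsub>G\<^esub> h) = \<alpha> (g, h) * l g * l h)"
  using assms(3)
  by (simp only: cohomology_class_eq_iff_mem[OF assms] mem_cohomology_class[OF assms(1,2)] simp_thms)

lemma cohomology_class_eq_of_mem:
  assumes "group G" "\<alpha> \<in> carrier (cocycles2 G)" "\<beta> \<in> cohomology_class G \<alpha>"
  shows "\<beta> \<in> carrier (cocycles2 G)" "cohomology_class G \<beta> = cohomology_class G \<alpha>"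
proof -
  show *: "\<beta> \<in> carrier (cocycles2 G)"
    using assms(3) by (simp only: mem_cohomology_class[OF assms(1,2)])
  show "cohomology_class G \<beta> = cohomology_class G \<alpha>"
    using assms(3) by (simp only: cohomology_class_eq_iff_mem[OF assms(1,2) *])
qed

section \<open>Functoriality of the second cohomology group\<close>

definition pullback2 :: "('a, 'm) monoid_scheme \<Rightarrow> ('a \<Rightarrow> 'b) \<Rightarrow> ('b \<times> 'b \<Rightarrow> complex) \<Rightarrow> 'a \<times> 'a \<Rightarrow> complex"
  where "pullback2 G f \<gamma> = (\<lambda>(g, h)\<in>carrier G \<times> carrier G. \<gamma> (f g, f h))"

text \<open>A class is a set of cocycles, so the induced map has to choose a representative;
  \<open>H2_map_class\<close> shows that the choice is immaterial. The map is contravariant: a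
  homomorphism from \<open>G\<close> to \<open>H\<close> sends \<open>H2 H\<close> to
  \<open>H2 G\<close>.\<close>

definition H2_map :: "('a, 'm) monoid_scheme \<Rightarrow> ('a \<Rightarrow> 'b) \<Rightarrow> ('b \<times> 'b \<Rightarrow> complex) set \<Rightarrow> ('a \<times> 'a \<Rightarrow> complex) set"
  where "H2_map G f c = cohomology_class G (pullback2 G f (SOME \<gamma>. \<gamma> \<in> c))"

lemma pullback2_apply:
  "g \<in> carrier G \<Longrightarrow> h \<in> carrier G \<Longrightarrow> pullback2 G f \<gamma> (g, h) = \<gamma> (f g, f h)"
  by (simp add: pullback2_def)

lemma pullback2_cocycle:
  assumes "group G" "group H" "f \<in> hom G H" "\<gamma> \<in> carrier (cocycles2 H)"
  shows "pullback2 G f \<gamma> \<in> carrier (cocycles2 G)"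
proof -
  interpret group G by fact
  have f: "f x \<in> carrier H" if "x \<in> carrier G" for x using assms(3) that by (auto simp: hom_def)
  have "restrict (\<lambda>(g, h). \<gamma> (f g, f h)) (carrier G \<times> carrier G) \<in> carrier (cocycles2 G)"
    by (rule restrict_mem_cocycles2)
      (use assms f in \<open>auto simp: hom_mult[OF assms(3)] cocycle2_nz cocycle2_assoc\<close>)
  thus ?thesis by (simp add: pullback2_def)
qed

text \<open>If two representatives differ by the coboundary of \<open>l\<close>, their pullbacks
  differ by the coboundary of \<open>l \<circ> f\<close>.\<close>

lemma H2_map_class:
  assumes "group G" "group H" "f \<in> hom G H" "\<gamma> \<in> carrier (cocycles2 H)"
  shows "H2_map G f (cohomology_class H \<gamma>) = cohomology_class G (pullback2 G f \<gamma>)"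
proof -
  define \<delta> where "\<delta> = (SOME \<delta>. \<delta> \<in> cohomology_class H \<gamma>)"
  have "\<delta> \<in> cohomology_class H \<gamma>"
    unfolding \<delta>_def by (rule someI[of _ \<gamma>]) (rule cohomology_class_self[OF assms(2,4)])
  then obtain l where d: "\<delta> \<in> carrier (cocycles2 H)" and l: "l \<in> carrier H \<rightarrow> UNIV - {0}"
    "\<And>g h. g \<in> carrier H \<Longrightarrow> h \<in> carrier H \<Longrightarrow> \<delta> (g, h) * l (g \<otimes>\<^bsub>H\<^esub> h) = \<gamma> (g, h) * l g * l h"
    using mem_cohomology_class[OF assms(2,4)] by blast
  have f: "f x \<in> carrier H" if "x \<in> carrier G" for x using assms(3) that by (auto simp: hom_def)
  have "cohomology_class G (pullback2 G f \<delta>) = cohomology_class G (pullback2 G f \<gamma>)"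
    unfolding cohomology_class_eq_iff[OF assms(1) pullback2_cocycle[OF assms] pullback2_cocycle[OF assms(1-3) d]]
    by (rule bexI[of _ "l \<circ> f"]) (use l f in \<open>auto simp: pullback2_apply hom_mult[OF assms(3)]\<close>)
  thus ?thesis by (simp add: H2_map_def \<delta>_def)
qed

lemma H2_map_hom:
  assumes "group G" "group H" "f \<in> hom G H"
  shows "H2_map G f \<in> hom (H2 H) (H2 G)"
proof (rule homI)
  fix c assume "c \<in> carrier (H2 H)"
  thus "H2_map G f c \<in> carrier (H2 G)"
    using pullback2_cocycle[OF assms] by (auto simp: carrier_H2 H2_map_class[OF assms])
next
  fix c d assume "c \<in> carrier (H2 H)" "d \<in> carrier (H2 H)"
  then obtain \<gamma> \<delta> where gd: "\<gamma> \<in> carrier (cocycles2 H)" "\<delta> \<in> carrier (cocycles2 H)"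
    "c = cohomology_class H \<gamma>" "d = cohomology_class H \<delta>" by (auto simp: carrier_H2)
  interpret ZH: comm_group "cocycles2 H" by (rule comm_group_cocycles2) fact
  interpret ZG: comm_group "cocycles2 G" by (rule comm_group_cocycles2) fact
  have f: "f x \<in> carrier H" if "x \<in> carrier G" for x using assms(3) that by (auto simp: hom_def)
  note p = pullback2_cocycle[OF assms]
  have "pullback2 G f (\<gamma> \<otimes>\<^bsub>cocycles2 H\<^esub> \<delta>) = pullback2 G f \<gamma> \<otimes>\<^bsub>cocycles2 G\<^esub> pullback2 G f \<delta>"
    by (rule cocycles2_eqI) (use p gd in \<open>auto simp: pullback2_apply cocycles2_mult_apply f\<close>)
  thus "H2_map G f (c \<otimes>\<^bsub>H2 H\<^esub> d) = H2_map G f c \<otimes>\<^bsub>H2 G\<^esub> H2_map G f d"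
    using gd p by (simp add: cohomology_class_mult assms H2_map_class[OF assms])
qed

lemma H2_map_comp:
  assumes "group G" "group H" "group K" "f \<in> hom G H" "f' \<in> hom H K" "c \<in> carrier (H2 K)"
  shows "H2_map G f (H2_map H f' c) = H2_map G (\<lambda>x. f' (f x)) c"
proof -
  from assms obtain \<gamma> where g: "\<gamma> \<in> carrier (cocycles2 K)" "c = cohomology_class K \<gamma>" by (auto simp: carrier_H2)
  have f: "f x \<in> carrier H" if "x \<in> carrier G" for x using assms(4) that by (auto simp: hom_def)
  have h: "(\<lambda>x. f' (f x)) \<in> hom G K" using hom_compose[OF assms(4,5)] by (simp add: comp_def)
  have "pullback2 G f (pullback2 H f' \<gamma>) = pullback2 G (\<lambda>x. f' (f x)) \<gamma>"
    by (auto simp: pullback2_def fun_eq_iff f)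
  thus ?thesis using g assms h by (simp add: H2_map_class pullback2_cocycle)
qed

lemma H2_map_ident:
  assumes "group G" "\<And>x. x \<in> carrier G \<Longrightarrow> f x = x" "c \<in> carrier (H2 G)"
  shows "H2_map G f c = c"
proof -
  interpret group G by fact
  from assms obtain \<gamma> where g: "\<gamma> \<in> carrier (cocycles2 G)" "c = cohomology_class G \<gamma>" by (auto simp: carrier_H2)
  have h: "f \<in> hom G G" using assms(2) by (auto simp: hom_def)
  have "pullback2 G f \<gamma> = \<gamma>"
    by (rule cocycles2_eqI) (use pullback2_cocycle[OF assms(1,1) h g(1)] g assms in \<open>auto simp: pullback2_apply\<close>)
  thus ?thesis using g assms h by (simp add: H2_map_class)
qed

text \<open>Along the trivial map every cocycle pulls back to the constant \<gamma>(1,1). Cocycles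
  are not normalised, so this constant need not be 1, but it is the coboundary of the constant
  function with the same value.\<close>

lemma H2_map_trivial:
  assumes "group G" "group H" "\<And>x. x \<in> carrier G \<Longrightarrow> f x = \<one>\<^bsub>H\<^esub>" "c \<in> carrier (H2 H)"
  shows "H2_map G f c = \<one>\<^bsub>H2 G\<^esub>"
proof -
  interpret G: group G by fact
  interpret H: group H by fact
  interpret ZG: comm_group "cocycles2 G" by (rule comm_group_cocycles2) fact
  from assms obtain \<gamma> where g: "\<gamma> \<in> carrier (cocycles2 H)" "c = cohomology_class H \<gamma>" by (auto simp: carrier_H2)
  have h: "f \<in> hom G H" using assms(3) by (auto simp: hom_def)
  have "cohomology_class G (pullback2 G f \<gamma>) = cohomology_class G \<one>\<^bsub>cocycles2 G\<^esub>"
    unfolding cohomology_class_eq_iff[OF assms(1) ZG.one_closed pullback2_cocycle[OF assms(1,2) h g(1)]]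
    by (rule bexI[of _ "\<lambda>_. \<gamma> (\<one>\<^bsub>H\<^esub>, \<one>\<^bsub>H\<^esub>)"])
      (use cocycle2_nz[OF g(1)] assms(3) in \<open>auto simp: pullback2_apply cocycles2_one_apply\<close>)
  thus ?thesis using g h assms by (simp add: H2_map_class cohomology_class_one)
qed

text \<open>Multiply the cocycle identity for \<open>(g, h, x)\<close> over all \<open>x\<close>.\<close>

lemma cocycle2_power_order:
  assumes "group G" "finite (carrier G)" "\<alpha> \<in> carrier (cocycles2 G)" "g \<in> carrier G" "h \<in> carrier G"
  defines "l \<equiv> \<lambda>g. \<Prod>x\<in>carrier G. \<alpha> (g, x)"
  shows "\<alpha> (g, h) ^ order G * l (g \<otimes>\<^bsub>G\<^esub> h) = l g * l h"
proof -
  interpret group G by fact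
  have "(\<Prod>x\<in>carrier G. \<alpha> (g, h \<otimes>\<^bsub>G\<^esub> x)) = l g" unfolding l_def
    by (rule prod.reindex_bij_witness[where j = "\<lambda>x. h \<otimes>\<^bsub>G\<^esub> x" and i = "\<lambda>x. inv\<^bsub>G\<^esub> h \<otimes>\<^bsub>G\<^esub> x"])
      (use assms in \<open>auto simp: m_assoc [symmetric]\<close>)
  moreover have "(\<Prod>x\<in>carrier G. \<alpha> (g, h) * \<alpha> (g \<otimes>\<^bsub>G\<^esub> h, x)) = (\<Prod>x\<in>carrier G. \<alpha> (g, h \<otimes>\<^bsub>G\<^esub> x) * \<alpha> (h, x))"
    by (rule prod.cong) (use cocycle2_assoc[OF assms(3-5)] in auto)
  ultimately show ?thesis by (simp add: prod.distrib l_def order_def)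
qed

text \<open>The identity of \<open>cocycle2_power_order\<close> exhibits this power of the cocycle
  as the coboundary of its row products.\<close>

lemma H2_pow_order:
  assumes "group G" "finite (carrier G)" "c \<in> carrier (H2 G)"
  shows "c [^]\<^bsub>H2 G\<^esub> order G = \<one>\<^bsub>H2 G\<^esub>"
proof -
  interpret group G by fact
  interpret ZG: comm_group "cocycles2 G" by (rule comm_group_cocycles2) fact
  from assms obtain \<alpha> where g: "\<alpha> \<in> carrier (cocycles2 G)" "c = cohomology_class G \<alpha>" by (auto simp: carrier_H2)
  have "cohomology_class G (\<alpha> [^]\<^bsub>cocycles2 G\<^esub> order G) = cohomology_class G \<one>\<^bsub>cocycles2 G\<^esub>"
    unfolding cohomology_class_eq_iff[OF assms(1) ZG.one_closed ZG.nat_pow_closed[OF g(1)]]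
    by (rule bexI[of _ "\<lambda>g. \<Prod>x\<in>carrier G. \<alpha> (g, x)"])
      (use cocycle2_nz[OF g(1)] cocycle2_power_order[OF assms(1,2) g(1)] assms(2) in \<open>auto simp: cocycles2_one_apply cocycles2_pow_apply\<close>)
  thus ?thesis using g assms by (simp add: cohomology_class_pow cohomology_class_one)
qed

section \<open>Algebra isomorphisms on function spaces\<close>

text \<open>Curried so that the library's vector space locale can be interpreted on the full
  function type; every algebra below is a subspace of such a type.\<close>

definition cscale :: "complex \<Rightarrow> ('a \<Rightarrow> complex) \<Rightarrow> 'a \<Rightarrow> complex"
  where "cscale c a = (\<lambda>x. c * a x)"

lemma cscale_apply [simp]: "cscale c a x = c * a x"
  by (simp add: cscale_def)

interpretation cfun: vector_space cscale
  by unfold_locales (auto simp: fun_eq_iff algebra_simps)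

text \<open>Elements of the algebras are represented by functions vanishing off the carrier instead of
  extensional ones, so that they form a subspace for the pointwise operations.\<close>

definition fspace :: "'a set \<Rightarrow> ('a \<Rightarrow> complex) set"
  where "fspace C = {a. \<forall>x. x \<notin> C \<longrightarrow> a x = 0}"

lemma subspace_fspace: "cfun.subspace (fspace C)"
  by (auto simp: cfun.subspace_def fspace_def)

lemma fspace_eqI: "a \<in> fspace C \<Longrightarrow> b \<in> fspace C \<Longrightarrow> (\<And>x. x \<in> C \<Longrightarrow> a x = b x) \<Longrightarrow> a = b"
  unfolding fspace_def fun_eq_iff mem_Collect_eq by metis

definition zext :: "'a set \<Rightarrow> ('a \<Rightarrow> complex) \<Rightarrow> 'a \<Rightarrow> complex"
  where "zext C a = (\<lambda>x. if x \<in> C then a x else 0)"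

lemma zext_mem [simp]: "zext C a \<in> fspace C"
  by (auto simp: zext_def fspace_def)

lemma zext_apply [simp]: "x \<in> C \<Longrightarrow> zext C a x = a x"
  by (simp add: zext_def)

lemma zext_restrict [simp]: "zext C (restrict a C) = zext C a"
  by (auto simp: zext_def fun_eq_iff)

lemma restrict_zext [simp]: "restrict (zext C a) C = restrict a C"
  by (auto simp: zext_def fun_eq_iff)

lemma zext_fspace: "a \<in> fspace C \<Longrightarrow> zext C a = a"
  by (rule fspace_eqI[of _ C]) auto

text \<open>Carriers and products are explicit arguments, which lets ideals with the product of the
  ambient algebra be compared as algebras. The unit of a block is its idempotent rather than the
  unit of the ambient algebra, and a multiplicative bijection between unital algebras preserves
  units by itself.\<close>

definition algebra_iso_map ::
  "(('a \<Rightarrow> complex) \<Rightarrow> 'b \<Rightarrow> complex) \<Rightarrow>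
   ('a \<Rightarrow> complex) set \<Rightarrow> (('a \<Rightarrow> complex) \<Rightarrow> ('a \<Rightarrow> complex) \<Rightarrow> 'a \<Rightarrow> complex) \<Rightarrow>
   ('b \<Rightarrow> complex) set \<Rightarrow> (('b \<Rightarrow> complex) \<Rightarrow> ('b \<Rightarrow> complex) \<Rightarrow> 'b \<Rightarrow> complex) \<Rightarrow> bool"
  where "algebra_iso_map F S m S' m' \<longleftrightarrow> bij_betw F S S' \<and>
    (\<forall>a\<in>S. \<forall>b\<in>S. F (a + b) = F a + F b) \<and> (\<forall>c. \<forall>a\<in>S. F (cscale c a) = cscale c (F a)) \<and>
    (\<forall>a\<in>S. \<forall>b\<in>S. F (m a b) = m' (F a) (F b))"

lemma algebra_iso_mapD:
  assumes "algebra_iso_map F S m S' m'"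
  shows "bij_betw F S S'" "\<And>a. a \<in> S \<Longrightarrow> F a \<in> S'"
    "\<And>a b. a \<in> S \<Longrightarrow> b \<in> S \<Longrightarrow> F (a + b) = F a + F b"
    "\<And>c a. a \<in> S \<Longrightarrow> F (cscale c a) = cscale c (F a)"
    "\<And>a b. a \<in> S \<Longrightarrow> b \<in> S \<Longrightarrow> F (m a b) = m' (F a) (F b)"
  using assms by (auto simp: algebra_iso_map_def bij_betw_def)

definition algebra_isomorphic
  where "algebra_isomorphic S m S' m' \<longleftrightarrow> (\<exists>F. algebra_iso_map F S m S' m')"

lemma algebra_iso_map_inv:
  assumes F: "algebra_iso_map F S m S' m'" and S: "cfun.subspace S" "\<And>a b. a \<in> S \<Longrightarrow> b \<in> S \<Longrightarrow> m a b \<in> S"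
  shows "algebra_iso_map (inv_into S F) S' m' S m"
proof -
  note D = algebra_iso_mapD[OF F]
  let ?I = "inv_into S F"
  have I: "?I y \<in> S" "F (?I y) = y" if "y \<in> S'" for y
    using that D(1) by (auto simp: bij_betw_def inv_into_into f_inv_into_f)
  have IF: "?I (F x) = x" if "x \<in> S" for x
    using that D(1) by (auto simp: bij_betw_def)
  have "?I (a + b) = ?I a + ?I b" if "a \<in> S'" "b \<in> S'" for a b
    using IF[of "?I a + ?I b"] I that D(3) cfun.subspace_add[OF S(1)] by metis
  moreover have "?I (cscale c a) = cscale c (?I a)" if "a \<in> S'" for c a
    using IF[of "cscale c (?I a)"] I that D(4) cfun.subspace_scale[OF S(1)] by metis
  moreover have "?I (m' a b) = m (?I a) (?I b)" if "a \<in> S'" "b \<in> S'" for a b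
    using IF[of "m (?I a) (?I b)"] I that D(5) S(2) by metis
  ultimately show ?thesis
    using bij_betw_inv_into[OF D(1)] by (simp add: algebra_iso_map_def)
qed

lemma algebra_iso_map_comp:
  assumes F: "algebra_iso_map F S m S' m'" and F': "algebra_iso_map F' S' m' S'' m''"
  shows "algebra_iso_map (F' \<circ> F) S m S'' m''"
  using bij_betw_trans[OF algebra_iso_mapD(1)[OF F] algebra_iso_mapD(1)[OF F']]
  by (simp add: algebra_iso_map_def algebra_iso_mapD(2-)[OF F] algebra_iso_mapD(3-)[OF F'])

lemma algebra_isomorphic_sym:
  "algebra_isomorphic S m S' m' \<Longrightarrow> cfun.subspace S \<Longrightarrow> (\<And>a b. a \<in> S \<Longrightarrow> b \<in> S \<Longrightarrow> m a b \<in> S) \<Longrightarrow>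
    algebra_isomorphic S' m' S m"
  unfolding algebra_isomorphic_def using algebra_iso_map_inv by blast

lemma algebra_isomorphic_trans:
  "algebra_isomorphic S m S' m' \<Longrightarrow> algebra_isomorphic S' m' S'' m'' \<Longrightarrow> algebra_isomorphic S m S'' m''"
  unfolding algebra_isomorphic_def using algebra_iso_map_comp by blast

section \<open>Twisted group algebras on functions vanishing off the carrier\<close>

text \<open>The sum over pairs with product \<open>x\<close> is indexed by the first component
  alone, as in \<open>twisted_group_algebra_mult_apply\<close>; extension by zero makes the result
  an element of \<open>talg G\<close> for arbitrary arguments.\<close>

definition tmul :: "('a, 'm) monoid_scheme \<Rightarrow> ('a \<times> 'a \<Rightarrow> complex) \<Rightarrow> ('a \<Rightarrow> complex) \<Rightarrow> ('a \<Rightarrow> complex) \<Rightarrow> 'a \<Rightarrow> complex"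
  where "tmul G \<alpha> a b = zext (carrier G)
    (\<lambda>x. \<Sum>g\<in>carrier G. \<alpha> (g, inv\<^bsub>G\<^esub> g \<otimes>\<^bsub>G\<^esub> x) * a g * b (inv\<^bsub>G\<^esub> g \<otimes>\<^bsub>G\<^esub> x))"

abbreviation talg :: "('a, 'm) monoid_scheme \<Rightarrow> ('a \<Rightarrow> complex) set"
  where "talg G \<equiv> fspace (carrier G)"

abbreviation talg_isomorphic
  where "talg_isomorphic G \<alpha> H \<beta> \<equiv> algebra_isomorphic (talg G) (tmul G \<alpha>) (talg H) (tmul H \<beta>)"

definition tone :: "('a, 'm) monoid_scheme \<Rightarrow> ('a \<times> 'a \<Rightarrow> complex) \<Rightarrow> 'a \<Rightarrow> complex"
  where "tone G \<alpha> = (\<lambda>x. if x = \<one>\<^bsub>G\<^esub> then inverse (\<alpha> (\<one>\<^bsub>G\<^esub>, \<one>\<^bsub>G\<^esub>)) else 0)"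

lemma tmul_mem [simp]: "tmul G \<alpha> a b \<in> talg G"
  by (simp add: tmul_def)

lemma tmul_add_left: "tmul G \<alpha> (a + b) c = tmul G \<alpha> a c + tmul G \<alpha> b c"
  by (auto simp: tmul_def zext_def fun_eq_iff algebra_simps sum.distrib)

lemma tmul_add_right: "tmul G \<alpha> c (a + b) = tmul G \<alpha> c a + tmul G \<alpha> c b"
  by (auto simp: tmul_def zext_def fun_eq_iff algebra_simps sum.distrib)

lemma tmul_scale_left: "tmul G \<alpha> (cscale s a) c = cscale s (tmul G \<alpha> a c)"
  by (auto simp: tmul_def zext_def fun_eq_iff algebra_simps sum_distrib_left)

lemma tmul_scale_right: "tmul G \<alpha> c (cscale s a) = cscale s (tmul G \<alpha> c a)"
  by (auto simp: tmul_def zext_def fun_eq_iff algebra_simps sum_distrib_left)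

lemma tmul_restrict:
  assumes "group G"
  shows "restrict (tmul G \<alpha> a b) (carrier G) =
    restrict a (carrier G) \<otimes>\<^bsub>twisted_group_algebra G \<alpha>\<^esub> restrict b (carrier G)"
proof -
  interpret group G by fact
  have "tmul G \<alpha> a b x = (restrict a (carrier G) \<otimes>\<^bsub>twisted_group_algebra G \<alpha>\<^esub> restrict b (carrier G)) x"
    if "x \<in> carrier G" for x
    unfolding twisted_group_algebra_mult_apply[OF assms that] using that
    by (auto simp: tmul_def intro!: sum.cong)
  thus ?thesis by (auto simp: fun_eq_iff twisted_group_algebra_def)
qed

lemma tmul_assoc:
  assumes "group G" "finite (carrier G)" "\<alpha> \<in> carrier (cocycles2 G)"
  shows "tmul G \<alpha> (tmul G \<alpha> a b) c = tmul G \<alpha> a (tmul G \<alpha> b c)"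
proof -
  interpret ring "twisted_group_algebra G \<alpha>" by (rule ring_twisted_group_algebra[OF assms])
  have c: "restrict a (carrier G) \<in> carrier (twisted_group_algebra G \<alpha>)" for a
    by (simp add: twisted_group_algebra_def)
  have "restrict (tmul G \<alpha> (tmul G \<alpha> a b) c) (carrier G) = restrict (tmul G \<alpha> a (tmul G \<alpha> b c)) (carrier G)"
    using assms(1) c by (simp add: tmul_restrict m_assoc)
  thus ?thesis using zext_restrict zext_fspace tmul_mem by metis
qed

lemma
  assumes "group G" "finite (carrier G)" "\<alpha> \<in> carrier (cocycles2 G)" "a \<in> talg G"
  shows tmul_one_left: "tmul G \<alpha> (tone G \<alpha>) a = a" and tmul_one_right: "tmul G \<alpha> a (tone G \<alpha>) = a"
proof -
  interpret ring "twisted_group_algebra G \<alpha>" by (rule ring_twisted_group_algebra[OF assms(1-3)])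
  have c: "restrict a (carrier G) \<in> carrier (twisted_group_algebra G \<alpha>)" for a
    by (simp add: twisted_group_algebra_def)
  have 1: "restrict (tone G \<alpha>) (carrier G) = \<one>\<^bsub>twisted_group_algebra G \<alpha>\<^esub>"
    by (auto simp: tone_def twisted_group_algebra_def fun_eq_iff)
  have "restrict (tmul G \<alpha> (tone G \<alpha>) a) (carrier G) = restrict a (carrier G)"
    "restrict (tmul G \<alpha> a (tone G \<alpha>)) (carrier G) = restrict a (carrier G)"
    using assms(1) c by (simp_all add: tmul_restrict 1)
  thus "tmul G \<alpha> (tone G \<alpha>) a = a" "tmul G \<alpha> a (tone G \<alpha>) = a"
    using zext_restrict zext_fspace tmul_mem assms(4) by metis+
qed

lemma tone_mem: "group G \<Longrightarrow> tone G \<alpha> \<in> talg G"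
  using group.is_monoid monoid.one_closed by (fastforce simp: tone_def fspace_def)

text \<open>Zero extension and restriction to the carrier are inverse linear bijections between
  extensional functions and functions vanishing off the carrier, and they respect the products by
  \<open>tmul_restrict\<close>.\<close>

lemma complex_algebra_iso_iff:
  assumes G: "group G" "finite (carrier G)" "\<alpha> \<in> carrier (cocycles2 G)"
    and H: "group H" "finite (carrier H)" "\<beta> \<in> carrier (cocycles2 H)"
  shows "complex_algebra_iso (twisted_group_algebra G \<alpha>) (twisted_group_algebra H \<beta>) \<noteq> {} \<longleftrightarrow>
    talg_isomorphic G \<alpha> H \<beta>"
proof -
  let ?A = "twisted_group_algebra G \<alpha>" and ?B = "twisted_group_algebra H \<beta>"
  let ?C = "carrier G" and ?D = "carrier H"
  interpret A: ring ?A by (rule ring_twisted_group_algebra[OF G])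
  interpret B: ring ?B by (rule ring_twisted_group_algebra[OF H])
  have cA: "a \<in> carrier ?A \<longleftrightarrow> a \<in> extensional ?C" for a by (simp add: twisted_group_algebra_def PiE_iff)
  have cB: "a \<in> carrier ?B \<longleftrightarrow> a \<in> extensional ?D" for a by (simp add: twisted_group_algebra_def PiE_iff)
  have rz: "restrict (zext C a) C = a" if "a \<in> extensional C" for C :: "'x set" and a
    using that by (simp add: extensional_restrict)
  have bA: "bij_betw (zext ?C) (carrier ?A) (talg G)" and bA': "bij_betw (\<lambda>a. restrict a ?C) (talg G) (carrier ?A)"
    by (rule bij_betw_byWitness[of _ "\<lambda>a. restrict a ?C"] bij_betw_byWitness[of _ "zext ?C"];
        auto simp: cA extensional_restrict zext_fspace)+
  have bB: "bij_betw (zext ?D) (carrier ?B) (talg H)" and bB': "bij_betw (\<lambda>a. restrict a ?D) (talg H) (carrier ?B)"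
    by (rule bij_betw_byWitness[of _ "\<lambda>a. restrict a ?D"] bij_betw_byWitness[of _ "zext ?D"];
        auto simp: cB extensional_restrict zext_fspace)+
  have addA: "restrict (a + b) ?C = restrict a ?C \<oplus>\<^bsub>?A\<^esub> restrict b ?C" for a b
    by (auto simp: twisted_group_algebra_def fun_eq_iff)
  have addB: "restrict (a + b) ?D = restrict a ?D \<oplus>\<^bsub>?B\<^esub> restrict b ?D" for a b
    by (auto simp: twisted_group_algebra_def fun_eq_iff)
  have scA: "restrict (cscale c a) ?C = c \<odot>\<^bsub>?A\<^esub> restrict a ?C" for a c
    by (auto simp: twisted_group_algebra_def fun_eq_iff)
  have scB: "restrict (cscale c a) ?D = c \<odot>\<^bsub>?B\<^esub> restrict a ?D" for a c
    by (auto simp: twisted_group_algebra_def fun_eq_iff)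
  note mA = tmul_restrict[OF G(1)] and mB = tmul_restrict[OF H(1)]
  have rA: "restrict a ?C \<in> carrier ?A" for a by (simp add: cA)
  have rB: "restrict a ?D \<in> carrier ?B" for a by (simp add: cB)
  have ze: "a = b" if "restrict a ?D = restrict b ?D" "a \<in> talg H" "b \<in> talg H" for a b
    using that zext_restrict zext_fspace by metis
  show ?thesis
  proof
    assume "complex_algebra_iso ?A ?B \<noteq> {}"
    then obtain f where f: "f \<in> ring_iso ?A ?B" "\<And>c x. x \<in> carrier ?A \<Longrightarrow> f (c \<odot>\<^bsub>?A\<^esub> x) = c \<odot>\<^bsub>?B\<^esub> f x"
      by (auto simp: complex_algebra_iso_def)
    have fb: "bij_betw f (carrier ?A) (carrier ?B)" using f(1) by (auto simp: ring_iso_def)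
    have fm: "f (x \<otimes>\<^bsub>?A\<^esub> y) = f x \<otimes>\<^bsub>?B\<^esub> f y" "f (x \<oplus>\<^bsub>?A\<^esub> y) = f x \<oplus>\<^bsub>?B\<^esub> f y" "f x \<in> carrier ?B"
      if "x \<in> carrier ?A" "y \<in> carrier ?A" for x y
      using f(1) that by (auto simp: ring_iso_def ring_hom_def)
    define F where "F = zext ?D \<circ> (f \<circ> (\<lambda>a. restrict a ?C))"
    have Fr: "restrict (F a) ?D = f (restrict a ?C)" for a
      using fm(3)[OF rA rA] by (simp add: F_def cB extensional_restrict)
    have Fm: "F a \<in> talg H" for a by (simp add: F_def)
    have ad: "u \<in> talg H \<Longrightarrow> v \<in> talg H \<Longrightarrow> u + v \<in> talg H" "u \<in> talg H \<Longrightarrow> cscale c u \<in> talg H" for u v c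
      by (auto simp: fspace_def)
    have "algebra_iso_map F (talg G) (tmul G \<alpha>) (talg H) (tmul H \<beta>)"
      unfolding algebra_iso_map_def
    proof (intro conjI ballI allI)
      show "bij_betw F (talg G) (talg H)" unfolding F_def
        by (intro bij_betw_trans[OF _ bB] bij_betw_trans[OF bA'] fb)
    qed (rule ze, simp add: Fr addA addB scA scB mA mB fm f(2) rA, simp add: Fm, simp add: Fm ad)+
    thus "talg_isomorphic G \<alpha> H \<beta>" by (auto simp: algebra_isomorphic_def)
  next
    assume "talg_isomorphic G \<alpha> H \<beta>"
    then obtain F where F: "algebra_iso_map F (talg G) (tmul G \<alpha>) (talg H) (tmul H \<beta>)" by (auto simp: algebra_isomorphic_def)
    note FD = algebra_iso_mapD[OF F]
    define f where "f = (\<lambda>a. restrict a ?D) \<circ> (F \<circ> zext ?C)"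
    have fb: "bij_betw f (carrier ?A) (carrier ?B)" unfolding f_def
      by (intro bij_betw_trans[OF _ bB'] bij_betw_trans[OF bA] FD(1))
    have fr: "f (restrict a ?C) = restrict (F a) ?D" if "a \<in> talg G" for a
      using that by (simp add: f_def zext_fspace)
    have ex: "\<exists>a'\<in>talg G. a = restrict a' ?C" if "a \<in> carrier ?A" for a
      using that rz[of a ?C] zext_mem[of ?C a] cA by metis
    have ad: "u \<in> talg G \<Longrightarrow> v \<in> talg G \<Longrightarrow> u + v \<in> talg G" "u \<in> talg G \<Longrightarrow> cscale c u \<in> talg G" for u v c
      by (auto simp: fspace_def)
    have m: "f (x \<otimes>\<^bsub>?A\<^esub> y) = f x \<otimes>\<^bsub>?B\<^esub> f y" "f (x \<oplus>\<^bsub>?A\<^esub> y) = f x \<oplus>\<^bsub>?B\<^esub> f y"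
       "f (c \<odot>\<^bsub>?A\<^esub> x) = c \<odot>\<^bsub>?B\<^esub> f x"
      if xy: "x \<in> carrier ?A" "y \<in> carrier ?A" for x y c
    proof -
      obtain a b where ab: "a \<in> talg G" "b \<in> talg G" "x = restrict a ?C" "y = restrict b ?C"
        using ex xy by metis
      show "f (x \<otimes>\<^bsub>?A\<^esub> y) = f x \<otimes>\<^bsub>?B\<^esub> f y" using ab by (simp add: fr FD(5) flip: mA mB)
      show "f (x \<oplus>\<^bsub>?A\<^esub> y) = f x \<oplus>\<^bsub>?B\<^esub> f y" using ab by (simp add: fr FD(3) ad flip: addA addB)
      show "f (c \<odot>\<^bsub>?A\<^esub> x) = c \<odot>\<^bsub>?B\<^esub> f x" using ab by (simp add: fr FD(4) ad flip: scA scB)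
    qed
    have fc: "f x \<in> carrier ?B" for x by (simp add: f_def rB)
    \<comment> \<open>\<open>ring_iso\<close> asks for the unit. Some \<open>x\<close> maps to the
      unit of the target, and \<open>f 1 = f 1 * f x = f (1 * x) = f x\<close>.\<close>
    obtain x where x: "x \<in> carrier ?A" "f x = \<one>\<^bsub>?B\<^esub>"
      using fb B.one_closed by (metis (no_types, lifting) bij_betw_def imageE)
    have "f \<one>\<^bsub>?A\<^esub> = f \<one>\<^bsub>?A\<^esub> \<otimes>\<^bsub>?B\<^esub> f x" using fc x by simp
    also have "\<dots> = f x" using m(1)[OF A.one_closed x(1)] x(1) by simp
    finally have "f \<one>\<^bsub>?A\<^esub> = \<one>\<^bsub>?B\<^esub>" using x by simp
    hence "f \<in> complex_algebra_iso ?A ?B"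
      using fb fc m by (auto simp: complex_algebra_iso_def ring_iso_def ring_hom_def)
    thus "complex_algebra_iso ?A ?B \<noteq> {}" by blast
  qed
qed

lemma talg_isomorphic_sym:
  "algebra_isomorphic (talg G) (tmul G \<alpha>) S' m' \<Longrightarrow> algebra_isomorphic S' m' (talg G) (tmul G \<alpha>)"
  by (rule algebra_isomorphic_sym) (auto simp: subspace_fspace)

lemma talg_isomorphic_cohomologous:
  assumes G: "group G" "finite (carrier G)" and \<alpha>: "\<alpha> \<in> carrier (cocycles2 G)" and \<beta>: "\<beta> \<in> carrier (cocycles2 G)"
    and eq: "cohomology_class G \<beta> = cohomology_class G \<alpha>"
  shows "talg_isomorphic G \<beta> G \<alpha>"
proof -
  interpret Z: comm_group "cocycles2 G" by (rule comm_group_cocycles2) fact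
  have "\<beta> \<in> coboundaries2 G #>\<^bsub>cocycles2 G\<^esub> \<alpha>"
    using cohomology_class_self[OF G(1) \<beta>] eq by (simp add: cohomology_class_def)
  then obtain l where l: "l \<in> carrier G \<rightarrow>\<^sub>E UNIV - {0}" "\<beta> = coboundary2 G l \<otimes>\<^bsub>cocycles2 G\<^esub> \<alpha>"
    by (auto simp: r_coset_def coboundaries2_def)
  have "coboundary2 G l \<in> carrier (cocycles2 G)"
    using subgroup.subset[OF subgroup_coboundaries2[OF G(1)]] l(1) unfolding coboundaries2_def by blast
  hence "\<beta> = \<alpha> \<otimes>\<^bsub>cocycles2 G\<^esub> coboundary2 G l"
    using l(2) \<alpha> Z.m_comm by simp
  thus ?thesis
    using twisted_group_algebra_cohomologous[OF G(1) l(1) \<alpha>] complex_algebra_iso_iff[OF G \<beta> G \<alpha>] by simp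
qed

section \<open>The relation is an equivalence relation, invariant under group isomorphism\<close>

lemma twisted_equivalentD:
  assumes G: "group G" "finite (carrier G)" and H: "group H" "finite (carrier H)" and "G \<sim>\<^sub>\<complex> H"
  obtains \<psi> where "\<psi> \<in> iso (H2 G) (H2 H)"
    "\<And>\<alpha> \<beta>. \<alpha> \<in> carrier (cocycles2 G) \<Longrightarrow> \<beta> \<in> carrier (cocycles2 H) \<Longrightarrow>
      \<psi> (cohomology_class G \<alpha>) = cohomology_class H \<beta> \<Longrightarrow>
      talg_isomorphic G \<alpha> H \<beta>"
proof -
  from assms(5) obtain \<psi> where p: "\<psi> \<in> iso (H2 G) (H2 H)"
    "\<forall>c \<in> carrier (H2 G). \<forall>\<alpha> \<in> c. \<forall>\<beta> \<in> \<psi> c.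
          complex_algebra_iso (twisted_group_algebra G \<alpha>) (twisted_group_algebra H \<beta>) \<noteq> {}"
    unfolding twisted_equivalent_def by blast
  show thesis
  proof (rule that[OF p(1)])
    fix \<alpha> \<beta> assume a: "\<alpha> \<in> carrier (cocycles2 G)" and b: "\<beta> \<in> carrier (cocycles2 H)"
      and e: "\<psi> (cohomology_class G \<alpha>) = cohomology_class H \<beta>"
    have "cohomology_class G \<alpha> \<in> carrier (H2 G)" using a by (simp add: carrier_H2)
    moreover have "\<beta> \<in> \<psi> (cohomology_class G \<alpha>)" using e cohomology_class_self[OF H(1) b] by simp
    ultimately show "talg_isomorphic G \<alpha> H \<beta>"
      using p(2) cohomology_class_self[OF G(1) a] complex_algebra_iso_iff[OF G a H b] by blast
  qed
qed

text \<open>Cohomologous cocycles have isomorphic algebras, so a single pair of representatives per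
  class can be transported to all pairs. The freedom in choosing \<open>\<alpha>'\<close> is what
  allows product cocycles to be used later.\<close>

lemma twisted_equivalentI:
  assumes G: "group G" "finite (carrier G)" and H: "group H" "finite (carrier H)"
    and \<psi>: "\<psi> \<in> iso (H2 G) (H2 H)"
    and iso: "\<And>\<alpha>. \<alpha> \<in> carrier (cocycles2 G) \<Longrightarrow>
      \<exists>\<alpha>'\<in>carrier (cocycles2 G). \<exists>\<beta>\<in>carrier (cocycles2 H).
        cohomology_class G \<alpha>' = cohomology_class G \<alpha> \<and>
        \<psi> (cohomology_class G \<alpha>) = cohomology_class H \<beta> \<and>
        talg_isomorphic G \<alpha>' H \<beta>"
  shows "G \<sim>\<^sub>\<complex> H"
  unfolding twisted_equivalent_def
proof (intro bexI[OF _ \<psi>] ballI)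
  fix c \<alpha> \<beta> assume c: "c \<in> carrier (H2 G)" "\<alpha> \<in> c" "\<beta> \<in> \<psi> c"
  obtain \<gamma> where g: "\<gamma> \<in> carrier (cocycles2 G)" "c = cohomology_class G \<gamma>"
    using c(1) by (auto simp: carrier_H2)
  obtain \<alpha>' \<beta>' where ab: "\<alpha>' \<in> carrier (cocycles2 G)" "\<beta>' \<in> carrier (cocycles2 H)"
    "cohomology_class G \<alpha>' = c" "\<psi> c = cohomology_class H \<beta>'"
    "talg_isomorphic G \<alpha>' H \<beta>'"
    using iso[OF g(1)] g(2) by blast
  note a = cohomology_class_eq_of_mem[OF G(1) ab(1), unfolded ab(3), OF c(2)]
  note b = cohomology_class_eq_of_mem[OF H(1) ab(2), unfolded ab(4)[symmetric], OF c(3)]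
  have "talg_isomorphic G \<alpha> G \<alpha>'"
    by (rule talg_isomorphic_cohomologous[OF G ab(1) a(1)]) (simp add: a(2) ab(3))
  moreover have "talg_isomorphic H \<beta>' H \<beta>"
    by (rule talg_isomorphic_cohomologous[OF H b(1) ab(2)]) (simp add: b(2) flip: ab(4))
  ultimately have "talg_isomorphic G \<alpha> H \<beta>"
    by (rule algebra_isomorphic_trans[OF _ algebra_isomorphic_trans[OF ab(5)]])
  thus "complex_algebra_iso (twisted_group_algebra G \<alpha>) (twisted_group_algebra H \<beta>) \<noteq> {}"
    by (simp only: complex_algebra_iso_iff[OF G a(1) H b(1)])
qed

lemma twisted_equivalent_sym:
  assumes G: "group G" "finite (carrier G)" and H: "group H" "finite (carrier H)" and "G \<sim>\<^sub>\<complex> H"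
  shows "H \<sim>\<^sub>\<complex> G"
proof -
  interpret HG: comm_group "H2 G" by (rule comm_group_H2) fact
  obtain \<psi> where p: "\<psi> \<in> iso (H2 G) (H2 H)"
    "\<And>\<alpha> \<beta>. \<alpha> \<in> carrier (cocycles2 G) \<Longrightarrow> \<beta> \<in> carrier (cocycles2 H) \<Longrightarrow>
      \<psi> (cohomology_class G \<alpha>) = cohomology_class H \<beta> \<Longrightarrow>
      talg_isomorphic G \<alpha> H \<beta>"
    using twisted_equivalentD[OF assms] by metis
  let ?i = "inv_into (carrier (H2 G)) \<psi>"
  have bij: "bij_betw \<psi> (carrier (H2 G)) (carrier (H2 H))" using p(1) by (auto simp: iso_def)
  show ?thesis
  proof (rule twisted_equivalentI[OF H G HG.iso_set_sym[OF p(1)]])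
    fix \<beta> assume b: "\<beta> \<in> carrier (cocycles2 H)"
    hence cb: "cohomology_class H \<beta> \<in> carrier (H2 H)" by (simp add: carrier_H2)
    hence "?i (cohomology_class H \<beta>) \<in> carrier (H2 G)"
      using bij by (metis bij_betw_def inv_into_into)
    then obtain \<alpha> where a: "\<alpha> \<in> carrier (cocycles2 G)" "?i (cohomology_class H \<beta>) = cohomology_class G \<alpha>"
      by (auto simp: carrier_H2)
    have "\<psi> (cohomology_class G \<alpha>) = cohomology_class H \<beta>"
      using a(2) bij_betw_inv_into_right[OF bij cb] by simp
    hence "talg_isomorphic H \<beta> G \<alpha>"
      using p(2) a b talg_isomorphic_sym by blast
    thus "\<exists>\<alpha>'\<in>carrier (cocycles2 H). \<exists>\<beta>'\<in>carrier (cocycles2 G).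
        cohomology_class H \<alpha>' = cohomology_class H \<beta> \<and>
        ?i (cohomology_class H \<beta>) = cohomology_class G \<beta>' \<and>
        talg_isomorphic H \<alpha>' G \<beta>'"
      using a b by blast
  qed
qed

lemma twisted_equivalent_trans:
  assumes G: "group G" "finite (carrier G)" and H: "group H" "finite (carrier H)"
    and K: "group K" "finite (carrier K)" and "G \<sim>\<^sub>\<complex> H" "H \<sim>\<^sub>\<complex> K"
  shows "G \<sim>\<^sub>\<complex> K"
proof -
  obtain \<psi> where p: "\<psi> \<in> iso (H2 G) (H2 H)"
    "\<And>\<alpha> \<beta>. \<alpha> \<in> carrier (cocycles2 G) \<Longrightarrow> \<beta> \<in> carrier (cocycles2 H) \<Longrightarrow>
      \<psi> (cohomology_class G \<alpha>) = cohomology_class H \<beta> \<Longrightarrow>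
      talg_isomorphic G \<alpha> H \<beta>"
    using twisted_equivalentD[OF G H assms(7)] by metis
  obtain \<phi> where q: "\<phi> \<in> iso (H2 H) (H2 K)"
    "\<And>\<alpha> \<beta>. \<alpha> \<in> carrier (cocycles2 H) \<Longrightarrow> \<beta> \<in> carrier (cocycles2 K) \<Longrightarrow>
      \<phi> (cohomology_class H \<alpha>) = cohomology_class K \<beta> \<Longrightarrow>
      talg_isomorphic H \<alpha> K \<beta>"
    using twisted_equivalentD[OF H K assms(8)] by metis
  have bp: "\<psi> c \<in> carrier (H2 H)" if "c \<in> carrier (H2 G)" for c using p(1) that by (auto simp: iso_def hom_def)
  have bq: "\<phi> c \<in> carrier (H2 K)" if "c \<in> carrier (H2 H)" for c using q(1) that by (auto simp: iso_def hom_def)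
  have "\<phi> \<circ> \<psi> \<in> iso (H2 G) (H2 K)" using iso_set_trans[OF p(1) q(1)] by (simp add: compose_def iso_def hom_def bp)
  thus ?thesis
  proof (rule twisted_equivalentI[OF G K])
    fix \<alpha> assume a: "\<alpha> \<in> carrier (cocycles2 G)"
    hence ca: "cohomology_class G \<alpha> \<in> carrier (H2 G)" by (simp add: carrier_H2)
    obtain \<beta> where b: "\<beta> \<in> carrier (cocycles2 H)" "\<psi> (cohomology_class G \<alpha>) = cohomology_class H \<beta>"
      using bp[OF ca] by (auto simp: carrier_H2)
    obtain \<gamma> where g: "\<gamma> \<in> carrier (cocycles2 K)" "\<phi> (cohomology_class H \<beta>) = cohomology_class K \<gamma>"
      using bq[OF bp[OF ca]] b by (auto simp: carrier_H2)
    have "talg_isomorphic G \<alpha> K \<gamma>"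
      using p(2)[OF a b] q(2)[OF b(1) g] by (rule algebra_isomorphic_trans)
    thus "\<exists>\<alpha>'\<in>carrier (cocycles2 G). \<exists>\<beta>\<in>carrier (cocycles2 K).
        cohomology_class G \<alpha>' = cohomology_class G \<alpha> \<and>
        (\<phi> \<circ> \<psi>) (cohomology_class G \<alpha>) = cohomology_class K \<beta> \<and>
        talg_isomorphic G \<alpha>' K \<beta>"
      using a b g by auto
  qed
qed

text \<open>Precomposition with \<open>f\<close> carries the convolution sum over \<open>H\<close>
  to the one over \<open>G\<close>; hence the direction from \<open>H\<close> to
  \<open>G\<close>.\<close>

lemma talg_isomorphic_pullback:
  assumes G: "group G" and H: "group H" and f: "f \<in> iso G H"
  shows "talg_isomorphic H \<beta> G (pullback2 G f \<beta>)"
proof -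
  interpret G: group G by fact
  interpret H: group H by fact
  interpret f: group_hom G H f using f by unfold_locales (auto simp: iso_def)
  have b: "bij_betw f (carrier G) (carrier H)" using f by (auto simp: iso_def)
  define F where "F = (\<lambda>a. zext (carrier G) (a \<circ> f))"
  let ?i = "inv_into (carrier G) f"
  have i: "?i y \<in> carrier G" "f (?i y) = y" if "y \<in> carrier H" for y
    using that b by (auto simp: bij_betw_def inv_into_into f_inv_into_f)
  have fi: "?i (f x) = x" if "x \<in> carrier G" for x
    using that b by (auto simp: bij_betw_def)
  have "algebra_iso_map F (talg H) (tmul H \<beta>) (talg G) (tmul G (pullback2 G f \<beta>))"
    unfolding algebra_iso_map_def
  proof (intro conjI ballI allI)
    show "bij_betw F (talg H) (talg G)"
      by (rule bij_betw_byWitness[of _ "\<lambda>a. zext (carrier H) (a \<circ> ?i)"])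
        (auto simp: F_def zext_def fspace_def fun_eq_iff i fi)
  next
    fix a b assume "a \<in> talg H" "b \<in> talg H"
    show "F (tmul H \<beta> a b) = tmul G (pullback2 G f \<beta>) (F a) (F b)"
    proof (rule fspace_eqI[of _ "carrier G"])
      fix x assume x: "x \<in> carrier G"
      have "(\<Sum>h\<in>carrier H. \<beta> (h, inv\<^bsub>H\<^esub> h \<otimes>\<^bsub>H\<^esub> f x) * a h * b (inv\<^bsub>H\<^esub> h \<otimes>\<^bsub>H\<^esub> f x)) =
        (\<Sum>g\<in>carrier G. pullback2 G f \<beta> (g, inv\<^bsub>G\<^esub> g \<otimes>\<^bsub>G\<^esub> x) * F a g * F b (inv\<^bsub>G\<^esub> g \<otimes>\<^bsub>G\<^esub> x))"
        by (rule sum.reindex_bij_witness[where j = ?i and i = f])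
          (use x in \<open>auto simp: F_def i fi pullback2_apply\<close>)
      thus "F (tmul H \<beta> a b) x = tmul G (pullback2 G f \<beta>) (F a) (F b) x"
        using x by (simp add: F_def tmul_def)
    qed (auto simp: F_def)
  qed (auto simp: F_def zext_def fun_eq_iff)
  thus ?thesis by (auto simp: algebra_isomorphic_def)
qed

lemma H2_map_iso:
  assumes G: "group G" and H: "group H" and f: "f \<in> iso G H"
  shows "H2_map G f \<in> iso (H2 H) (H2 G)"
proof -
  interpret G: group G by fact
  have fh: "f \<in> hom G H" using f by (simp add: iso_def)
  let ?i = "inv_into (carrier G) f"
  have ih: "?i \<in> hom H G" using G.iso_set_sym[OF f] by (simp add: iso_def)
  have b: "bij_betw f (carrier G) (carrier H)" using f by (auto simp: iso_def)
  note h1 = H2_map_hom[OF G H fh] and h2 = H2_map_hom[OF H G ih]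
  have "bij_betw (H2_map G f) (carrier (H2 H)) (carrier (H2 G))"
  proof (rule bij_betw_byWitness[of _ "H2_map H ?i"])
    show "\<forall>c\<in>carrier (H2 H). H2_map H ?i (H2_map G f c) = c"
      using b by (auto simp: H2_map_comp[OF H G H ih fh] bij_betw_def f_inv_into_f intro!: H2_map_ident[OF H])
    show "\<forall>c\<in>carrier (H2 G). H2_map G f (H2_map H ?i c) = c"
      using b by (auto simp: H2_map_comp[OF G H G fh ih] bij_betw_def intro!: H2_map_ident[OF G])
  qed (use h1 h2 in \<open>auto simp: hom_def\<close>)
  thus ?thesis using h1 by (simp add: iso_def)
qed

lemma twisted_equivalent_of_iso:
  assumes G: "group G" "finite (carrier G)" and H: "group H" "finite (carrier H)" and "G \<cong> H"
  shows "H \<sim>\<^sub>\<complex> G"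
proof -
  from assms(5) obtain f where f: "f \<in> iso G H" by (auto simp: is_iso_def)
  have fh: "f \<in> hom G H" using f by (simp add: iso_def)
  show ?thesis
  proof (rule twisted_equivalentI[OF H G H2_map_iso[OF G(1) H(1) f]])
    fix \<alpha> assume a: "\<alpha> \<in> carrier (cocycles2 H)"
    show "\<exists>\<alpha>'\<in>carrier (cocycles2 H). \<exists>\<beta>\<in>carrier (cocycles2 G).
        cohomology_class H \<alpha>' = cohomology_class H \<alpha> \<and>
        H2_map G f (cohomology_class H \<alpha>) = cohomology_class G \<beta> \<and>
        talg_isomorphic H \<alpha>' G \<beta>"
      by (rule bexI[OF _ a], rule bexI[OF _ pullback2_cocycle[OF G(1) H(1) fh a]])
        (simp add: talg_isomorphic_pullback[OF G(1) H(1) f] H2_map_class[OF G(1) H(1) fh a])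
  qed
qed

section \<open>The second cohomology of a product of coprime order\<close>

lemma cocycle2_one_left:
  assumes "group G" "\<gamma> \<in> carrier (cocycles2 G)" "x \<in> carrier G"
  shows "\<gamma> (\<one>\<^bsub>G\<^esub>, x) = \<gamma> (\<one>\<^bsub>G\<^esub>, \<one>\<^bsub>G\<^esub>)"
proof -
  interpret group G by fact
  show ?thesis using cocycle2_assoc[OF assms(2), of "\<one>\<^bsub>G\<^esub>" "\<one>\<^bsub>G\<^esub>" x] assms(3) cocycle2_nz[OF assms(2), of "\<one>\<^bsub>G\<^esub>" x] by simp
qed

lemma cocycle2_one_right:
  assumes "group G" "\<gamma> \<in> carrier (cocycles2 G)" "x \<in> carrier G"
  shows "\<gamma> (x, \<one>\<^bsub>G\<^esub>) = \<gamma> (\<one>\<^bsub>G\<^esub>, \<one>\<^bsub>G\<^esub>)"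
proof -
  interpret group G by fact
  show ?thesis using cocycle2_assoc[OF assms(2), of x "\<one>\<^bsub>G\<^esub>" "\<one>\<^bsub>G\<^esub>"] assms(3) cocycle2_nz[OF assms(2), of x "\<one>\<^bsub>G\<^esub>"] by simp
qed

text \<open>For commuting \<open>x\<close> and \<open>y\<close> the ratio
  \<gamma>(x,y)/\<gamma>(y,x) is the scalar by which the products of the two basis elements in
  either order differ, a group commutator in the algebra. It is multiplicative in \<open>x\<close>;
  the proof eliminates through \<open>p\<close> and \<open>q\<close>, the values of \<gamma> at (x,
  x'y) and (xy, x').\<close>

lemma cocycle2_commutator_mult:
  assumes G: "group G" and c: "\<gamma> \<in> carrier (cocycles2 G)"
    and x: "x \<in> carrier G" and x': "x' \<in> carrier G" and y: "y \<in> carrier G"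
    and xy: "x \<otimes>\<^bsub>G\<^esub> y = y \<otimes>\<^bsub>G\<^esub> x" and x'y: "x' \<otimes>\<^bsub>G\<^esub> y = y \<otimes>\<^bsub>G\<^esub> x'"
  shows "\<gamma> (x \<otimes>\<^bsub>G\<^esub> x', y) / \<gamma> (y, x \<otimes>\<^bsub>G\<^esub> x') = \<gamma> (x, y) / \<gamma> (y, x) * (\<gamma> (x', y) / \<gamma> (y, x'))"
proof -
  interpret group G by fact
  note nz = cocycle2_nz[OF c]
  have nzs: "\<gamma> (x, x') \<noteq> 0" "\<gamma> (y, x) \<noteq> 0" "\<gamma> (y, x') \<noteq> 0" "\<gamma> (y, x \<otimes>\<^bsub>G\<^esub> x') \<noteq> 0"
    "\<gamma> (x, x' \<otimes>\<^bsub>G\<^esub> y) \<noteq> 0" "\<gamma> (x \<otimes>\<^bsub>G\<^esub> y, x') \<noteq> 0"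
    using nz x x' y by auto
  have 1: "\<gamma> (x, x') * \<gamma> (x \<otimes>\<^bsub>G\<^esub> x', y) = \<gamma> (x, x' \<otimes>\<^bsub>G\<^esub> y) * \<gamma> (x', y)"
    by (rule cocycle2_assoc[OF c x x' y])
  have 2: "\<gamma> (y, x) * \<gamma> (x \<otimes>\<^bsub>G\<^esub> y, x') = \<gamma> (y, x \<otimes>\<^bsub>G\<^esub> x') * \<gamma> (x, x')"
    unfolding xy by (rule cocycle2_assoc[OF c y x x'])
  have 3: "\<gamma> (x, y) * \<gamma> (x \<otimes>\<^bsub>G\<^esub> y, x') = \<gamma> (x, x' \<otimes>\<^bsub>G\<^esub> y) * \<gamma> (y, x')"
    unfolding x'y by (rule cocycle2_assoc[OF c x y x'])
  define p where "p = \<gamma> (x, x' \<otimes>\<^bsub>G\<^esub> y)"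
  define q where "q = \<gamma> (x \<otimes>\<^bsub>G\<^esub> y, x')"
  have a: "\<gamma> (x \<otimes>\<^bsub>G\<^esub> x', y) = p * \<gamma> (x', y) / \<gamma> (x, x')"
    using 1 nzs(1) by (simp add: p_def field_simps)
  have b: "\<gamma> (y, x \<otimes>\<^bsub>G\<^esub> x') = \<gamma> (y, x) * q / \<gamma> (x, x')"
    using 2 nzs(1) by (simp add: q_def field_simps)
  have d: "\<gamma> (x, y) = p * \<gamma> (y, x') / q"
    using 3 nzs(6) by (simp add: p_def q_def field_simps)
  show ?thesis unfolding a b d using nzs by (simp add: q_def[symmetric] field_simps)
qed

lemma cocycle2_commutator_pow:
  assumes G: "group G" and c: "\<gamma> \<in> carrier (cocycles2 G)"
    and x: "x \<in> carrier G" and y: "y \<in> carrier G" and xy: "x \<otimes>\<^bsub>G\<^esub> y = y \<otimes>\<^bsub>G\<^esub> x"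
  shows "(\<gamma> (x, y) / \<gamma> (y, x)) ^ n = \<gamma> (x [^]\<^bsub>G\<^esub> n, y) / \<gamma> (y, x [^]\<^bsub>G\<^esub> n)"
proof -
  interpret group G by fact
  have comm: "x [^]\<^bsub>G\<^esub> m \<otimes>\<^bsub>G\<^esub> y = y \<otimes>\<^bsub>G\<^esub> x [^]\<^bsub>G\<^esub> m" for m :: nat
    using group_commutes_pow[OF xy x y] .
  show ?thesis
  proof (induction n)
    case 0
    show ?case using cocycle2_one_left[OF G c y] cocycle2_one_right[OF G c y] cocycle2_nz[OF c, of "\<one>\<^bsub>G\<^esub>" "\<one>\<^bsub>G\<^esub>"] by simp
  next
    case (Suc n)
    have "\<gamma> (x [^]\<^bsub>G\<^esub> n \<otimes>\<^bsub>G\<^esub> x, y) / \<gamma> (y, x [^]\<^bsub>G\<^esub> n \<otimes>\<^bsub>G\<^esub> x) =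
      \<gamma> (x [^]\<^bsub>G\<^esub> n, y) / \<gamma> (y, x [^]\<^bsub>G\<^esub> n) * (\<gamma> (x, y) / \<gamma> (y, x))"
      by (rule cocycle2_commutator_mult[OF G c]) (use x y xy comm in auto)
    thus ?case using Suc.IH by (simp add: mult.commute)
  qed
qed

lemma coprime_powers_eq_one:
  fixes z :: "'a :: field"
  assumes "z ^ m = 1" "z ^ n = 1" "coprime m n"
  shows "z = 1"
proof (cases "m = 0")
  \<comment> \<open>Coprimality to \<open>m = 0\<close> means \<open>n = 1\<close>; the Bezout
    identity below needs a nonzero \<open>m\<close>.\<close>
  case True
  thus ?thesis using assms by simp
next
  case False
  obtain a b where "m * a = n * b + 1"
    using bezout_nat[OF False, of n] assms(3) by (auto simp: coprime_iff_gcd_eq_1)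
  hence "z ^ (m * a) = z ^ (n * b) * z" by simp
  thus ?thesis using assms(1,2) by (simp add: power_mult)
qed

text \<open>The commutator scalar is an \<open>m\<close>-th root of unity by multiplicativity in
  \<open>x\<close> and an \<open>n\<close>-th root of unity by multiplicativity in \<open>y\<close>,
  hence equal to 1.\<close>

lemma cocycle2_commute_coprime:
  assumes G: "group G" and c: "\<gamma> \<in> carrier (cocycles2 G)"
    and x: "x \<in> carrier G" and y: "y \<in> carrier G" and xy: "x \<otimes>\<^bsub>G\<^esub> y = y \<otimes>\<^bsub>G\<^esub> x"
    and xm: "x [^]\<^bsub>G\<^esub> m = \<one>\<^bsub>G\<^esub>" and yn: "y [^]\<^bsub>G\<^esub> n = \<one>\<^bsub>G\<^esub>" and mn: "coprime m (n::nat)"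
  shows "\<gamma> (x, y) = \<gamma> (y, x)"
proof -
  interpret group G by fact
  note nz = cocycle2_nz[OF c]
  have 1: "(\<gamma> (x, y) / \<gamma> (y, x)) ^ m = 1"
    using cocycle2_one_left[OF G c y] cocycle2_one_right[OF G c y] nz[of "\<one>\<^bsub>G\<^esub>" "\<one>\<^bsub>G\<^esub>"]
    by (simp add: cocycle2_commutator_pow[OF G c x y xy] xm)
  have "(\<gamma> (y, x) / \<gamma> (x, y)) ^ n = 1"
    using cocycle2_one_left[OF G c x] cocycle2_one_right[OF G c x] nz[of "\<one>\<^bsub>G\<^esub>" "\<one>\<^bsub>G\<^esub>"]
    by (simp add: cocycle2_commutator_pow[OF G c y x xy[symmetric]] yn)
  hence "(\<gamma> (x, y) / \<gamma> (y, x)) ^ n = 1"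
    by (simp add: power_divide)
  with 1 have "\<gamma> (x, y) / \<gamma> (y, x) = 1" using mn coprime_powers_eq_one by blast
  thus ?thesis using nz[OF y x] by simp
qed

text \<open>With \<open>a, c\<close> in one factor and \<open>b, d\<close> in the other, this says that the basis change
  \<open>(a, b) \<mapsto> u\<^sub>a \<cdot> u\<^sub>b\<close> turns \<open>\<gamma>\<close> into a product of its restrictions.\<close>

lemma cocycle2_exchange:
  assumes G: "group G" and \<gamma>: "\<gamma> \<in> carrier (cocycles2 G)"
    and abcd: "a \<in> carrier G" "b \<in> carrier G" "c \<in> carrier G" "d \<in> carrier G"
    and bc: "b \<otimes>\<^bsub>G\<^esub> c = c \<otimes>\<^bsub>G\<^esub> b" and eq: "\<gamma> (b, c) = \<gamma> (c, b)"
  shows "\<gamma> (a \<otimes>\<^bsub>G\<^esub> b, c \<otimes>\<^bsub>G\<^esub> d) * \<gamma> (a, b) * \<gamma> (c, d) =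
    \<gamma> (a, c) * \<gamma> (b, d) * \<gamma> (a \<otimes>\<^bsub>G\<^esub> c, b \<otimes>\<^bsub>G\<^esub> d)"
proof -
  interpret group G by fact
  note nz = cocycle2_nz[OF \<gamma>] and co = cocycle2_assoc[OF \<gamma>]
  let ?w = "b \<otimes>\<^bsub>G\<^esub> c \<otimes>\<^bsub>G\<^esub> d"
  have w: "b \<otimes>\<^bsub>G\<^esub> (c \<otimes>\<^bsub>G\<^esub> d) = ?w" "c \<otimes>\<^bsub>G\<^esub> (b \<otimes>\<^bsub>G\<^esub> d) = ?w"
    using abcd bc by (auto simp: m_assoc[symmetric])
  have 1: "\<gamma> (a, b) * \<gamma> (a \<otimes>\<^bsub>G\<^esub> b, c \<otimes>\<^bsub>G\<^esub> d) = \<gamma> (a, ?w) * \<gamma> (b, c \<otimes>\<^bsub>G\<^esub> d)"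
    using co[of a b "c \<otimes>\<^bsub>G\<^esub> d"] abcd w by simp
  have 2: "\<gamma> (b, c) * \<gamma> (b \<otimes>\<^bsub>G\<^esub> c, d) = \<gamma> (b, c \<otimes>\<^bsub>G\<^esub> d) * \<gamma> (c, d)"
    using co[of b c d] abcd by simp
  have 3: "\<gamma> (b, c) * \<gamma> (b \<otimes>\<^bsub>G\<^esub> c, d) = \<gamma> (c, b \<otimes>\<^bsub>G\<^esub> d) * \<gamma> (b, d)"
    using co[of c b d] abcd eq bc by simp
  have 4: "\<gamma> (a, c) * \<gamma> (a \<otimes>\<^bsub>G\<^esub> c, b \<otimes>\<^bsub>G\<^esub> d) = \<gamma> (a, ?w) * \<gamma> (c, b \<otimes>\<^bsub>G\<^esub> d)"
    using co[of a c "b \<otimes>\<^bsub>G\<^esub> d"] abcd w by simp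
  have "\<gamma> (a \<otimes>\<^bsub>G\<^esub> b, c \<otimes>\<^bsub>G\<^esub> d) * \<gamma> (a, b) * \<gamma> (c, d) = \<gamma> (a, ?w) * (\<gamma> (b, c \<otimes>\<^bsub>G\<^esub> d) * \<gamma> (c, d))"
    using 1 by (simp add: mult_ac)
  also have "\<dots> = \<gamma> (a, ?w) * \<gamma> (c, b \<otimes>\<^bsub>G\<^esub> d) * \<gamma> (b, d)" using 2 3 by simp
  also have "\<dots> = \<gamma> (a, c) * \<gamma> (a \<otimes>\<^bsub>G\<^esub> c, b \<otimes>\<^bsub>G\<^esub> d) * \<gamma> (b, d)" using 4 by simp
  finally show ?thesis by (simp add: mult_ac)
qed

text \<open>The product of the two inflations along the projections. Its twisted group algebra is
  the tensor product of the two algebras, realised on functions on the product set.\<close>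

definition prod_cocycle ::
    "('a, 'm) monoid_scheme \<Rightarrow> ('b, 'n) monoid_scheme \<Rightarrow> ('a \<times> 'a \<Rightarrow> complex) \<Rightarrow> ('b \<times> 'b \<Rightarrow> complex) \<Rightarrow>
      ('a \<times> 'b) \<times> ('a \<times> 'b) \<Rightarrow> complex"
  where "prod_cocycle G H \<alpha> \<beta> =
    pullback2 (G \<times>\<times> H) fst \<alpha> \<otimes>\<^bsub>cocycles2 (G \<times>\<times> H)\<^esub> pullback2 (G \<times>\<times> H) snd \<beta>"

lemma fst_hom: "fst \<in> hom (G \<times>\<times> H) G" and snd_hom: "snd \<in> hom (G \<times>\<times> H) H"
  by (auto simp: hom_def DirProd_def)

lemma inl_hom: "group H \<Longrightarrow> (\<lambda>g. (g, \<one>\<^bsub>H\<^esub>)) \<in> hom G (G \<times>\<times> H)"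
  and inr_hom: "group G \<Longrightarrow> (\<lambda>h. (\<one>\<^bsub>G\<^esub>, h)) \<in> hom H (G \<times>\<times> H)"
  by (auto simp: hom_def DirProd_def group.is_monoid monoid.one_closed monoid.l_one)

lemma prod_cocycle_apply:
  "g \<in> carrier G \<Longrightarrow> g' \<in> carrier G \<Longrightarrow> h \<in> carrier H \<Longrightarrow> h' \<in> carrier H \<Longrightarrow>
    prod_cocycle G H \<alpha> \<beta> ((g, h), (g', h')) = \<alpha> (g, g') * \<beta> (h, h')"
  by (simp add: prod_cocycle_def cocycles2_mult_apply pullback2_apply)

lemma prod_cocycle_cocycle:
  assumes "group G" "group H" "\<alpha> \<in> carrier (cocycles2 G)" "\<beta> \<in> carrier (cocycles2 H)"
  shows "prod_cocycle G H \<alpha> \<beta> \<in> carrier (cocycles2 (G \<times>\<times> H))"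
proof -
  have P: "group (G \<times>\<times> H)" using assms DirProd_group by blast
  interpret Z: comm_group "cocycles2 (G \<times>\<times> H)" by (rule comm_group_cocycles2[OF P])
  show ?thesis unfolding prod_cocycle_def
    by (intro Z.m_closed pullback2_cocycle[OF P _ fst_hom] pullback2_cocycle[OF P _ snd_hom] assms)
qed

lemma DirProd_pow: "(g, h) [^]\<^bsub>G \<times>\<times> H\<^esub> (n::nat) = (g [^]\<^bsub>G\<^esub> n, h [^]\<^bsub>H\<^esub> n)"
  by (induction n) (auto simp: nat_pow_def DirProd_def)

lemma cohomology_class_DirProd:
  assumes G: "group G" "finite (carrier G)" and H: "group H" "finite (carrier H)"
    and cop: "coprime (order G) (order H)" and \<gamma>: "\<gamma> \<in> carrier (cocycles2 (G \<times>\<times> H))"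
  shows "cohomology_class (G \<times>\<times> H) \<gamma> = cohomology_class (G \<times>\<times> H)
    (prod_cocycle G H (pullback2 G (\<lambda>g. (g, \<one>\<^bsub>H\<^esub>)) \<gamma>) (pullback2 H (\<lambda>h. (\<one>\<^bsub>G\<^esub>, h)) \<gamma>))"
proof -
  interpret G: group G by fact
  interpret H: group H by fact
  let ?P = "G \<times>\<times> H"
  have P: "group ?P" using assms DirProd_group by blast
  interpret P: group ?P by fact
  let ?\<alpha> = "pullback2 G (\<lambda>g. (g, \<one>\<^bsub>H\<^esub>)) \<gamma>" and ?\<beta> = "pullback2 H (\<lambda>h. (\<one>\<^bsub>G\<^esub>, h)) \<gamma>"
  have a: "?\<alpha> \<in> carrier (cocycles2 G)" by (rule pullback2_cocycle[OF G(1) P inl_hom[OF H(1)] \<gamma>])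
  have b: "?\<beta> \<in> carrier (cocycles2 H)" by (rule pullback2_cocycle[OF H(1) P inr_hom[OF G(1)] \<gamma>])
  \<comment> \<open>The inverse of the scalar by which the product of the basis elements of (g,1)
    and (1,h) differs from the basis element of (g,h).\<close>
  define l where "l = (\<lambda>(g, h). inverse (\<gamma> ((g, \<one>\<^bsub>H\<^esub>), (\<one>\<^bsub>G\<^esub>, h))))"
  show ?thesis
    unfolding cohomology_class_eq_iff[OF P prod_cocycle_cocycle[OF G(1) H(1) a b] \<gamma>]
  proof (rule bexI[of _ l], intro ballI)
    show "l \<in> carrier ?P \<rightarrow> UNIV - {0}"
      using cocycle2_nz[OF \<gamma>] by (auto simp: l_def)
  next
    fix p q assume "p \<in> carrier ?P" "q \<in> carrier ?P"
    then obtain g h g' h' where pq: "p = (g, h)" "q = (g', h')"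
      "g \<in> carrier G" "h \<in> carrier H" "g' \<in> carrier G" "h' \<in> carrier H" by (auto simp: DirProd_def)
    have comm: "(\<one>\<^bsub>G\<^esub>, h) \<otimes>\<^bsub>?P\<^esub> (g', \<one>\<^bsub>H\<^esub>) = (g', \<one>\<^bsub>H\<^esub>) \<otimes>\<^bsub>?P\<^esub> (\<one>\<^bsub>G\<^esub>, h)"
      using pq by simp
    have "\<gamma> ((\<one>\<^bsub>G\<^esub>, h), (g', \<one>\<^bsub>H\<^esub>)) = \<gamma> ((g', \<one>\<^bsub>H\<^esub>), (\<one>\<^bsub>G\<^esub>, h))"
    proof (rule cocycle2_commute_coprime[OF P \<gamma> _ _ comm])
      show "(\<one>\<^bsub>G\<^esub>, h) [^]\<^bsub>?P\<^esub> order H = \<one>\<^bsub>?P\<^esub>" "(g', \<one>\<^bsub>H\<^esub>) [^]\<^bsub>?P\<^esub> order G = \<one>\<^bsub>?P\<^esub>"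
        using pq by (auto simp: DirProd_pow G.pow_order_eq_1 H.pow_order_eq_1)
      show "coprime (order H) (order G)" using cop by (simp add: coprime_commute)
    qed (use pq in auto)
    from cocycle2_exchange[OF P \<gamma> _ _ _ _ comm this, of "(g, \<one>\<^bsub>H\<^esub>)" "(\<one>\<^bsub>G\<^esub>, h')"]
    have ex: "\<gamma> (p, q) * \<gamma> ((g, \<one>\<^bsub>H\<^esub>), (\<one>\<^bsub>G\<^esub>, h)) * \<gamma> ((g', \<one>\<^bsub>H\<^esub>), (\<one>\<^bsub>G\<^esub>, h')) =
      \<gamma> ((g, \<one>\<^bsub>H\<^esub>), (g', \<one>\<^bsub>H\<^esub>)) * \<gamma> ((\<one>\<^bsub>G\<^esub>, h), (\<one>\<^bsub>G\<^esub>, h')) *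
        \<gamma> ((g \<otimes>\<^bsub>G\<^esub> g', \<one>\<^bsub>H\<^esub>), (\<one>\<^bsub>G\<^esub>, h \<otimes>\<^bsub>H\<^esub> h'))"
      using pq by simp
    have nz: "\<gamma> ((x, \<one>\<^bsub>H\<^esub>), (\<one>\<^bsub>G\<^esub>, y)) \<noteq> 0" if "x \<in> carrier G" "y \<in> carrier H" for x y
      using cocycle2_nz[OF \<gamma>] that by simp
    show "\<gamma> (p, q) * l (p \<otimes>\<^bsub>?P\<^esub> q) = prod_cocycle G H ?\<alpha> ?\<beta> (p, q) * l p * l q"
      using ex pq nz[of g h] nz[of g' h'] nz[of "g \<otimes>\<^bsub>G\<^esub> g'" "h \<otimes>\<^bsub>H\<^esub> h'"]
      by (simp add: l_def prod_cocycle_apply pullback2_apply field_simps)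
  qed
qed

section \<open>Tensor products of algebra isomorphisms\<close>

lemma sum_fun_apply: "(\<Sum>i\<in>A. f i) x = (\<Sum>i\<in>A. f i x)" for f :: "'i \<Rightarrow> 'a \<Rightarrow> 'b :: comm_monoid_add"
  by (induction A rule: infinite_finite_induct) auto

lemma algebra_iso_map_sum:
  assumes F: "algebra_iso_map F S m S' m'" and S: "cfun.subspace S" and f: "\<And>i. i \<in> I \<Longrightarrow> f i \<in> S"
  shows "F (\<Sum>i\<in>I. f i) = (\<Sum>i\<in>I. F (f i))"
proof -
  have 0: "F 0 = 0"
    using algebra_iso_mapD(4)[OF F cfun.subspace_0[OF S], of 0] by simp
  show ?thesis using f
  proof (induction I rule: infinite_finite_induct)
    case (insert i I)
    have "F (\<Sum>i\<in>insert i I. f i) = F (f i + (\<Sum>i\<in>I. f i))"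
      by (simp only: sum.insert[OF insert.hyps])
    also have "\<dots> = F (f i) + F (\<Sum>i\<in>I. f i)"
      by (intro algebra_iso_mapD(3)[OF F] cfun.subspace_sum[OF S] insert.prems) auto
    also have "F (\<Sum>i\<in>I. f i) = (\<Sum>i\<in>I. F (f i))"
      by (rule insert.IH) (simp add: insert.prems)
    finally show ?case by (simp only: sum.insert[OF insert.hyps])
  qed (simp_all add: 0)
qed

definition slice :: "('a \<times> 'b \<Rightarrow> complex) \<Rightarrow> 'b \<Rightarrow> 'a \<Rightarrow> complex"
  where "slice a y = (\<lambda>x. a (x, y))"

text \<open>The tensor product of \<open>f\<close> with the identity: a function on the product is a
  family of elements of the first algebra indexed by the second group, and \<open>f\<close> acts on
  each member.\<close>

definition slicewise :: "(('a \<Rightarrow> complex) \<Rightarrow> 'c \<Rightarrow> complex) \<Rightarrow> ('a \<times> 'b \<Rightarrow> complex) \<Rightarrow> 'c \<times> 'b \<Rightarrow> complex"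
  where "slicewise f a = (\<lambda>(x, y). f (slice a y) x)"

text \<open>Read through slices, the product is a convolution over the second group with
  coefficients in the first algebra. On the right-hand side only \<open>tmul G \<alpha>\<close>
  involves \<open>G\<close>, so a linear map preserving it can be applied slice by slice.\<close>

lemma slice_tmul:
  assumes G: "group G" and H: "group H" and y: "y \<in> carrier H"
  shows "slice (tmul (G \<times>\<times> H) (prod_cocycle G H \<alpha> \<beta>) a b) y = (\<Sum>h\<in>carrier H.
    cscale (\<beta> (h, inv\<^bsub>H\<^esub> h \<otimes>\<^bsub>H\<^esub> y)) (tmul G \<alpha> (slice a h) (slice b (inv\<^bsub>H\<^esub> h \<otimes>\<^bsub>H\<^esub> y))))"
    (is "?L = ?R")
proof (rule fspace_eqI[of _ "carrier G"])
  interpret G: group G by fact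
  interpret H: group H by fact
  show "?L \<in> talg G" by (auto simp: slice_def fspace_def tmul_def zext_def)
  show "?R \<in> talg G"
    by (intro cfun.subspace_sum[OF subspace_fspace] cfun.subspace_scale[OF subspace_fspace]) simp
  fix x assume x: "x \<in> carrier G"
  have "?L x = (\<Sum>(g, h)\<in>carrier G \<times> carrier H.
      prod_cocycle G H \<alpha> \<beta> ((g, h), inv\<^bsub>G \<times>\<times> H\<^esub> (g, h) \<otimes>\<^bsub>G \<times>\<times> H\<^esub> (x, y)) * a (g, h) *
      b (inv\<^bsub>G \<times>\<times> H\<^esub> (g, h) \<otimes>\<^bsub>G \<times>\<times> H\<^esub> (x, y)))"
    using x y by (simp add: slice_def tmul_def case_prod_beta)
  also have "\<dots> = (\<Sum>(g, h)\<in>carrier G \<times> carrier H.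
      \<alpha> (g, inv\<^bsub>G\<^esub> g \<otimes>\<^bsub>G\<^esub> x) * \<beta> (h, inv\<^bsub>H\<^esub> h \<otimes>\<^bsub>H\<^esub> y) * a (g, h) * b (inv\<^bsub>G\<^esub> g \<otimes>\<^bsub>G\<^esub> x, inv\<^bsub>H\<^esub> h \<otimes>\<^bsub>H\<^esub> y))"
    by (rule sum.cong) (use x y in \<open>auto simp: prod_cocycle_apply inv_DirProd[OF G H]\<close>)
  also have "\<dots> = (\<Sum>h\<in>carrier H. \<Sum>g\<in>carrier G.
      \<alpha> (g, inv\<^bsub>G\<^esub> g \<otimes>\<^bsub>G\<^esub> x) * \<beta> (h, inv\<^bsub>H\<^esub> h \<otimes>\<^bsub>H\<^esub> y) * a (g, h) * b (inv\<^bsub>G\<^esub> g \<otimes>\<^bsub>G\<^esub> x, inv\<^bsub>H\<^esub> h \<otimes>\<^bsub>H\<^esub> y))"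
    by (simp add: sum.swap[of _ "carrier H"] flip: sum.cartesian_product)
  also have "\<dots> = ?R x"
    using x by (simp add: sum_fun_apply tmul_def slice_def sum_distrib_left mult_ac)
  finally show "?L x = ?R x" .
qed

text \<open>\<open>slicewise F\<close> is the isomorphism, and \<open>slicewise\<close> of the
  inverse of \<open>F\<close> inverts it. By \<open>slice_tmul\<close> it only has to pass through
  linear combinations of products in the first algebra.\<close>

lemma talg_isomorphic_DirProd_left:
  assumes G: "group G" and G': "group G'" and H: "group H"
    and iso: "talg_isomorphic G \<alpha> G' \<alpha>'"
  shows "talg_isomorphic (G \<times>\<times> H) (prod_cocycle G H \<alpha> \<beta>) (G' \<times>\<times> H) (prod_cocycle G' H \<alpha>' \<beta>)"
proof -
  interpret H: group H by fact
  obtain F where F: "algebra_iso_map F (talg G) (tmul G \<alpha>) (talg G') (tmul G' \<alpha>')"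
    using iso by (auto simp: algebra_isomorphic_def)
  note D = algebra_iso_mapD[OF F]
  let ?I = "inv_into (talg G) F"
  have I: "algebra_iso_map ?I (talg G') (tmul G' \<alpha>') (talg G) (tmul G \<alpha>)"
    by (rule algebra_iso_map_inv[OF F]) (auto simp: subspace_fspace)
  have zero: "f 0 = 0" if "algebra_iso_map f (fspace A) m (fspace B) m'" for f :: "('x \<Rightarrow> complex) \<Rightarrow> 'y \<Rightarrow> complex" and A m B m'
    using algebra_iso_mapD(4)[OF that cfun.subspace_0[OF subspace_fspace], of 0] by simp
  have IF: "?I (F a) = a" if "a \<in> talg G" for a
    using that D(1) by (auto simp: bij_betw_def)
  have FI: "F (?I a) = a" if "a \<in> talg G'" for a
    using that D(1) by (auto simp: bij_betw_def f_inv_into_f)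
  have sl: "slice a y \<in> fspace A" if "a \<in> fspace (A \<times> B)" for a :: "'x \<times> 'z \<Rightarrow> complex" and A B y
    using that by (auto simp: fspace_def slice_def)
  have sl0: "slice a y = 0" if "a \<in> fspace (A \<times> B)" "y \<notin> B" for a :: "'x \<times> 'z \<Rightarrow> complex" and A B y
    using that by (auto simp: fspace_def slice_def fun_eq_iff)
  have sT: "slice (slicewise f a) y = f (slice a y)" for f :: "('x \<Rightarrow> complex) \<Rightarrow> 'y \<Rightarrow> complex" and a :: "'x \<times> 'z \<Rightarrow> complex" and y
    by (simp add: slicewise_def slice_def)
  have ext: "a = b" if "\<And>y. slice a y = slice b y" for a b :: "'x \<times> 'z \<Rightarrow> complex"
    using that by (auto simp: slice_def fun_eq_iff)
  have TT: "slicewise f a \<in> fspace (A' \<times> B)" if f: "algebra_iso_map f (fspace A) m (fspace A') m'" and a: "a \<in> fspace (A \<times> B)"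
    for f :: "('x \<Rightarrow> complex) \<Rightarrow> 'y \<Rightarrow> complex" and a :: "'x \<times> 'z \<Rightarrow> complex" and A m m' A' B
  proof -
    have "f (slice a y) x = 0" if "x \<notin> A'" for x y
      using algebra_iso_mapD(2)[OF f sl[OF a], of y] that by (simp add: fspace_def)
    moreover have "f (slice a y) x = 0" if "y \<notin> B" for x y
      by (simp add: sl0[OF a that] zero[OF f])
    ultimately show ?thesis by (auto simp: slicewise_def fspace_def)
  qed
  have c: "talg (G \<times>\<times> H) = fspace (carrier G \<times> carrier H)" "talg (G' \<times>\<times> H) = fspace (carrier G' \<times> carrier H)"
    by simp_all
  have "algebra_iso_map (slicewise F) (talg (G \<times>\<times> H)) (tmul (G \<times>\<times> H) (prod_cocycle G H \<alpha> \<beta>))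
    (talg (G' \<times>\<times> H)) (tmul (G' \<times>\<times> H) (prod_cocycle G' H \<alpha>' \<beta>))"
    unfolding algebra_iso_map_def
  proof (intro conjI ballI allI)
    show "bij_betw (slicewise F) (talg (G \<times>\<times> H)) (talg (G' \<times>\<times> H))" unfolding c
    proof (rule bij_betw_byWitness[of _ "slicewise ?I"])
      show "\<forall>a\<in>fspace (carrier G \<times> carrier H). slicewise ?I (slicewise F a) = a"
        by (auto intro!: ext simp: sT IF sl)
      show "\<forall>a\<in>fspace (carrier G' \<times> carrier H). slicewise F (slicewise ?I a) = a"
        by (auto intro!: ext simp: sT FI sl)
    qed (use TT[OF F] TT[OF I] in auto)
  next
    fix a b assume "a \<in> talg (G \<times>\<times> H)" "b \<in> talg (G \<times>\<times> H)"
    hence s: "slice a y \<in> talg G" "slice b y \<in> talg G" for y unfolding c by (auto intro: sl)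
    have p: "slice (u + v) y = slice u y + slice v y" for u v :: "'x \<times> 'z \<Rightarrow> complex" and y
      by (simp add: slice_def fun_eq_iff)
    show "slicewise F (a + b) = slicewise F a + slicewise F b"
      by (rule ext) (simp only: sT p D(3) s)
  next
    fix d a assume "a \<in> talg (G \<times>\<times> H)"
    hence s: "slice a y \<in> talg G" for y unfolding c by (auto intro: sl)
    have p: "slice (cscale d u) y = cscale d (slice u y)" for u :: "'x \<times> 'z \<Rightarrow> complex" and y
      by (simp add: slice_def fun_eq_iff)
    show "slicewise F (cscale d a) = cscale d (slicewise F a)"
      by (rule ext) (simp only: sT p D(4) s)
  next
    fix a b assume a: "a \<in> talg (G \<times>\<times> H)" and b: "b \<in> talg (G \<times>\<times> H)"
    hence s: "slice a y \<in> talg G" "slice b y \<in> talg G" for y unfolding c by (auto intro: sl)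
    show "slicewise F (tmul (G \<times>\<times> H) (prod_cocycle G H \<alpha> \<beta>) a b) =
      tmul (G' \<times>\<times> H) (prod_cocycle G' H \<alpha>' \<beta>) (slicewise F a) (slicewise F b)" (is "slicewise F ?l = ?r")
    proof (rule ext)
      fix y
      show "slice (slicewise F ?l) y = slice ?r y"
      proof (cases "y \<in> carrier H")
        case True
        show ?thesis
          unfolding sT slice_tmul[OF G H True] slice_tmul[OF G' H True]
          by (subst algebra_iso_map_sum[OF F subspace_fspace])
            (simp_all add: cfun.subspace_scale[OF subspace_fspace] D(4,5) s)
      next
        case False
        have "?l \<in> fspace (carrier G \<times> carrier H)" "?r \<in> fspace (carrier G' \<times> carrier H)"
          using tmul_mem[of "G \<times>\<times> H"] tmul_mem[of "G' \<times>\<times> H"] unfolding c by auto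
        thus ?thesis using False by (simp only: sT sl0[OF _ False] zero[OF F])
      qed
    qed
  qed
  thus ?thesis by (auto simp: algebra_isomorphic_def)
qed

section \<open>Inflation, restriction and torsion in the cohomology of a product\<close>

lemma (in group) pow_coprime_one:
  assumes "x \<in> carrier G" "x [^] (m::nat) = \<one>" "x [^] (n::nat) = \<one>" "coprime m n"
  shows "x = \<one>"
proof -
  have "ord x dvd m" "ord x dvd n" using assms pow_eq_id by auto
  hence "ord x = 1" using assms(4) coprime_common_divisor_nat by blast
  thus ?thesis using assms(1) ord_eq_1 by blast
qed

lemma H2_DirProd_inject:
  assumes "group G" "group H" "\<alpha> \<in> carrier (cocycles2 G)" "\<beta> \<in> carrier (cocycles2 H)"
  shows "H2_map (G \<times>\<times> H) fst (cohomology_class G \<alpha>) \<otimes>\<^bsub>H2 (G \<times>\<times> H)\<^esub> H2_map (G \<times>\<times> H) snd (cohomology_class H \<beta>) =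
    cohomology_class (G \<times>\<times> H) (prod_cocycle G H \<alpha> \<beta>)"
proof -
  have P: "group (G \<times>\<times> H)" using assms DirProd_group by blast
  show ?thesis
    by (simp add: prod_cocycle_def cohomology_class_mult[OF P] H2_map_class[OF P _ fst_hom] H2_map_class[OF P _ snd_hom]
        pullback2_cocycle[OF P _ fst_hom] pullback2_cocycle[OF P _ snd_hom] assms)
qed

lemma H2_DirProd_decomp:
  assumes G: "group G" "finite (carrier G)" and H: "group H" "finite (carrier H)"
    and cop: "coprime (order G) (order H)" and x: "x \<in> carrier (H2 (G \<times>\<times> H))"
  shows "H2_map (G \<times>\<times> H) fst (H2_map G (\<lambda>g. (g, \<one>\<^bsub>H\<^esub>)) x) \<otimes>\<^bsub>H2 (G \<times>\<times> H)\<^esub>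
    H2_map (G \<times>\<times> H) snd (H2_map H (\<lambda>h. (\<one>\<^bsub>G\<^esub>, h)) x) = x"
proof -
  have P: "group (G \<times>\<times> H)" using assms DirProd_group by blast
  obtain \<gamma> where g: "\<gamma> \<in> carrier (cocycles2 (G \<times>\<times> H))" "x = cohomology_class (G \<times>\<times> H) \<gamma>"
    using x by (auto simp: carrier_H2)
  note a = pullback2_cocycle[OF G(1) P inl_hom[OF H(1)] g(1)]
  note b = pullback2_cocycle[OF H(1) P inr_hom[OF G(1)] g(1)]
  show ?thesis
    unfolding g(2) H2_map_class[OF G(1) P inl_hom[OF H(1)] g(1)] H2_map_class[OF H(1) P inr_hom[OF G(1)] g(1)]
      H2_DirProd_inject[OF G(1) H(1) a b]
    by (rule cohomology_class_DirProd[OF G H cop g(1), symmetric])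
qed

text \<open>Projection after inclusion is the identity on the same factor and the trivial
  homomorphism across the factors.\<close>

lemma H2_DirProd_project:
  assumes G: "group G" and H: "group H" and c: "c \<in> carrier (H2 G)" and d: "d \<in> carrier (H2 H)"
  defines "x \<equiv> H2_map (G \<times>\<times> H) fst c \<otimes>\<^bsub>H2 (G \<times>\<times> H)\<^esub> H2_map (G \<times>\<times> H) snd d"
  shows "x \<in> carrier (H2 (G \<times>\<times> H))" "H2_map G (\<lambda>g. (g, \<one>\<^bsub>H\<^esub>)) x = c" "H2_map H (\<lambda>h. (\<one>\<^bsub>G\<^esub>, h)) x = d"
proof -
  let ?P = "G \<times>\<times> H"
  interpret G: group G by fact
  interpret H: group H by fact
  have P: "group ?P" using assms DirProd_group by blast
  interpret HG: comm_group "H2 G" by (rule comm_group_H2) fact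
  interpret HH: comm_group "H2 H" by (rule comm_group_H2) fact
  interpret HP: comm_group "H2 ?P" by (rule comm_group_H2) fact
  note h1 = H2_map_hom[OF P G fst_hom[of G H]] and h2 = H2_map_hom[OF P H snd_hom[of G H]]
  note r1 = H2_map_hom[OF G P inl_hom[OF H]] and r2 = H2_map_hom[OF H P inr_hom[OF G]]
  have m: "H2_map ?P fst c \<in> carrier (H2 ?P)" "H2_map ?P snd d \<in> carrier (H2 ?P)"
    using h1 h2 c d by (auto simp: hom_def)
  thus "x \<in> carrier (H2 ?P)" unfolding x_def by simp
  have "H2_map G (\<lambda>g. (g, \<one>\<^bsub>H\<^esub>)) (H2_map ?P fst c) = c"
    unfolding H2_map_comp[OF G P G inl_hom[OF H] fst_hom c] by (rule H2_map_ident[OF G _ c]) simp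
  moreover have "H2_map G (\<lambda>g. (g, \<one>\<^bsub>H\<^esub>)) (H2_map ?P snd d) = \<one>\<^bsub>H2 G\<^esub>"
    unfolding H2_map_comp[OF G P H inl_hom[OF H] snd_hom d] by (rule H2_map_trivial[OF G H _ d]) simp
  ultimately show "H2_map G (\<lambda>g. (g, \<one>\<^bsub>H\<^esub>)) x = c"
    unfolding x_def using c by (simp add: hom_mult[OF r1 m])
  have "H2_map H (\<lambda>h. (\<one>\<^bsub>G\<^esub>, h)) (H2_map ?P snd d) = d"
    unfolding H2_map_comp[OF H P H inr_hom[OF G] snd_hom d] by (rule H2_map_ident[OF H _ d]) simp
  moreover have "H2_map H (\<lambda>h. (\<one>\<^bsub>G\<^esub>, h)) (H2_map ?P fst c) = \<one>\<^bsub>H2 H\<^esub>"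
    unfolding H2_map_comp[OF H P G inr_hom[OF G] fst_hom c] by (rule H2_map_trivial[OF H G _ c]) simp
  ultimately show "H2_map H (\<lambda>h. (\<one>\<^bsub>G\<^esub>, h)) x = d"
    unfolding x_def using d by (simp add: hom_mult[OF r2 m])
qed

text \<open>The restriction of \<open>x\<close> to \<open>H\<close> is killed by the orders of both
  groups, hence trivial, and \<open>H2_DirProd_decomp\<close> leaves only the inflated part. Torsion
  is respected by every isomorphism of cohomology groups, which is how inflated classes are
  recognised later.\<close>

lemma H2_DirProd_torsion:
  assumes G: "group G" "finite (carrier G)" and H: "group H" "finite (carrier H)"
    and cop: "coprime (order G) (order H)" and x: "x \<in> carrier (H2 (G \<times>\<times> H))"
    and pow: "x [^]\<^bsub>H2 (G \<times>\<times> H)\<^esub> order G = \<one>\<^bsub>H2 (G \<times>\<times> H)\<^esub>"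
  shows "H2_map (G \<times>\<times> H) fst (H2_map G (\<lambda>g. (g, \<one>\<^bsub>H\<^esub>)) x) = x"
proof -
  let ?P = "G \<times>\<times> H"
  have P: "group ?P" using assms DirProd_group by blast
  interpret HG: comm_group "H2 G" by (rule comm_group_H2) fact
  interpret HH: comm_group "H2 H" by (rule comm_group_H2) fact
  interpret HP: comm_group "H2 ?P" by (rule comm_group_H2) fact
  note r1 = H2_map_hom[OF G(1) P inl_hom[OF H(1)]] and r2 = H2_map_hom[OF H(1) P inr_hom[OF G(1)]]
  interpret R: group_hom "H2 ?P" "H2 H" "H2_map H (\<lambda>h. (\<one>\<^bsub>G\<^esub>, h))" using r2 by unfold_locales
  interpret S: group_hom "H2 H" "H2 ?P" "H2_map ?P snd" using H2_map_hom[OF P H(1) snd_hom] by unfold_locales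
  interpret T: group_hom "H2 G" "H2 ?P" "H2_map ?P fst" using H2_map_hom[OF P G(1) fst_hom] by unfold_locales
  interpret U: group_hom "H2 ?P" "H2 G" "H2_map G (\<lambda>g. (g, \<one>\<^bsub>H\<^esub>))" using r1 by unfold_locales
  let ?y = "H2_map H (\<lambda>h. (\<one>\<^bsub>G\<^esub>, h)) x"
  have y: "?y \<in> carrier (H2 H)" using x by simp
  have "?y [^]\<^bsub>H2 H\<^esub> order G = \<one>\<^bsub>H2 H\<^esub>"
    using R.hom_nat_pow[OF x, of "order G"] pow by simp
  hence "?y = \<one>\<^bsub>H2 H\<^esub>"
    using HH.pow_coprime_one[OF y _ H2_pow_order[OF H y] cop] by blast
  thus ?thesis using H2_DirProd_decomp[OF G H cop x] x by simp
qed

lemma DirProd_swap_iso: "(\<lambda>(x, y). (y, x)) \<in> iso (G \<times>\<times> H) (H \<times>\<times> G)"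
  by (auto simp: iso_def hom_def DirProd_def bij_betw_def inj_on_def image_iff)

text \<open>Interchanging the factors, an isomorphism of groups compatible with the product
  cocycles, reduces this to the left factor.\<close>

lemma talg_isomorphic_DirProd_right:
  assumes G: "group G" and H: "group H" and H': "group H'"
    and iso: "talg_isomorphic H \<beta> H' \<beta>'"
  shows "talg_isomorphic (G \<times>\<times> H) (prod_cocycle G H \<alpha> \<beta>) (G \<times>\<times> H') (prod_cocycle G H' \<alpha> \<beta>')"
proof -
  have swap: "talg_isomorphic (G \<times>\<times> K) (prod_cocycle G K \<alpha> \<gamma>) (K \<times>\<times> G) (prod_cocycle K G \<gamma> \<alpha>)" if K: "group K" for K :: "('x, 'y) monoid_scheme" and \<gamma>
  proof -
    interpret KG: group "K \<times>\<times> G" by (rule DirProd_group[OF K G])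
    interpret K: group K by fact
    interpret G: group G by fact
    let ?s = "\<lambda>(x, y). (y, x)"
    have eq: "pullback2 (K \<times>\<times> G) ?s (prod_cocycle G K \<alpha> \<gamma>) (p, q) = prod_cocycle K G \<gamma> \<alpha> (p, q)"
      if "p \<in> carrier (K \<times>\<times> G)" "q \<in> carrier (K \<times>\<times> G)" for p q
      using that by (auto simp: pullback2_apply prod_cocycle_apply mult.commute)
    have "tmul (K \<times>\<times> G) (pullback2 (K \<times>\<times> G) ?s (prod_cocycle G K \<alpha> \<gamma>)) = tmul (K \<times>\<times> G) (prod_cocycle K G \<gamma> \<alpha>)"
      unfolding tmul_def zext_def fun_eq_iff
      by (auto intro!: sum.cong simp: eq simp del: carrier_DirProd mult_DirProd)
    thus ?thesis
      using talg_isomorphic_pullback[OF DirProd_group[OF K G] DirProd_group[OF G K] DirProd_swap_iso, of "prod_cocycle G K \<alpha> \<gamma>"]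
      by simp
  qed
  have "talg_isomorphic (G \<times>\<times> H) (prod_cocycle G H \<alpha> \<beta>) (H' \<times>\<times> G) (prod_cocycle H' G \<beta>' \<alpha>)"
    by (rule algebra_isomorphic_trans[OF swap[OF H] talg_isomorphic_DirProd_left[OF H H' G iso]])
  thus ?thesis
    by (rule algebra_isomorphic_trans[OF _ talg_isomorphic_sym[OF swap[OF H']]])
qed

text \<open>Under the decomposition of a class into its two restrictions, \<psi> and \<phi> act
  componentwise. Representatives are taken to be product cocycles, for which the algebras are tensor
  products and can be exchanged one factor at a time.\<close>

lemma twisted_equivalent_DirProd:
  assumes G: "group G" "finite (carrier G)" and K: "group K" "finite (carrier K)"
    and G': "group G'" "finite (carrier G')" and K': "group K'" "finite (carrier K')"
    and ord: "order G' = order G" "order K' = order K" and cop: "coprime (order G) (order K)"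
    and GG: "G \<sim>\<^sub>\<complex> G'" and KK: "K \<sim>\<^sub>\<complex> K'"
  shows "G \<times>\<times> K \<sim>\<^sub>\<complex> G' \<times>\<times> K'"
proof -
  let ?P = "G \<times>\<times> K" and ?P' = "G' \<times>\<times> K'"
  have P: "group ?P" "finite (carrier ?P)" and P': "group ?P'" "finite (carrier ?P')"
    using G K G' K' DirProd_group by auto
  have cop': "coprime (order G') (order K')" using cop ord by simp
  interpret HP: comm_group "H2 ?P" by (rule comm_group_H2[OF P(1)])
  interpret HP': comm_group "H2 ?P'" by (rule comm_group_H2[OF P'(1)])
  obtain \<psi> where p: "\<psi> \<in> iso (H2 G) (H2 G')"
    "\<And>\<alpha> \<beta>. \<alpha> \<in> carrier (cocycles2 G) \<Longrightarrow> \<beta> \<in> carrier (cocycles2 G') \<Longrightarrow>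
      \<psi> (cohomology_class G \<alpha>) = cohomology_class G' \<beta> \<Longrightarrow>
      talg_isomorphic G \<alpha> G' \<beta>"
    using twisted_equivalentD[OF G G' GG] by metis
  obtain \<phi> where q: "\<phi> \<in> iso (H2 K) (H2 K')"
    "\<And>\<alpha> \<beta>. \<alpha> \<in> carrier (cocycles2 K) \<Longrightarrow> \<beta> \<in> carrier (cocycles2 K') \<Longrightarrow>
      \<phi> (cohomology_class K \<alpha>) = cohomology_class K' \<beta> \<Longrightarrow>
      talg_isomorphic K \<alpha> K' \<beta>"
    using twisted_equivalentD[OF K K' KK] by metis
  let ?i1 = "H2_map ?P fst" and ?i2 = "H2_map ?P snd" and ?i1' = "H2_map ?P' fst" and ?i2' = "H2_map ?P' snd"
  let ?r1 = "H2_map G (\<lambda>g. (g, \<one>\<^bsub>K\<^esub>))" and ?r2 = "H2_map K (\<lambda>h. (\<one>\<^bsub>G\<^esub>, h))"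
  let ?r1' = "H2_map G' (\<lambda>g. (g, \<one>\<^bsub>K'\<^esub>))" and ?r2' = "H2_map K' (\<lambda>h. (\<one>\<^bsub>G'\<^esub>, h))"
  note h1' = H2_map_hom[OF P'(1) G'(1) fst_hom] and h2' = H2_map_hom[OF P'(1) K'(1) snd_hom]
  note r1 = H2_map_hom[OF G(1) P(1) inl_hom[OF K(1)]] and r2 = H2_map_hom[OF K(1) P(1) inr_hom[OF G(1)]]
  note r1' = H2_map_hom[OF G'(1) P'(1) inl_hom[OF K'(1)]] and r2' = H2_map_hom[OF K'(1) P'(1) inr_hom[OF G'(1)]]
  have ph: "\<psi> \<in> hom (H2 G) (H2 G')" "\<phi> \<in> hom (H2 K) (H2 K')" and
    pb: "bij_betw \<psi> (carrier (H2 G)) (carrier (H2 G'))" "bij_betw \<phi> (carrier (H2 K)) (carrier (H2 K'))"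
    using p(1) q(1) by (auto simp: iso_def)
  note cl = hom_in_carrier[OF ph(1)] hom_in_carrier[OF ph(2)] hom_in_carrier[OF r1] hom_in_carrier[OF r2]
    hom_in_carrier[OF r1'] hom_in_carrier[OF r2'] hom_in_carrier[OF h1'] hom_in_carrier[OF h2']
  define \<theta> where "\<theta> x = ?i1' (\<psi> (?r1 x)) \<otimes>\<^bsub>H2 ?P'\<^esub> ?i2' (\<phi> (?r2 x))" for x
  have \<theta>hom: "\<theta> \<in> hom (H2 ?P) (H2 ?P')"
  proof (rule homI)
    fix x y assume xy: "x \<in> carrier (H2 ?P)" "y \<in> carrier (H2 ?P)"
    show "\<theta> (x \<otimes>\<^bsub>H2 ?P\<^esub> y) = \<theta> x \<otimes>\<^bsub>H2 ?P'\<^esub> \<theta> y"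
      using xy by (simp add: \<theta>_def hom_mult[OF r1] hom_mult[OF r2] hom_mult[OF ph(1)] hom_mult[OF ph(2)]
          hom_mult[OF h1'] hom_mult[OF h2'] cl HP'.m_ac)
  qed (simp add: \<theta>_def cl)
  let ?\<psi>' = "inv_into (carrier (H2 G)) \<psi>" and ?\<phi>' = "inv_into (carrier (H2 K)) \<phi>"
  have inv: "?\<psi>' c \<in> carrier (H2 G)" "\<psi> (?\<psi>' c) = c" if "c \<in> carrier (H2 G')" for c
    using that pb(1) by (auto simp: bij_betw_def inv_into_into f_inv_into_f)
  have inv': "?\<phi>' c \<in> carrier (H2 K)" "\<phi> (?\<phi>' c) = c" if "c \<in> carrier (H2 K')" for c
    using that pb(2) by (auto simp: bij_betw_def inv_into_into f_inv_into_f)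
  have "bij_betw \<theta> (carrier (H2 ?P)) (carrier (H2 ?P'))"
    unfolding bij_betw_def
  proof
    show "inj_on \<theta> (carrier (H2 ?P))"
    proof (rule inj_onI)
      fix x y assume xy: "x \<in> carrier (H2 ?P)" "y \<in> carrier (H2 ?P)" and e: "\<theta> x = \<theta> y"
      have "?r1' (\<theta> z) = \<psi> (?r1 z)" "?r2' (\<theta> z) = \<phi> (?r2 z)" if "z \<in> carrier (H2 ?P)" for z
        unfolding \<theta>_def using that by (intro H2_DirProd_project G' K' cl; assumption)+
      with xy e have "\<psi> (?r1 x) = \<psi> (?r1 y)" "\<phi> (?r2 x) = \<phi> (?r2 y)" by metis+
      hence "?r1 x = ?r1 y" "?r2 x = ?r2 y"
        using pb xy by (auto simp: bij_betw_def cl dest: inj_onD)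
      thus "x = y" using H2_DirProd_decomp[OF G K cop] xy by metis
    qed
    show "\<theta> ` carrier (H2 ?P) = carrier (H2 ?P')"
    proof
      show "\<theta> ` carrier (H2 ?P) \<subseteq> carrier (H2 ?P')" using \<theta>hom by (auto simp: hom_def)
      show "carrier (H2 ?P') \<subseteq> \<theta> ` carrier (H2 ?P)"
      proof
        fix z assume z: "z \<in> carrier (H2 ?P')"
        let ?c = "?\<psi>' (?r1' z)" and ?d = "?\<phi>' (?r2' z)"
        have cd: "?c \<in> carrier (H2 G)" "?d \<in> carrier (H2 K)" using z inv inv' cl by auto
        note pr = H2_DirProd_project[OF G(1) K(1) cd]
        have "\<theta> (?i1 ?c \<otimes>\<^bsub>H2 ?P\<^esub> ?i2 ?d) = z"
          unfolding \<theta>_def pr(2,3) using z inv inv' cl by (simp add: H2_DirProd_decomp[OF G' K' cop'])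
        thus "z \<in> \<theta> ` carrier (H2 ?P)" using pr(1) by blast
      qed
    qed
  qed
  hence "\<theta> \<in> iso (H2 ?P) (H2 ?P')" using \<theta>hom by (simp add: iso_def)
  thus ?thesis
  proof (rule twisted_equivalentI[OF P P'])
    fix \<gamma> assume g: "\<gamma> \<in> carrier (cocycles2 ?P)"
    let ?x = "cohomology_class ?P \<gamma>"
    have x: "?x \<in> carrier (H2 ?P)" using g by (simp add: carrier_H2)
    obtain \<alpha> where a: "\<alpha> \<in> carrier (cocycles2 G)" "?r1 ?x = cohomology_class G \<alpha>"
      using cl(3)[OF x] by (auto simp: carrier_H2)
    obtain \<beta> where b: "\<beta> \<in> carrier (cocycles2 K)" "?r2 ?x = cohomology_class K \<beta>"
      using cl(4)[OF x] by (auto simp: carrier_H2)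
    obtain \<alpha>' where a': "\<alpha>' \<in> carrier (cocycles2 G')" "\<psi> (?r1 ?x) = cohomology_class G' \<alpha>'"
      using cl(1)[OF cl(3)[OF x]] by (auto simp: carrier_H2)
    obtain \<beta>' where b': "\<beta>' \<in> carrier (cocycles2 K')" "\<phi> (?r2 ?x) = cohomology_class K' \<beta>'"
      using cl(2)[OF cl(4)[OF x]] by (auto simp: carrier_H2)
    have 1: "cohomology_class ?P (prod_cocycle G K \<alpha> \<beta>) = ?x"
      using H2_DirProd_decomp[OF G K cop x] H2_DirProd_inject[OF G(1) K(1) a(1) b(1)] a b by simp
    have 2: "\<theta> ?x = cohomology_class ?P' (prod_cocycle G' K' \<alpha>' \<beta>')"
      using H2_DirProd_inject[OF G'(1) K'(1) a'(1) b'(1)] a' b' by (simp add: \<theta>_def)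
    have "talg_isomorphic ?P (prod_cocycle G K \<alpha> \<beta>) ?P' (prod_cocycle G' K' \<alpha>' \<beta>')"
      using p(2)[OF a(1) a'(1)] q(2)[OF b(1) b'(1)] a(2) a'(2) b(2) b'(2)
      by (intro algebra_isomorphic_trans[OF talg_isomorphic_DirProd_left[OF G(1) G'(1) K(1)]
            talg_isomorphic_DirProd_right[OF G'(1) K(1) K'(1)]]) simp_all
    thus "\<exists>\<gamma>1\<in>carrier (cocycles2 ?P). \<exists>\<gamma>2\<in>carrier (cocycles2 ?P').
        cohomology_class ?P \<gamma>1 = ?x \<and> \<theta> ?x = cohomology_class ?P' \<gamma>2 \<and>
        talg_isomorphic ?P \<gamma>1 ?P' \<gamma>2"
      using 1 2 prod_cocycle_cocycle[OF G(1) K(1) a(1) b(1)] prod_cocycle_cocycle[OF G'(1) K'(1) a'(1) b'(1)]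
      by blast
  qed
qed

section \<open>Traces of linear operators\<close>

definition delta :: "'a \<Rightarrow> 'a \<Rightarrow> complex"
  where "delta g = (\<lambda>x. of_bool (x = g))"

lemma delta_mem: "g \<in> C \<Longrightarrow> delta g \<in> fspace C"
  by (auto simp: delta_def fspace_def)

lemma fspace_expand:
  assumes "finite C" "a \<in> fspace C"
  shows "a = (\<Sum>g\<in>C. cscale (a g) (delta g))"
proof (rule fspace_eqI[OF assms(2)])
  show "(\<Sum>g\<in>C. cscale (a g) (delta g)) \<in> fspace C"
    by (intro cfun.subspace_sum[OF subspace_fspace] cfun.subspace_scale[OF subspace_fspace] delta_mem)
  fix x assume "x \<in> C"
  thus "a x = (\<Sum>g\<in>C. cscale (a g) (delta g)) x"
    using assms(1) by (simp add: sum_fun_apply delta_def of_bool_def if_distrib[of "\<lambda>z. _ * z"] cong: if_cong)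
qed

lemma span_delta:
  assumes "finite C"
  shows "cfun.span (delta ` C) = fspace C"
proof
  show "cfun.span (delta ` C) \<subseteq> fspace C"
    by (rule cfun.span_minimal) (auto simp: delta_mem subspace_fspace)
  show "fspace C \<subseteq> cfun.span (delta ` C)"
  proof
    fix a assume "a \<in> fspace C"
    hence "a = (\<Sum>g\<in>C. cscale (a g) (delta g))" by (rule fspace_expand[OF assms])
    thus "a \<in> cfun.span (delta ` C)"
      by (metis (no_types, lifting) cfun.span_base cfun.span_scale cfun.span_sum imageI)
  qed
qed

lemma finite_independent_fspace:
  assumes "finite C" "cfun.independent B" "B \<subseteq> fspace C"
  shows "finite B" "card B \<le> card C"
proof -
  have "finite B \<and> card B \<le> card (delta ` C)"
    by (rule cfun.independent_span_bound) (use assms span_delta[OF assms(1)] in auto)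
  thus "finite B" by blast
  show "card B \<le> card C"
    using \<open>finite B \<and> card B \<le> card (delta ` C)\<close> card_image_le[OF assms(1), of delta] by linarith
qed

abbreviation clinear :: "(('a \<Rightarrow> complex) \<Rightarrow> 'b \<Rightarrow> complex) \<Rightarrow> bool"
  where "clinear \<equiv> Vector_Spaces.linear cscale cscale"

definition optrace :: "'a set \<Rightarrow> (('a \<Rightarrow> complex) \<Rightarrow> 'a \<Rightarrow> complex) \<Rightarrow> complex"
  where "optrace C T = (\<Sum>g\<in>C. T (delta g) g)"

text \<open>Independence of the trace from the basis: each \<open>delta g\<close> is expanded in
  \<open>B\<close>, each \<open>T b\<close> in the vectors \<open>delta g\<close>, and the two sums
  are exchanged.\<close>

lemma optrace_basis:
  assumes C: "finite C" and T: "clinear T" "\<And>a. a \<in> fspace C \<Longrightarrow> T a \<in> fspace C"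
    and B: "cfun.independent B" "cfun.span B = fspace C"
  shows "optrace C T = (\<Sum>b\<in>B. cfun.representation B (T b) b)"
proof -
  interpret T: Vector_Spaces.linear cscale cscale T by fact
  have BC: "B \<subseteq> fspace C" using B(2) cfun.span_superset by blast
  have fin: "finite B" by (rule finite_independent_fspace[OF C B(1) BC])
  have ex: "v = (\<Sum>b\<in>B. cscale (cfun.representation B v b) b)" if "v \<in> fspace C" for v
    using cfun.sum_representation_eq[OF B(1) _ fin] that B(2) by (metis order_refl)
  have "optrace C T = (\<Sum>g\<in>C. \<Sum>b\<in>B. cfun.representation B (delta g) b * T b g)"
    unfolding optrace_def
  proof (rule sum.cong)
    fix g assume "g \<in> C"
    hence "T (delta g) = T (\<Sum>b\<in>B. cscale (cfun.representation B (delta g) b) b)"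
      using ex[OF delta_mem] by metis
    also have "\<dots> = (\<Sum>b\<in>B. cscale (cfun.representation B (delta g) b) (T b))"
      by (simp only: T.sum T.scale)
    finally show "T (delta g) g = (\<Sum>b\<in>B. cfun.representation B (delta g) b * T b g)"
      by (simp add: sum_fun_apply)
  qed simp
  also have "\<dots> = (\<Sum>b\<in>B. \<Sum>g\<in>C. T b g * cfun.representation B (delta g) b)"
    by (subst sum.swap) (simp add: mult.commute)
  also have "\<dots> = (\<Sum>b\<in>B. cfun.representation B (T b) b)"
  proof (rule sum.cong)
    fix b assume "b \<in> B"
    hence Tb: "T b \<in> fspace C" using BC T(2) by blast
    have d: "delta g \<in> cfun.span B" if "g \<in> C" for g unfolding B(2) using that by (rule delta_mem)
    have "cfun.representation B (T b) b = cfun.representation B (\<Sum>g\<in>C. cscale (T b g) (delta g)) b"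
      by (rule arg_cong[of _ _ "\<lambda>v. cfun.representation B v b"]) (rule fspace_expand[OF C Tb])
    also have "\<dots> = (\<Sum>g\<in>C. cfun.representation B (cscale (T b g) (delta g)) b)"
      by (subst cfun.representation_sum[OF B(1)]) (auto simp: d cfun.span_scale)
    also have "\<dots> = (\<Sum>g\<in>C. T b g * cfun.representation B (delta g) b)"
      by (rule sum.cong) (simp_all add: cfun.representation_scale[OF B(1)] d)
    finally show "(\<Sum>g\<in>C. T b g * cfun.representation B (delta g) b) = cfun.representation B (T b) b" by simp
  qed simp
  finally show ?thesis .
qed

text \<open>The trace can be computed on any subspace containing the image: when \<open>B0\<close>
  is extended to a basis, \<open>T b\<close> has no component along an added vector
  \<open>b\<close>.\<close>

lemma optrace_range:
  assumes C: "finite C" and T: "clinear T" and K: "K \<subseteq> fspace C"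
    and TK: "\<And>a. a \<in> fspace C \<Longrightarrow> T a \<in> K"
    and B0: "cfun.independent B0" "cfun.span B0 = K"
  shows "optrace C T = (\<Sum>b\<in>B0. cfun.representation B0 (T b) b)"
proof -
  have B0K: "B0 \<subseteq> fspace C" using B0(2) K cfun.span_superset by blast
  obtain B where B: "B0 \<subseteq> B" "B \<subseteq> fspace C" "cfun.independent B" "fspace C \<subseteq> cfun.span B"
    using cfun.maximal_independent_subset_extend[OF B0K B0(1)] by metis
  have span: "cfun.span B = fspace C"
    using B(4) cfun.span_minimal[OF B(2) subspace_fspace] by blast
  have fin: "finite B" by (rule finite_independent_fspace[OF C B(3,2)])
  have rep: "cfun.representation B (T b) = cfun.representation B0 (T b)" if "b \<in> B" for b
    by (rule cfun.representation_extend[OF B(3) _ B(1)]) (use TK that B(2) B0(2) in blast)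
  have "optrace C T = (\<Sum>b\<in>B. cfun.representation B (T b) b)"
    by (rule optrace_basis[OF C T _ B(3) span]) (use TK K in blast)
  also have "\<dots> = (\<Sum>b\<in>B. cfun.representation B0 (T b) b)" by (simp add: rep)
  also have "\<dots> = (\<Sum>b\<in>B0. cfun.representation B0 (T b) b)"
    by (rule sum.mono_neutral_right[OF fin B(1)]) (use cfun.representation_ne_zero in blast)
  finally show ?thesis .
qed

lemma subspace_image_clinear:
  assumes "clinear T" "cfun.subspace S"
  shows "cfun.subspace (T ` S)"
proof -
  interpret T: Vector_Spaces.linear cscale cscale T by fact
  show ?thesis by (rule T.subspace_image[OF assms(2)])
qed

text \<open>On its image an idempotent operator is the identity, so \<open>optrace_range\<close>
  yields the dimension of the image.\<close>

lemma optrace_idempotent: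
  assumes C: "finite C" and T: "clinear T" "\<And>a. a \<in> fspace C \<Longrightarrow> T a \<in> fspace C"
    and idem: "\<And>a. a \<in> fspace C \<Longrightarrow> T (T a) = T a"
  shows "optrace C T = of_nat (cfun.dim (T ` fspace C))"
proof -
  let ?K = "T ` fspace C"
  have sK: "cfun.subspace ?K" by (rule subspace_image_clinear[OF T(1) subspace_fspace])
  obtain B where B: "B \<subseteq> ?K" "cfun.independent B" "?K \<subseteq> cfun.span B" "card B = cfun.dim ?K"
    using cfun.basis_exists by metis
  have span: "cfun.span B = ?K" using B(3) cfun.span_minimal[OF B(1) sK] by blast
  have "optrace C T = (\<Sum>b\<in>B. cfun.representation B (T b) b)"
    by (rule optrace_range[OF C T(1) _ _ B(2) span]) (use T(2) in auto)
  also have "\<dots> = (\<Sum>b\<in>B. 1)"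
  proof (rule sum.cong)
    fix b assume b: "b \<in> B"
    hence "T b = b" using B(1) idem by auto
    thus "cfun.representation B (T b) b = 1" by (simp add: cfun.representation_basis[OF B(2) b])
  qed simp
  finally show ?thesis using B(4) by simp
qed

text \<open>An operator of square zero vanishes on its image, and the trace can be computed
  there.\<close>

lemma optrace_square_zero:
  assumes C: "finite C" and T: "clinear T" "\<And>a. a \<in> fspace C \<Longrightarrow> T a \<in> fspace C"
    and nil: "\<And>a. a \<in> fspace C \<Longrightarrow> T (T a) = 0"
  shows "optrace C T = 0"
proof -
  let ?K = "T ` fspace C"
  have sK: "cfun.subspace ?K" by (rule subspace_image_clinear[OF T(1) subspace_fspace])
  obtain B where B: "B \<subseteq> ?K" "cfun.independent B" "?K \<subseteq> cfun.span B" "card B = cfun.dim ?K"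
    using cfun.basis_exists by metis
  have span: "cfun.span B = ?K" using B(3) cfun.span_minimal[OF B(1) sK] by blast
  have "optrace C T = (\<Sum>b\<in>B. cfun.representation B (T b) b)"
    by (rule optrace_range[OF C T(1) _ _ B(2) span]) (use T(2) in auto)
  also have "\<dots> = (\<Sum>b\<in>B. 0)"
  proof (rule sum.cong)
    fix b assume b: "b \<in> B"
    hence "T b = 0" using B(1) nil by auto
    thus "cfun.representation B (T b) b = 0" by (simp add: cfun.representation_zero)
  qed simp
  finally show ?thesis by simp
qed

lemma dim_one_span:
  assumes "cfun.subspace K" "cfun.dim K = 1"
  obtains b where "K = cfun.span {b}"
proof -
  obtain B where B: "B \<subseteq> K" "cfun.independent B" "K \<subseteq> cfun.span B" "card B = cfun.dim K"
    using cfun.basis_exists by metis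
  then obtain b where "B = {b}" using assms(2) card_1_singletonE by metis
  thus thesis using that[of b] B(3) cfun.span_minimal[OF B(1) assms(1)] by blast
qed

section \<open>Polynomials in an operator and their splitting into linear factors\<close>

text \<open>The vector p(T) w by Horner's scheme; \<open>fold_coeffs\<close> has the constant
  coefficient outermost.\<close>

definition poly_op :: "(('a \<Rightarrow> complex) \<Rightarrow> 'a \<Rightarrow> complex) \<Rightarrow> complex poly \<Rightarrow> ('a \<Rightarrow> complex) \<Rightarrow> 'a \<Rightarrow> complex"
  where "poly_op T p w = fold_coeffs (\<lambda>c v. cscale c w + T v) p 0"

lemma cscale_zero: "cscale 0 w = 0"
  by (auto simp: fun_eq_iff)

lemma poly_op_0: "poly_op T 0 w = 0"
  by (simp add: poly_op_def)

lemma poly_op_pCons: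
  assumes "clinear T"
  shows "poly_op T (pCons c p) w = cscale c w + T (poly_op T p w)"
proof -
  interpret T: Vector_Spaces.linear cscale cscale T by fact
  show ?thesis
  proof (cases "pCons c p = 0")
    case True
    hence "c = 0" "p = 0" by auto
    thus ?thesis by (simp only: pCons_0_0 poly_op_0 T.zero cscale_zero) simp
  next
    case False
    hence "c \<noteq> 0 \<or> p \<noteq> 0" by auto
    thus ?thesis unfolding poly_op_def by (auto simp: fun_eq_iff)
  qed
qed

lemma poly_op_add:
  assumes "clinear T"
  shows "poly_op T (p + q) w = poly_op T p w + poly_op T q w"
proof -
  interpret T: Vector_Spaces.linear cscale cscale T by fact
  show ?thesis
  proof (induction p q rule: poly_induct2)
    case 0 show ?case by (simp only: add_0_left poly_op_0)
  next
    case (pCons a p b q)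
    show ?case
      by (simp only: add_pCons poly_op_pCons[OF assms] pCons.IH T.add cfun.scale_left_distrib add_ac)
  qed
qed

lemma poly_op_smult:
  assumes "clinear T"
  shows "poly_op T (Polynomial.smult c p) w = cscale c (poly_op T p w)"
proof -
  interpret T: Vector_Spaces.linear cscale cscale T by fact
  show ?thesis
  proof (induction p)
    case 0 show ?case by (simp only: smult_0_right poly_op_0 cfun.scale_zero_right)
  next
    case (pCons a p)
    show ?case
      by (simp only: smult_pCons poly_op_pCons[OF assms] pCons.IH T.scale cfun.scale_right_distrib cfun.scale_scale)
  qed
qed

lemma clinear_poly_op:
  assumes "clinear T"
  shows "clinear (poly_op T p)"
proof -
  interpret T: Vector_Spaces.linear cscale cscale T by fact
  have "poly_op T p (v + w) = poly_op T p v + poly_op T p w" for v w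
  proof (induction p)
    case 0 show ?case by (simp only: poly_op_0 add_0_left)
  next
    case (pCons a p)
    show ?case by (simp only: poly_op_pCons[OF assms] pCons.IH T.add cfun.scale_right_distrib add_ac)
  qed
  moreover have "poly_op T p (cscale c w) = cscale c (poly_op T p w)" for c w
  proof (induction p)
    case 0 show ?case by (simp only: poly_op_0 cfun.scale_zero_right)
  next
    case (pCons a p)
    show ?case
      by (simp only: poly_op_pCons[OF assms] pCons.IH T.scale cfun.scale_right_distrib cfun.scale_scale mult.commute)
  qed
  ultimately show ?thesis by unfold_locales
qed

lemma poly_op_commute:
  assumes "clinear T"
  shows "poly_op T p (T w) = T (poly_op T p w)"
proof -
  interpret T: Vector_Spaces.linear cscale cscale T by fact
  show ?thesis
  proof (induction p)
    case 0 show ?case by (simp only: poly_op_0 T.zero)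
  next
    case (pCons a p)
    show ?case by (simp only: poly_op_pCons[OF assms] pCons.IH T.add T.scale)
  qed
qed

lemma poly_op_linear_factor:
  assumes "clinear T"
  shows "poly_op T ([:- r, 1:] * q) w = poly_op T q (T w - cscale r w)"
proof -
  interpret T: Vector_Spaces.linear cscale cscale T by fact
  interpret q: Vector_Spaces.linear cscale cscale "poly_op T q" by (rule clinear_poly_op[OF assms])
  have "[:- r, 1:] * q = Polynomial.smult (- r) q + pCons 0 q" by simp
  hence "poly_op T ([:- r, 1:] * q) w = cscale (- r) (poly_op T q w) + (cscale 0 w + T (poly_op T q w))"
    by (simp only: poly_op_add[OF assms] poly_op_smult[OF assms] poly_op_pCons[OF assms])
  also have "\<dots> = T (poly_op T q w) - cscale r (poly_op T q w)" by (auto simp: fun_eq_iff)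
  also have "\<dots> = poly_op T q (T w - cscale r w)" by (simp only: q.diff q.scale poly_op_commute[OF assms])
  finally show ?thesis .
qed

text \<open>Over the complex numbers \<open>p\<close> splits. Induction on the degree removes one
  linear factor at a time, and the nonzero constant that remains can only kill the zero
  vector.\<close>

lemma poly_op_annihilates_split:
  assumes T: "clinear T" and "p \<noteq> 0" "poly_op T p w = 0"
  shows "\<exists>rs. foldr (\<lambda>r v. T v - cscale r v) rs w = 0"
  using assms(2,3)
proof (induction "Polynomial.degree p" arbitrary: p w)
  case 0
  then obtain c where c: "p = [:c:]" "c \<noteq> 0" by (metis degree_eq_zeroE pCons_0_0)
  interpret T: Vector_Spaces.linear cscale cscale T by fact
have "poly_op T [:c:] w = cscale c w"
    by (simp only: poly_op_pCons[OF T] poly_op_0 T.zero add_0_right)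
  hence "cscale c w = 0" using 0(3) c(1) by metis
  hence "w = 0" using c(2) \<open>cscale c w = 0\<close> cfun.scale_eq_0_iff by blast
  thus ?case by (intro exI[of _ "[]"]) simp
next
  case (Suc n)
  have "\<not> constant (poly p)" using Suc(2) by (simp add: constant_degree)
  then obtain r where "poly p r = 0" using fundamental_theorem_of_algebra by blast
  then obtain q where q: "p = [:- r, 1:] * q" by (auto simp: poly_eq_0_iff_dvd dvd_def)
  have "q \<noteq> 0" using q Suc(3) by auto
  have "Polynomial.degree p = Polynomial.degree [:- r, 1:] + Polynomial.degree q"
    unfolding q by (rule degree_mult_eq) (use \<open>q \<noteq> 0\<close> in auto)
  hence "Polynomial.degree q = n" using Suc(2) by simp
  moreover have "poly_op T q (T w - cscale r w) = 0" using Suc(4) unfolding q poly_op_linear_factor[OF T] .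
  ultimately obtain rs where "foldr (\<lambda>r v. T v - cscale r v) rs (T w - cscale r w) = 0"
    using Suc(1)[of q] \<open>q \<noteq> 0\<close> by blast
  \<comment> \<open>\<open>foldr\<close> applies the last entry of the list first, and the factor
    split off here acts on \<open>w\<close> first.\<close>
  thus ?case by (intro exI[of _ "rs @ [r]"]) simp
qed

text \<open>Finite dimension makes the iterates of \<open>T\<close> on \<open>w\<close> linearly
  dependent, and a dependence is a nonzero polynomial in \<open>T\<close> annihilating
  \<open>w\<close>.\<close>

lemma exists_annihilating_roots:
  assumes C: "finite C" and T: "clinear T" "\<And>a. a \<in> fspace C \<Longrightarrow> T a \<in> fspace C" and w: "w \<in> fspace C"
  shows "\<exists>rs. foldr (\<lambda>r v. T v - cscale r v) rs w = 0"
proof -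
  interpret T: Vector_Spaces.linear cscale cscale T by fact
  have mon: "poly_op T (Polynomial.monom c i) w = cscale c ((T ^^ i) w)" for c i
  proof (induction i)
    case 0 show ?case by (simp only: monom_0 poly_op_pCons[OF T(1)] poly_op_0 T.zero add_0_right funpow_0)
  next
    case (Suc i)
    show ?case by (simp only: monom_Suc poly_op_pCons[OF T(1)] Suc cscale_zero add_0_left T.scale funpow.simps comp_apply)
  qed
  have psum: "poly_op T (\<Sum>i\<in>I. f i) w = (\<Sum>i\<in>I. poly_op T (f i) w)" if "finite I" for f and I :: "nat set"
    using that
  proof (induction I)
    case empty show ?case by (simp only: sum.empty poly_op_0)
  next
    case (insert i I)
    show ?case by (simp only: sum.insert[OF insert.hyps] poly_op_add[OF T(1)] insert.IH)
  qed
  have mem: "(T ^^ i) w \<in> fspace C" for i by (induction i) (auto simp: w T(2))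
  \<comment> \<open>These are \<open>card C + 1\<close> exponents, one more than the
    dimension.\<close>
  let ?N = "{..card C}"
  have "\<exists>p. p \<noteq> 0 \<and> poly_op T p w = 0"
  proof (cases "inj_on (\<lambda>i. (T ^^ i) w) ?N")
    \<comment> \<open>Repeated vectors do not show up as a dependence of the set of iterates, so
      coinciding powers are treated apart, with the polynomial X^i - X^j.\<close>
    case False
    then obtain i j where ij: "i \<noteq> j" "(T ^^ i) w = (T ^^ j) w" by (auto simp: inj_on_def)
    let ?p = "Polynomial.monom 1 i + Polynomial.monom (-1) j :: complex poly"
    have "Polynomial.coeff ?p i = 1" using ij(1) by simp
    hence "?p \<noteq> 0" by (metis coeff_0 zero_neq_one)
    moreover have "poly_op T ?p w = 0"
      unfolding poly_op_add[OF T(1)] mon ij(2) by (auto simp: fun_eq_iff)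
    ultimately show ?thesis by blast
  next
    case True
    let ?S = "(\<lambda>i. (T ^^ i) w) ` ?N"
    have "card ?S = card C + 1" using True by (simp add: card_image)
    hence "cfun.dependent ?S" using finite_independent_fspace(2)[OF C, of ?S] mem by fastforce
    then obtain c v where c: "v \<in> ?S" "c v \<noteq> 0" "(\<Sum>v\<in>?S. cscale (c v) v) = 0"
      using cfun.dependent_finite[of ?S] by auto
    let ?p = "\<Sum>i\<in>?N. Polynomial.monom (c ((T ^^ i) w)) i"
    obtain i where i: "i \<in> ?N" "v = (T ^^ i) w" using c(1) by auto
    have "Polynomial.coeff ?p i = c v" using i by (simp add: coeff_sum if_distrib cong: if_cong)
    hence "?p \<noteq> 0" using c(2) by (metis coeff_0)
    moreover have "poly_op T ?p w = 0"
      using c(3) by (simp only: psum finite_atMost mon sum.reindex[OF True] comp_def)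
    ultimately show ?thesis by (intro exI[of _ ?p] conjI)
  qed
  thus ?thesis using poly_op_annihilates_split[OF T(1)] by blast
qed

section \<open>Primitive central idempotents\<close>

lemma tmul_zero_left: "tmul G \<alpha> 0 a = 0"
  by (auto simp: tmul_def zext_def fun_eq_iff)

lemma tmul_zero_right: "tmul G \<alpha> a 0 = 0"
  by (auto simp: tmul_def zext_def fun_eq_iff)

lemma tmul_diff_left: "tmul G \<alpha> (a - b) c = tmul G \<alpha> a c - tmul G \<alpha> b c"
  by (auto simp: tmul_def zext_def fun_eq_iff algebra_simps sum_subtractf)

lemma tmul_diff_right: "tmul G \<alpha> c (a - b) = tmul G \<alpha> c a - tmul G \<alpha> c b"
  by (auto simp: tmul_def zext_def fun_eq_iff algebra_simps sum_subtractf)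

lemma clinear_tmul_left: "clinear (tmul G \<alpha> a)"
  by unfold_locales (rule tmul_add_right tmul_scale_right)+

lemma clinear_tmul_right: "clinear (\<lambda>x. tmul G \<alpha> x a)"
  by unfold_locales (rule tmul_add_left tmul_scale_left)+

lemma tmul_sum_right: "tmul G \<alpha> a (\<Sum>i\<in>I. f i) = (\<Sum>i\<in>I. tmul G \<alpha> a (f i))"
proof -
  interpret T: Vector_Spaces.linear cscale cscale "tmul G \<alpha> a" by (rule clinear_tmul_left)
  show ?thesis by (rule T.sum)
qed

lemma tmul_sum_left: "tmul G \<alpha> (\<Sum>i\<in>I. f i) a = (\<Sum>i\<in>I. tmul G \<alpha> (f i) a)"
proof -
  interpret T: Vector_Spaces.linear cscale cscale "\<lambda>x. tmul G \<alpha> x a" by (rule clinear_tmul_right)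
  show ?thesis by (rule T.sum)
qed

section \<open>Trace form, centre and idempotents of one twisted group algebra\<close>

locale twisted_alg = group G for G (structure) +
  fixes \<alpha> :: "'a \<times> 'a \<Rightarrow> complex"
  assumes fin: "finite (carrier G)" and cocycle: "\<alpha> \<in> carrier (cocycles2 G)"
begin

abbreviation m (infixl \<open>\<star>\<close> 70) where "a \<star> b \<equiv> tmul G \<alpha> a b"
abbreviation V where "V \<equiv> talg G"
abbreviation e1 where "e1 \<equiv> tone G \<alpha>"

lemmas nz = cocycle2_nz[OF cocycle]
lemmas one_l = cocycle2_one_left[OF group_axioms cocycle]
lemmas one_r = cocycle2_one_right[OF group_axioms cocycle]
lemmas assoc = tmul_assoc[OF group_axioms fin cocycle]
lemmas unit_l = tmul_one_left[OF group_axioms fin cocycle]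
lemmas unit_r = tmul_one_right[OF group_axioms fin cocycle]
lemmas unit_mem = tone_mem[OF group_axioms]
lemmas bilin = tmul_add_left tmul_add_right tmul_diff_left tmul_diff_right tmul_scale_left tmul_scale_right
  tmul_zero_left tmul_zero_right

lemma V_closed:
  "a \<in> V \<Longrightarrow> b \<in> V \<Longrightarrow> a + b \<in> V" "a \<in> V \<Longrightarrow> b \<in> V \<Longrightarrow> a - b \<in> V" "a \<in> V \<Longrightarrow> cscale c a \<in> V" "0 \<in> V"
  by (auto simp: fspace_def)

lemma tmul_apply: "x \<in> carrier G \<Longrightarrow> (a \<star> b) x = (\<Sum>g\<in>carrier G. \<alpha> (g, inv g \<otimes> x) * a g * b (inv g \<otimes> x))"
  by (simp add: tmul_def)

lemma mul_delta_apply: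
  assumes h: "h \<in> carrier G" and x: "x \<in> carrier G"
  shows "(a \<star> delta h) x = \<alpha> (x \<otimes> inv h, h) * a (x \<otimes> inv h)"
proof -
  have iff: "inv g \<otimes> x = h \<longleftrightarrow> g = x \<otimes> inv h" if "g \<in> carrier G" for g
    using that h x inv_solve_left inv_solve_right' by (metis m_closed inv_closed)
  have h': "inv (x \<otimes> inv h) \<otimes> x = h" using iff[of "x \<otimes> inv h"] h x by simp
  have "(a \<star> delta h) x = (\<Sum>g\<in>carrier G. if g = x \<otimes> inv h then \<alpha> (x \<otimes> inv h, h) * a (x \<otimes> inv h) else 0)"
    unfolding tmul_apply[OF x] by (rule sum.cong) (use iff h' in \<open>auto simp: delta_def\<close>)
  thus ?thesis using fin h x by simp
qed

lemma delta_mul: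
  assumes g: "g \<in> carrier G" and h: "h \<in> carrier G"
  shows "delta g \<star> delta h = cscale (\<alpha> (g, h)) (delta (g \<otimes> h))"
proof (rule fspace_eqI[of _ "carrier G"])
  show "cscale (\<alpha> (g, h)) (delta (g \<otimes> h)) \<in> V" using g h by (intro V_closed delta_mem) simp
  fix x assume x: "x \<in> carrier G"
  have "x \<otimes> inv h = g \<longleftrightarrow> x = g \<otimes> h" using g h x inv_solve_right' by metis
  thus "(delta g \<star> delta h) x = cscale (\<alpha> (g, h)) (delta (g \<otimes> h)) x"
    unfolding mul_delta_apply[OF h x] by (auto simp: delta_def)
qed simp

lemma V_expand: "a \<in> V \<Longrightarrow> a = (\<Sum>g\<in>carrier G. cscale (a g) (delta g))"
  by (rule fspace_expand[OF fin])

lemma unit_eq: "e1 = cscale (inverse (\<alpha> (\<one>, \<one>))) (delta \<one>)"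
  by (auto simp: tone_def delta_def fun_eq_iff)

text \<open>The trace of left multiplication by \<open>a\<close>: as \<open>optrace_eq\<close>
  shows, every diagonal entry equals \<alpha>(1,1) a(1).\<close>

definition tr where "tr a = of_nat (order G) * \<alpha> (\<one>, \<one>) * a \<one>"

lemma optrace_eq: "optrace (carrier G) (\<lambda>x. a \<star> x) = tr a"
proof -
  have "(a \<star> delta g) g = \<alpha> (\<one>, \<one>) * a \<one>" if "g \<in> carrier G" for g
    using that by (simp add: mul_delta_apply one_l[OF that])
  thus ?thesis by (simp add: optrace_def tr_def order_def)
qed

lemma tr_lin: "tr (a + b) = tr a + tr b" "tr (cscale c a) = c * tr a" "tr (a - b) = tr a - tr b" "tr 0 = 0"
  by (auto simp: tr_def algebra_simps)

lemma tr_sum: "tr (\<Sum>i\<in>I. f i) = (\<Sum>i\<in>I. tr (f i))"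
  by (auto simp: tr_def sum_fun_apply sum_distrib_left)

lemma tr_unit: "tr e1 = of_nat (order G)"
  using nz[of \<one> \<one>] by (simp add: tr_def tone_def)

lemma cocycle_inv: "g \<in> carrier G \<Longrightarrow> \<alpha> (g, inv g) = \<alpha> (inv g, g)"
  using cocycle2_assoc[OF cocycle, of g "inv g" g] one_l[of g] one_r[of g] nz[of \<one> \<one>] by simp

lemma tr_commute: "tr (a \<star> b) = tr (b \<star> a)"
proof -
  have "(a \<star> b) \<one> = (\<Sum>g\<in>carrier G. \<alpha> (g, inv g) * a g * b (inv g))"
    by (subst tmul_apply) auto
  also have "\<dots> = (\<Sum>g\<in>carrier G. \<alpha> (g, inv g) * b g * a (inv g))"
    by (rule sum.reindex_bij_witness[where i = "m_inv G" and j = "m_inv G"]) (auto simp: cocycle_inv)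
  also have "\<dots> = (b \<star> a) \<one>"
    by (subst tmul_apply) auto
  finally show ?thesis by (simp add: tr_def)
qed

lemma order_nz: "of_nat (order G) \<noteq> (0::complex)"
  using fin order_gt_0_iff_finite by simp

text \<open>Pairing with the basis element of \<open>inv g\<close> returns \<open>a g\<close> up to
  a nonzero factor.\<close>

lemma tr_nondegenerate:
  assumes a: "a \<in> V" and "\<And>g. g \<in> carrier G \<Longrightarrow> tr (a \<star> delta g) = 0"
  shows "a = 0"
proof (rule fspace_eqI[OF a])
  fix g assume g: "g \<in> carrier G"
  have "tr (a \<star> delta (inv g)) = 0" using assms g by simp
  thus "a g = 0 g" using g nz[of g "inv g"] nz[of \<one> \<one>] order_nz by (simp add: tr_def mul_delta_apply)
qed (rule V_closed)

text \<open>The inverse of the basis element of \<open>g\<close>. The product of the basis elements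
  of \<open>g\<close> and \<open>inv g\<close> is \<alpha>(g, inv g) times the basis element of the
  identity, and the latter is \<alpha>(1,1) times the unit.\<close>

definition delta_inv where "delta_inv g = cscale (inverse (\<alpha> (g, inv g) * \<alpha> (\<one>, \<one>))) (delta (inv g))"

lemma delta_inv_mem: "g \<in> carrier G \<Longrightarrow> delta_inv g \<in> V"
  unfolding delta_inv_def by (intro V_closed delta_mem) simp

lemma delta_mul_inv: "g \<in> carrier G \<Longrightarrow> delta g \<star> delta_inv g = e1"
  using nz[of g "inv g"] unfolding delta_inv_def unit_eq by (simp add: bilin delta_mul)

lemma delta_inv_mul: "g \<in> carrier G \<Longrightarrow> delta_inv g \<star> delta g = e1"
  using nz[of g "inv g"] unfolding delta_inv_def unit_eq by (simp add: bilin delta_mul cocycle_inv[symmetric])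

text \<open>This is \<open>delta h \<star> delta g = cscale (\<alpha> (h, g)) (delta (h \<otimes>
  g))\<close> with both sides inverted.\<close>

lemma delta_inv_mult:
  assumes g: "g \<in> carrier G" and h: "h \<in> carrier G"
  shows "cscale (\<alpha> (h, g)) (delta_inv g \<star> delta_inv h) = delta_inv (h \<otimes> g)"
proof -
  have "delta_inv (h \<otimes> g) = delta_inv (h \<otimes> g) \<star> (delta h \<star> (delta g \<star> delta_inv g) \<star> delta_inv h)"
    using g h by (simp only: delta_mul_inv unit_r[OF delta_mem] unit_r[OF delta_inv_mem] m_closed)
  also have "\<dots> = (delta_inv (h \<otimes> g) \<star> (delta h \<star> delta g)) \<star> delta_inv g \<star> delta_inv h"
    by (simp only: assoc)
  also have "\<dots> = cscale (\<alpha> (h, g)) (e1 \<star> delta_inv g \<star> delta_inv h)"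
    using g h by (simp only: delta_mul bilin delta_inv_mul m_closed)
  also have "\<dots> = cscale (\<alpha> (h, g)) (delta_inv g \<star> delta_inv h)"
    using g by (simp only: unit_l delta_inv_mem)
  finally show ?thesis by simp
qed

definition Z where "Z = {z \<in> V. \<forall>x\<in>V. z \<star> x = x \<star> z}"

lemma Z_mem: "z \<in> Z \<Longrightarrow> z \<in> V" by (simp add: Z_def)

lemma Z_commute: "z \<in> Z \<Longrightarrow> x \<in> V \<Longrightarrow> z \<star> x = x \<star> z" by (simp add: Z_def)

lemma Z_closed:
  "a \<in> Z \<Longrightarrow> b \<in> Z \<Longrightarrow> a + b \<in> Z" "a \<in> Z \<Longrightarrow> b \<in> Z \<Longrightarrow> a - b \<in> Z" "a \<in> Z \<Longrightarrow> cscale c a \<in> Z" "0 \<in> Z"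
  "e1 \<in> Z"
  unfolding Z_def using V_closed unit_mem by (auto simp only: bilin unit_l unit_r mem_Collect_eq)

lemma Z_mul:
  assumes a: "a \<in> Z" and b: "b \<in> Z"
  shows "a \<star> b \<in> Z"
proof -
  have "(a \<star> b) \<star> x = x \<star> (a \<star> b)" if x: "x \<in> V" for x
  proof -
    have "(a \<star> b) \<star> x = (a \<star> x) \<star> b" by (simp only: assoc Z_commute[OF b x])
    thus ?thesis by (simp only: assoc Z_commute[OF a x])
  qed
  thus ?thesis unfolding Z_def by simp
qed

lemma Z_I:
  assumes z: "z \<in> V" and "\<And>g. g \<in> carrier G \<Longrightarrow> z \<star> delta g = delta g \<star> z"
  shows "z \<in> Z"
proof -
  have "z \<star> x = x \<star> z" if "x \<in> V" for x
  proof -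
    have "z \<star> (\<Sum>g\<in>carrier G. cscale (x g) (delta g)) = (\<Sum>g\<in>carrier G. cscale (x g) (delta g)) \<star> z"
      unfolding tmul_sum_left tmul_sum_right by (rule sum.cong) (simp_all only: bilin assms(2))
    thus ?thesis using V_expand[OF that] by simp
  qed
  thus ?thesis using z by (simp add: Z_def)
qed

text \<open>Up to the factor \<open>order G\<close>, the average over conjugation by basis elements,
  which projects the algebra onto its centre.\<close>

definition conj_sum where "conj_sum x = (\<Sum>g\<in>carrier G. delta g \<star> x \<star> delta_inv g)"

lemma conj_sum_mem: "conj_sum x \<in> V"
  unfolding conj_sum_def by (intro cfun.subspace_sum[OF subspace_fspace]) simp

lemma conj_sum_conj:
  assumes h: "h \<in> carrier G"
  shows "delta h \<star> conj_sum x \<star> delta_inv h = conj_sum x"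
proof -
  have "delta h \<star> conj_sum x \<star> delta_inv h = (\<Sum>g\<in>carrier G. delta (h \<otimes> g) \<star> x \<star> delta_inv (h \<otimes> g))"
    unfolding conj_sum_def tmul_sum_left tmul_sum_right
  proof (rule sum.cong)
    fix g assume g: "g \<in> carrier G"
    have "delta h \<star> (delta g \<star> x \<star> delta_inv g) \<star> delta_inv h = (delta h \<star> delta g) \<star> x \<star> (delta_inv g \<star> delta_inv h)"
      by (simp only: assoc)
    also have "\<dots> = delta (h \<otimes> g) \<star> x \<star> delta_inv (h \<otimes> g)"
      by (simp only: delta_mul[OF h g] bilin flip: delta_inv_mult[OF g h])
    finally show "delta h \<star> (delta g \<star> x \<star> delta_inv g) \<star> delta_inv h = delta (h \<otimes> g) \<star> x \<star> delta_inv (h \<otimes> g)" .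
  qed simp
  also have "\<dots> = conj_sum x" unfolding conj_sum_def
    by (rule sum.reindex_bij_witness[where i = "\<lambda>g. inv h \<otimes> g" and j = "\<lambda>g. h \<otimes> g"])
      (use h in \<open>auto simp: m_assoc[symmetric]\<close>)
  finally show ?thesis .
qed

lemma conj_sum_Z: "conj_sum x \<in> Z"
proof (rule Z_I[OF conj_sum_mem])
  fix h assume h: "h \<in> carrier G"
  have "conj_sum x \<star> delta h = delta h \<star> conj_sum x \<star> delta_inv h \<star> delta h" by (simp only: conj_sum_conj[OF h])
  also have "\<dots> = delta h \<star> conj_sum x"
    by (simp only: assoc delta_inv_mul[OF h] unit_r[OF tmul_mem] unit_r[OF conj_sum_mem])
  finally show "conj_sum x \<star> delta h = delta h \<star> conj_sum x" .
qed

lemma sum_const_fun: "(\<Sum>g\<in>carrier G. f) = cscale (of_nat (order G)) f" for f :: "'x \<Rightarrow> complex"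
  by (auto simp: fun_eq_iff sum_fun_apply order_def)

lemma conj_sum_central: "z \<in> Z \<Longrightarrow> conj_sum z = cscale (of_nat (order G)) z"
proof -
  assume z: "z \<in> Z"
  have "conj_sum z = (\<Sum>g\<in>carrier G. z)" unfolding conj_sum_def
    by (rule sum.cong)
      (simp_all only: Z_commute[OF z delta_mem, symmetric] assoc delta_mul_inv unit_r[OF Z_mem[OF z]])
  thus ?thesis by (simp only: sum_const_fun)
qed

text \<open>A central \<open>z\<close> can be moved through the conjugation and the trace is cyclic,
  so every summand contributes the trace of \<open>x \<star> z\<close>.\<close>

lemma tr_conj_sum:
  assumes z: "z \<in> Z"
  shows "tr (conj_sum x \<star> z) = of_nat (order G) * tr (x \<star> z)"
proof -
  have "tr (delta g \<star> x \<star> delta_inv g \<star> z) = tr (x \<star> z)" if g: "g \<in> carrier G" for g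
  proof -
    have "tr (delta g \<star> x \<star> delta_inv g \<star> z) = tr (delta g \<star> (x \<star> delta_inv g \<star> z))" by (simp only: assoc)
    also have "\<dots> = tr (x \<star> delta_inv g \<star> z \<star> delta g)" by (rule tr_commute)
    also have "\<dots> = tr (x \<star> z)"
      by (simp only: assoc Z_commute[OF z delta_mem[OF g]]) (simp only: assoc[symmetric] delta_inv_mul[OF g], simp only: assoc unit_l[OF Z_mem[OF z]])
    finally show ?thesis .
  qed
  thus ?thesis unfolding conj_sum_def tmul_sum_left tr_sum by (simp add: order_def)
qed

text \<open>If a central \<open>z\<close> has square zero, so has each
  \<open>z \<star> delta g\<close>. Left multiplication by it then has trace zero, and nondegeneracy
  of the trace form gives the claim.\<close>

lemma Z_reduced:
  assumes z: "z \<in> Z" and zz: "z \<star> z = 0"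
  shows "z = 0"
proof (rule tr_nondegenerate[OF Z_mem[OF z]])
  fix g assume g: "g \<in> carrier G"
  have "(z \<star> delta g) \<star> ((z \<star> delta g) \<star> a) = 0" for a
  proof -
    have "(z \<star> delta g) \<star> ((z \<star> delta g) \<star> a) = (z \<star> (delta g \<star> z)) \<star> delta g \<star> a" by (simp only: assoc)
    also have "\<dots> = (z \<star> z) \<star> delta g \<star> delta g \<star> a"
      by (simp only: Z_commute[OF z delta_mem[OF g], symmetric]) (simp only: assoc)
    finally show ?thesis by (simp only: zz bilin)
  qed
  hence "optrace (carrier G) (\<lambda>x. (z \<star> delta g) \<star> x) = 0"
    by (intro optrace_square_zero[OF fin clinear_tmul_left]) simp_all
  thus "tr (z \<star> delta g) = 0" by (simp only: optrace_eq)
qed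

definition block_dim where "block_dim e = cfun.dim ((\<lambda>x. e \<star> x) ` V)"

text \<open>Left multiplication by an idempotent projects onto the right ideal it generates, and the
  trace of a projection is its rank.\<close>

lemma tr_idem: "e \<star> e = e \<Longrightarrow> tr e = of_nat (block_dim e)"
  unfolding block_dim_def optrace_eq[symmetric]
  by (rule optrace_idempotent[OF fin clinear_tmul_left]) (simp_all flip: assoc)

lemma block_dim_pos:
  assumes e: "e \<in> V" and nz: "e \<noteq> 0"
  shows "block_dim e > 0"
proof (rule ccontr)
  assume "\<not> block_dim e > 0"
  hence d: "cfun.dim ((\<lambda>x. e \<star> x) ` V) = 0" by (simp add: block_dim_def)
  obtain B where B: "B \<subseteq> (\<lambda>x. e \<star> x) ` V" "cfun.independent B" "(\<lambda>x. e \<star> x) ` V \<subseteq> cfun.span B"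
    "card B = cfun.dim ((\<lambda>x. e \<star> x) ` V)"
    using cfun.basis_exists by metis
  have "finite B" by (rule finite_independent_fspace[OF fin B(2)]) (use B(1) in auto)
  hence "B = {}" using B(4) d by simp
  moreover have "e \<star> e1 \<in> (\<lambda>x. e \<star> x) ` V" using unit_mem by blast
  ultimately have "e \<star> e1 = 0" using B(3) cfun.span_empty by blast
  thus False using nz unit_r[OF e] by simp
qed

definition idem where "idem e \<longleftrightarrow> e \<in> Z \<and> e \<star> e = e"

text \<open>Primitivity says that the centre of the block is a line, rather than that
  \<open>e\<close> is minimal among central idempotents; the scalars by which central elements act
  are then available at once. \<open>idem_split\<close> provides the link with minimality.\<close>

definition prim where "prim e \<longleftrightarrow> idem e \<and> e \<noteq> 0 \<and> (\<forall>z\<in>Z. \<exists>c. e \<star> z = cscale c e)"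

lemma primD: "prim e \<Longrightarrow> e \<in> Z" "prim e \<Longrightarrow> e \<in> V" "prim e \<Longrightarrow> e \<star> e = e" "prim e \<Longrightarrow> e \<noteq> 0"
  "prim e \<Longrightarrow> z \<in> Z \<Longrightarrow> \<exists>c. e \<star> z = cscale c e"
  by (auto simp: prim_def idem_def Z_mem)

text \<open>If \<open>x = e z\<close> is annihilated by a product of factors \<open>x - r\<close>, a shortest such product
  yields an eigenvector \<open>y\<close> in the centre, and \<open>y\<close> is a multiple of an idempotent because the
  centre is reduced.\<close>

lemma idem_split:
  assumes e: "idem e" and ne: "e \<noteq> 0" and np: "\<not> prim e"
  shows "\<exists>f. idem f \<and> e \<star> f = f \<and> f \<noteq> 0 \<and> f \<noteq> e"
proof (rule ccontr)
  assume H: "\<nexists>f. idem f \<and> e \<star> f = f \<and> f \<noteq> 0 \<and> f \<noteq> e"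
  have eZ: "e \<in> Z" and ee: "e \<star> e = e" using e by (auto simp: idem_def)
  have "\<exists>c. e \<star> z = cscale c e" if z: "z \<in> Z" for z
  proof -
    define x where "x = e \<star> z"
    have x: "x \<in> Z" "x \<star> e = x" "e \<star> x = x"
      using eZ z ee Z_mul assoc Z_commute[OF eZ Z_mem[OF z]] by (auto simp: x_def) (metis assoc)
    define \<phi> where "\<phi> = (\<lambda>rs. foldr (\<lambda>r v. x \<star> v - cscale r v) rs e)"
    have \<phi>_Cons: "\<phi> (r # rs) = x \<star> \<phi> rs - cscale r (\<phi> rs)" for r rs by (simp add: \<phi>_def)
    have \<phi>Z: "\<phi> rs \<in> Z \<and> e \<star> \<phi> rs = \<phi> rs" for rs
    proof (induction rs)
      case Nil show ?case using eZ ee by (simp add: \<phi>_def)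
    next
      case (Cons r rs)
      have "e \<star> (x \<star> \<phi> rs) = x \<star> \<phi> rs" by (simp only: x(3) flip: assoc)
      thus ?case unfolding \<phi>_Cons using Cons x(1) by (auto intro: Z_closed Z_mul simp only: bilin)
    qed
    have "\<exists>rs. \<phi> rs = 0" unfolding \<phi>_def
      by (rule exists_annihilating_roots[OF fin clinear_tmul_left _ Z_mem[OF eZ]]) simp
    define n where "n = (LEAST n. \<exists>rs. length rs = n \<and> \<phi> rs = 0)"
    have "\<exists>rs. length rs = n \<and> \<phi> rs = 0" unfolding n_def
      by (rule LeastI_ex) (use \<open>\<exists>rs. \<phi> rs = 0\<close> in blast)
    then obtain rs where rs: "length rs = n" "\<phi> rs = 0" by blast
    have "rs \<noteq> []" using rs(2) ne by (auto simp: \<phi>_def)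
    then obtain r ss where ss: "rs = r # ss" by (cases rs) auto
    define y where "y = \<phi> ss"
    have "y \<noteq> 0"
    proof
      assume "y = 0"
      hence "n \<le> length ss" unfolding n_def y_def by (intro Least_le) blast
      thus False using rs(1) ss by simp
    qed
    have y: "y \<in> Z" "e \<star> y = y" using \<phi>Z by (auto simp: y_def)
    have xy: "x \<star> y = cscale r y" using rs(2) unfolding ss \<phi>_Cons y_def by (simp only: right_minus_eq)
    \<comment> \<open>Since \<open>y\<close> is an eigenvector of \<open>x\<close>, every product of
      factors acts on it as a scalar. For the list \<open>ss\<close> that product is
      \<open>y\<close> itself, so \<open>y \<star> y\<close> is a multiple of
      \<open>y\<close>.\<close>
    have "\<exists>k. \<phi> ts \<star> y = cscale k y" for ts
    proof (induction ts)
      case Nil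
      show ?case by (rule exI[of _ 1]) (simp add: \<phi>_def y(2) del: cscale_apply)
    next
      case (Cons s ts)
      then obtain k where k: "\<phi> ts \<star> y = cscale k y" by blast
      have "\<phi> (s # ts) \<star> y = x \<star> (\<phi> ts \<star> y) - cscale s (\<phi> ts \<star> y)"
        unfolding \<phi>_Cons by (simp only: bilin assoc)
      also have "\<dots> = cscale ((r - s) * k) y"
        unfolding k bilin xy by (auto simp: fun_eq_iff algebra_simps)
      finally show ?case by blast
    qed
    from this[of ss] obtain k where k: "y \<star> y = cscale k y" by (auto simp: y_def)
    have "k \<noteq> 0"
    proof
      assume "k = 0"
      hence "y \<star> y = 0" using k by (simp only: cscale_zero)
      thus False using Z_reduced[OF y(1)] \<open>y \<noteq> 0\<close> by blast
    qed
    define f where "f = cscale (inverse k) y"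
    have yf: "y = cscale k f" using \<open>k \<noteq> 0\<close> by (auto simp: f_def fun_eq_iff)
    have "f \<star> f = f" unfolding f_def bilin k using \<open>k \<noteq> 0\<close> by (auto simp: fun_eq_iff)
    moreover have "f \<in> Z" unfolding f_def by (rule Z_closed(3)[OF y(1)])
    moreover have "e \<star> f = f" unfolding f_def bilin y(2) ..
    moreover have "f \<noteq> 0" using yf \<open>y \<noteq> 0\<close> by (auto simp only: cfun.scale_zero_right)
    \<comment> \<open>The assumption leaves no proper central idempotent below \<open>e\<close>. As
      \<open>f\<close> is a multiple of an eigenvector of \<open>x\<close>, now \<open>e\<close> is
      an eigenvector, and \<open>x\<close>, being fixed by \<open>e\<close>, is a multiple of
      \<open>e\<close>.\<close>
    ultimately have "f = e" using H by (auto simp: idem_def)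
    hence "cscale k x = cscale k (cscale r e)"
      using xy x(2) unfolding yf bilin by (simp only: cfun.scale_left_commute)
    hence "x = cscale r e" using \<open>k \<noteq> 0\<close> cfun.scale_left_imp_eq by blast
    thus ?thesis unfolding x_def by blast
  qed
  hence "prim e" using e ne by (simp add: prim_def)
  thus False using np by simp
qed

text \<open>Induction on the dimension of the block: if \<open>e\<close> is not primitive it splits
  as \<open>f + (e - f)\<close>, and both parts have smaller positive dimension.\<close>

lemma idem_decomp: "idem e \<Longrightarrow> \<exists>S. finite S \<and> (\<forall>p\<in>S. prim p \<and> e \<star> p = p) \<and> e = (\<Sum>p\<in>S. p)"
proof (induction "block_dim e" arbitrary: e rule: less_induct)
  case less
  have eZ: "e \<in> Z" "e \<star> e = e" using less(2) by (auto simp: idem_def)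
  show ?case
  proof (cases "e = 0")
    case True
    show ?thesis unfolding True by (rule exI[of _ "{}"]) simp
  next
    case ne: False
    show ?thesis
    proof (cases "prim e")
      case True
      show ?thesis by (rule exI[of _ "{e}"]) (use True eZ in simp)
    next
      case False
      then obtain f where f: "idem f" "e \<star> f = f" "f \<noteq> 0" "f \<noteq> e" using idem_split[OF less(2) ne] by blast
      have fZ: "f \<in> Z" "f \<star> f = f" using f by (auto simp: idem_def)
      have fe: "f \<star> e = f" using f(2) Z_commute[OF eZ(1) Z_mem[OF fZ(1)]] by simp
      let ?g = "e - f"
      have gg: "?g \<star> ?g = ?g" unfolding bilin eZ(2) f(2) fe fZ(2) by simp
      have g: "idem ?g" unfolding idem_def using gg Z_closed(2)[OF eZ(1) fZ(1)] by simp
      have g0: "?g \<noteq> 0" using f(4) by auto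
      \<comment> \<open>Dimensions are additive here because they are traces of idempotents.\<close>
      have "of_nat (block_dim e) = (of_nat (block_dim f) + of_nat (block_dim ?g) :: complex)"
        by (simp only: tr_idem[OF eZ(2), symmetric] tr_idem[OF fZ(2), symmetric] tr_idem[OF gg, symmetric] tr_lin)
          simp
      hence "block_dim e = block_dim f + block_dim ?g" by (metis of_nat_add of_nat_eq_iff)
      moreover have "block_dim f > 0" "block_dim ?g > 0" using block_dim_pos f(3) g0 Z_mem fZ(1) g by (auto simp: idem_def)
      ultimately have "block_dim f < block_dim e" "block_dim ?g < block_dim e" by auto
      from less(1)[OF this(1) f(1)] less(1)[OF this(2) g] obtain S T where
        S: "finite S" "\<forall>p\<in>S. prim p \<and> f \<star> p = p" "f = (\<Sum>p\<in>S. p)" and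
        T: "finite T" "\<forall>p\<in>T. prim p \<and> ?g \<star> p = p" "?g = (\<Sum>p\<in>T. p)" by blast
      \<comment> \<open>A common element would be fixed by the orthogonal idempotents
        \<open>f\<close> and \<open>e - f\<close>, hence be zero.\<close>
      have "S \<inter> T = {}"
      proof (rule ccontr)
        assume "S \<inter> T \<noteq> {}"
        then obtain p where p: "p \<in> S" "p \<in> T" by blast
        have "p = ?g \<star> (f \<star> p)" using p S T by metis
        also have "\<dots> = 0" unfolding assoc[symmetric] bilin fZ(2) f(2) by (simp only: diff_self bilin)
        finally show False using p S primD(4) by blast
      qed
      moreover have "e = f + ?g" by simp
      ultimately have "e = (\<Sum>p\<in>S \<union> T. p)" using S T by (metis sum.union_disjoint)
      moreover have "e \<star> p = p" if "p \<in> S \<union> T" for p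
      proof -
        have "f \<star> p = p \<or> ?g \<star> p = p" using that S T by blast
        moreover have "e \<star> ?g = ?g" unfolding bilin eZ(2) f(2) ..
        ultimately show ?thesis using f(2) by (metis assoc)
      qed
      ultimately show ?thesis using S T by (intro exI[of _ "S \<union> T"]) auto
    qed
  qed
qed

text \<open>If \<open>p \<star> q\<close> is c times \<open>p\<close>, multiplying by
  \<open>p\<close> and \<open>q\<close> once more shows c = 1, so \<open>p = p \<star> q\<close>; by
  symmetry \<open>q\<close> equals the same product.\<close>

lemma prim_eqI:
  assumes p: "prim p" and q: "prim q" and pq: "p \<star> q \<noteq> 0"
  shows "p = q"
proof -
  have *: "a = a \<star> b" if a: "prim a" and b: "prim b" and ab: "a \<star> b \<noteq> 0" for a b
  proof -
    obtain c where c: "a \<star> b = cscale c a" using primD(5)[OF a primD(1)[OF b]] by blast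
    have "a \<star> b = a \<star> a \<star> (b \<star> b)" by (simp only: primD(3)[OF a] primD(3)[OF b])
    also have "\<dots> = a \<star> (a \<star> b) \<star> b" by (simp only: assoc)
    also have "\<dots> = cscale c (a \<star> b)" unfolding c bilin primD(3)[OF a] ..
    finally have "cscale c (a \<star> b) = cscale 1 (a \<star> b)" by (simp only: cfun.scale_one)
    hence "c = 1" using ab cfun.scale_right_imp_eq by blast
    thus ?thesis using c by (simp only: cfun.scale_one)
  qed
  have "q \<star> p = p \<star> q" by (rule Z_commute[OF primD(1)[OF q] primD(2)[OF p]])
  thus ?thesis using *[OF p q pq] *[OF q p] pq by metis
qed

text \<open>A primitive idempotent outside a decomposition of the unit would be orthogonal to all
  its summands, hence zero. So the decomposition consists of all primitive idempotents.\<close>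

lemma prims: "finite {p. prim p}" "(\<Sum>p | prim p. p) = e1"
proof -
  have "idem e1" unfolding idem_def using Z_closed(5) unit_l[OF unit_mem] by simp
  then obtain S where S: "finite S" "\<forall>p\<in>S. prim p \<and> e1 \<star> p = p" "e1 = (\<Sum>p\<in>S. p)"
    using idem_decomp by blast
  have "q \<in> S" if q: "prim q" for q
  proof (rule ccontr)
    assume n: "q \<notin> S"
    have "q = (\<Sum>p\<in>S. p) \<star> q" using unit_l[OF primD(2)[OF q]] S(3) by simp
    also have "\<dots> = (\<Sum>p\<in>S. p \<star> q)" by (rule tmul_sum_left)
    also have "\<dots> = (\<Sum>p\<in>S. 0)"
      by (rule sum.cong) (use S(2) n prim_eqI[OF _ q] in blast)+
    finally show False using primD(4)[OF q] by simp
  qed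
  hence eq: "S = {p. prim p}" using S(2) by blast
  show "finite {p. prim p}" using S(1) unfolding eq .
  show "(\<Sum>p | prim p. p) = e1" unfolding eq[symmetric] by (rule S(3)[symmetric])
qed

text \<open>The trace of the unit, computed in two ways.\<close>

lemma sum_block_dim: "(\<Sum>p | prim p. block_dim p) = order G"
proof -
  have "of_nat (\<Sum>p | prim p. block_dim p) = (\<Sum>p | prim p. tr p)"
    unfolding of_nat_sum by (rule sum.cong) (auto simp: tr_idem primD)
  also have "\<dots> = tr (\<Sum>p | prim p. p)" by (rule tr_sum[symmetric])
  also have "\<dots> = of_nat (order G)" by (simp only: prims(2) tr_unit)
  finally show ?thesis by (simp only: of_nat_eq_iff)
qed

end

section \<open>Dimensions of blocks divide the squared group order\<close>

text \<open>The matrix counting the \<open>p\<close> that send one index to another has integer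
  entries and \<open>w\<close> is an eigenvector of it, so \<open>lam\<close> is a root of its monic
  integral characteristic polynomial.\<close>

lemma algebraic_int_eigenvalue:
  fixes w :: "'j \<Rightarrow> complex" and \<sigma> :: "'p \<Rightarrow> 'j \<Rightarrow> 'j"
  assumes J: "finite J" and P: "finite P" and \<sigma>: "\<And>p j. p \<in> P \<Longrightarrow> j \<in> J \<Longrightarrow> \<sigma> p j \<in> J"
    and eig: "\<And>j. j \<in> J \<Longrightarrow> lam * w j = (\<Sum>p\<in>P. w (\<sigma> p j))" and nz: "\<exists>j\<in>J. w j \<noteq> 0"
  shows "algebraic_int lam"
proof -
  define N where "N = card J"
  obtain f where f: "bij_betw f {0..<N} J"
    using J unfolding N_def by (metis ex_bij_betw_nat_finite)
  define A :: "int mat" where "A = mat N N (\<lambda>(i, i'). int (card {p \<in> P. \<sigma> p (f i) = f i'}))"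
  define v where "v = vec N (\<lambda>i. w (f i))"
  have A: "A \<in> carrier_mat N N" by (simp add: A_def)
  have fJ: "f i \<in> J" if "i < N" for i using f that by (auto simp: bij_betw_def)
  have "map_mat of_int A *\<^sub>v v = lam \<cdot>\<^sub>v v"
  proof (rule eq_vecI)
    fix i assume "i < dim_vec (lam \<cdot>\<^sub>v v)"
    hence i: "i < N" by (simp add: v_def)
    have "(\<Sum>p\<in>P. w (\<sigma> p (f i))) = (\<Sum>j\<in>J. \<Sum>p\<in>{p\<in>P. \<sigma> p (f i) = j}. w (\<sigma> p (f i)))"
      by (rule sum.group[symmetric, OF P J]) (use \<sigma> fJ[OF i] in auto)
    also have "\<dots> = (\<Sum>j\<in>J. of_nat (card {p\<in>P. \<sigma> p (f i) = j}) * w j)"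
      by (rule sum.cong) auto
    also have "\<dots> = (\<Sum>i'\<in>{0..<N}. of_nat (card {p\<in>P. \<sigma> p (f i) = f i'}) * w (f i'))"
      by (rule sum.reindex_bij_betw[OF f, symmetric])
    finally show "vec_index (map_mat of_int A *\<^sub>v v) i = vec_index (lam \<cdot>\<^sub>v v) i"
      using i eig[OF fJ[OF i]] by (simp add: A_def v_def scalar_prod_def)
  qed (simp add: A_def v_def)
  moreover have "v \<noteq> 0\<^sub>v N"
  proof
    assume "v = 0\<^sub>v N"
    hence "w (f i) = 0" if "i < N" for i using that unfolding v_def by (metis index_vec index_zero_vec(1))
    thus False using nz f by (auto simp: bij_betw_def)
  qed
  ultimately have "eigenvalue (map_mat of_int A) lam"
    unfolding eigenvalue_def eigenvector_def by (intro exI[of _ v]) (simp add: A_def v_def)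
  hence "Polynomial.poly (char_poly (map_mat of_int A)) lam = 0"
    using eigenvalue_root_char_poly[of "map_mat of_int A :: complex mat" N] A by simp
  hence "Polynomial.poly (map_poly of_int (char_poly A)) lam = 0"
    by (simp add: of_int_hom.char_poly_hom[OF A])
  moreover have "Polynomial.lead_coeff (char_poly A) = 1"
    using degree_monic_char_poly[OF A] by simp
  ultimately show ?thesis using algebraic_int.intros[of "map_poly of_int (char_poly A)" lam]
    by (auto simp: algebraic_int_altdef_ipoly)
qed

context twisted_alg
begin

text \<open>\<open>conj_sum x\<close> is central, hence acts on the block of \<open>e\<close> as a
  scalar, and taking traces determines the scalar.\<close>

lemma prim_conj_sum:
  assumes e: "prim e"
  shows "e \<star> conj_sum x = cscale (of_nat (order G) * tr (x \<star> e) / of_nat (block_dim e)) e"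
proof -
  obtain c where c: "e \<star> conj_sum x = cscale c e" using primD(5)[OF e conj_sum_Z] by blast
  have "tr (e \<star> conj_sum x) = of_nat (order G) * tr (x \<star> e)"
    using tr_conj_sum[OF primD(1)[OF e]] by (simp only: tr_commute[of e])
  hence "c * of_nat (block_dim e) = of_nat (order G) * tr (x \<star> e)"
    unfolding c tr_lin tr_idem[OF primD(3)[OF e]] .
  moreover have "block_dim e > 0" using block_dim_pos primD(2,4)[OF e] by blast
  ultimately have "c = of_nat (order G) * tr (x \<star> e) / of_nat (block_dim e)" by (simp add: field_simps)
  thus ?thesis using c by simp
qed

text \<open>Up to the factor \<open>order G\<close>, the inverses \<open>delta_inv h\<close> form
  the basis dual to the \<open>delta h\<close> for the trace form.\<close>

lemma expand_dual:
  assumes a: "a \<in> V"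
  shows "(\<Sum>h\<in>carrier G. cscale (tr (delta h \<star> a)) (delta_inv h)) = cscale (of_nat (order G)) a"
proof (rule fspace_eqI[of _ "carrier G"])
  show "(\<Sum>h\<in>carrier G. cscale (tr (delta h \<star> a)) (delta_inv h)) \<in> V"
    by (intro cfun.subspace_sum[OF subspace_fspace] V_closed delta_inv_mem)
  show "cscale (of_nat (order G)) a \<in> V" by (rule V_closed(3)[OF a])
  fix x assume x: "x \<in> carrier G"
  have t: "tr (delta h \<star> a) = of_nat (order G) * \<alpha> (\<one>, \<one>) * (\<alpha> (inv h, h) * a (inv h))" if "h \<in> carrier G" for h
    unfolding tr_commute[of "delta h" a] using that by (simp add: tr_def mul_delta_apply)
  have "(\<Sum>h\<in>carrier G. cscale (tr (delta h \<star> a)) (delta_inv h)) x =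
    (\<Sum>h\<in>carrier G. if h = inv x then of_nat (order G) * a x else 0)"
    unfolding sum_fun_apply
  proof (rule sum.cong)
    fix h assume h: "h \<in> carrier G"
    have "x = inv h \<longleftrightarrow> h = inv x" using h x by auto
    thus "cscale (tr (delta h \<star> a)) (delta_inv h) x = (if h = inv x then of_nat (order G) * a x else 0)"
      unfolding cscale_apply t[OF h] delta_inv_def
      using x h nz[of "inv x" x] nz[of \<one> \<one>] cocycle_inv[OF x]
      by (auto simp: delta_def field_simps)
  qed simp
  also have "\<dots> = cscale (of_nat (order G)) a x" using x fin by simp
  finally show "(\<Sum>h\<in>carrier G. cscale (tr (delta h \<star> a)) (delta_inv h)) x = cscale (of_nat (order G)) a x" .
qed

text \<open>The element multiplied with \<open>e\<close> is the sum of all commutators \<open>u\<^sub>g u\<^sub>h u\<^sub>g\<inverse> u\<^sub>h\<inverse>\<close>.\<close>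

lemma prim_commutator_sum:
  assumes e: "prim e"
  shows "e \<star> (\<Sum>h\<in>carrier G. conj_sum (delta h) \<star> delta_inv h) = cscale (of_nat (order G) ^ 2 / of_nat (block_dim e)) e"
proof -
  let ?k = "of_nat (order G) :: complex" and ?d = "of_nat (block_dim e) :: complex"
  have "e \<star> (\<Sum>h\<in>carrier G. conj_sum (delta h) \<star> delta_inv h) = (\<Sum>h\<in>carrier G. e \<star> cscale (?k / ?d) (cscale (tr (delta h \<star> e)) (delta_inv h)))"
    unfolding tmul_sum_right
  proof (rule sum.cong)
    fix h
    have "e \<star> (conj_sum (delta h) \<star> delta_inv h) = (e \<star> conj_sum (delta h)) \<star> delta_inv h" by (simp only: assoc)
    thus "e \<star> (conj_sum (delta h) \<star> delta_inv h) = e \<star> cscale (?k / ?d) (cscale (tr (delta h \<star> e)) (delta_inv h))"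
      by (simp only: prim_conj_sum[OF e] bilin cfun.scale_scale times_divide_eq_left)
  qed simp
  also have "\<dots> = cscale (?k / ?d) (e \<star> (\<Sum>h\<in>carrier G. cscale (tr (delta h \<star> e)) (delta_inv h)))"
    by (simp only: tmul_sum_right cfun.scale_sum_right tmul_scale_right)
  also have "\<dots> = cscale (?k ^ 2 / ?d) e"
    unfolding expand_dual[OF primD(2)[OF e]] bilin primD(3)[OF e] cfun.scale_scale
    by (simp only: power2_eq_square times_divide_eq_left)
  finally show ?thesis .
qed

text \<open>When the cocycle takes values in roots of unity, the commutators permute the finite set of
  vectors \<open>\<zeta> u\<^sub>s\<close>, so the scalar above is an eigenvalue of an integer matrix.\<close>

lemma block_dim_dvd:
  assumes n: "n > 0" and roots: "\<And>g h. g \<in> carrier G \<Longrightarrow> h \<in> carrier G \<Longrightarrow> \<alpha> (g, h) ^ n = 1"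
    and e: "prim e"
  shows "block_dim e dvd order G ^ 2"
proof -
  let ?k = "of_nat (order G) :: complex" and ?d = "of_nat (block_dim e) :: complex"
  \<comment> \<open>Multiples of basis elements by \<open>n\<close>-th roots of unity: a finite set,
    closed under products and containing the inverses of the basis elements, so the commutators
    \<open>c p\<close> act on it.\<close>
  define M where "M = {cscale z (delta s) | z s. z ^ n = 1 \<and> s \<in> carrier G}"
  have M1: "delta g \<in> M" if "g \<in> carrier G" for g
    unfolding M_def using that by (intro CollectI exI[of _ 1] exI[of _ g]) simp
  have M2: "delta_inv g \<in> M" if "g \<in> carrier G" for g
    unfolding M_def delta_inv_def using that roots[of g "inv g"] roots[of \<one> \<one>]
    by (intro CollectI exI[of _ "inverse (\<alpha> (g, inv g) * \<alpha> (\<one>, \<one>))"] exI[of _ "inv g"] conjI refl)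
      (simp_all add: power_inverse power_mult_distrib)
  have M3: "a \<star> b \<in> M" if ab: "a \<in> M" "b \<in> M" for a b
  proof -
    obtain y z s t where yz: "a = cscale y (delta s)" "b = cscale z (delta t)" "y ^ n = 1" "z ^ n = 1"
      "s \<in> carrier G" "t \<in> carrier G" using ab unfolding M_def by blast
    have "a \<star> b = cscale (z * (y * \<alpha> (s, t))) (delta (s \<otimes> t))"
      unfolding yz(1,2) bilin delta_mul[OF yz(5,6)] cfun.scale_scale ..
    moreover have "(z * (y * \<alpha> (s, t))) ^ n = 1" using yz roots[of s t] by (simp add: power_mult_distrib)
    moreover have "s \<otimes> t \<in> carrier G" using yz by simp
    ultimately show ?thesis unfolding M_def by blast
  qed
  \<comment> \<open>Keeping the root of unity in the index set leaves no coefficients: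
    multiplication by a commutator sends indices to indices, and the resulting matrix is
    integral.\<close>
  let ?P = "carrier G \<times> carrier G" and ?J = "{z. z ^ n = (1::complex)} \<times> carrier G"
  define c where "c p = delta (fst p) \<star> delta (snd p) \<star> delta_inv (fst p) \<star> delta_inv (snd p)" for p
  have "\<exists>z s'. z ^ n = 1 \<and> s' \<in> carrier G \<and> c p \<star> delta s = cscale z (delta s')" if "p \<in> ?P" "s \<in> carrier G" for p s
  proof -
    have "c p \<star> delta s \<in> M" unfolding c_def using that by (intro M3 M1 M2) auto
    thus ?thesis unfolding M_def by blast
  qed
  then obtain \<zeta> \<tau> where zt: "\<And>p s. p \<in> ?P \<Longrightarrow> s \<in> carrier G \<Longrightarrow>
    \<zeta> p s ^ n = 1 \<and> \<tau> p s \<in> carrier G \<and> c p \<star> delta s = cscale (\<zeta> p s) (delta (\<tau> p s))"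
    by metis
  define \<sigma> where "\<sigma> p j = (fst j * \<zeta> p (snd j), \<tau> p (snd j))" for p j
  \<comment> \<open>The index (z, s) stands for \<open>z\<close> times the basis element of
    \<open>s\<close>, and \<open>w\<close> is the trace of that vector multiplied by
    \<open>e\<close>.\<close>
  define w where "w j = fst j * tr (e \<star> delta (snd j))" for j
  have csum: "(\<Sum>h\<in>carrier G. conj_sum (delta h) \<star> delta_inv h) = (\<Sum>p\<in>?P. c p)"
  proof -
    have "(\<Sum>p\<in>?P. c p) = (\<Sum>g\<in>carrier G. \<Sum>h\<in>carrier G. c (g, h))"
      by (simp only: sum.cartesian_product case_prod_eta)
    also have "\<dots> = (\<Sum>h\<in>carrier G. \<Sum>g\<in>carrier G. c (g, h))" by (rule sum.swap)
    finally show ?thesis unfolding conj_sum_def tmul_sum_left c_def fst_conv snd_conv by (rule sym)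
  qed
  have "algebraic_int (?k ^ 2 / ?d)"
  proof (rule algebraic_int_eigenvalue[of ?J ?P \<sigma> _ w])
    show "finite ?J" using finite_nth_roots[of n 1] n fin by simp
    show "finite ?P" using fin by simp
    show "\<sigma> p j \<in> ?J" if "p \<in> ?P" "j \<in> ?J" for p j
      using zt[OF that(1), of "snd j"] that(2) by (auto simp: \<sigma>_def power_mult_distrib)
    show "?k ^ 2 / ?d * w j = (\<Sum>p\<in>?P. w (\<sigma> p j))" if jJ: "j \<in> ?J" for j
    proof -
      obtain z s where j: "j = (z, s)" and s: "s \<in> carrier G" using jJ by auto
      have "?k ^ 2 / ?d * tr (e \<star> delta s) = tr (cscale (?k ^ 2 / ?d) e \<star> delta s)"
        by (simp only: bilin tr_lin)
      also have "\<dots> = tr (e \<star> (\<Sum>p\<in>?P. c p) \<star> delta s)"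
        by (simp only: prim_commutator_sum[OF e, unfolded csum])
      also have "\<dots> = (\<Sum>p\<in>?P. tr (e \<star> (c p \<star> delta s)))"
        by (simp only: tmul_sum_right tmul_sum_left tr_sum assoc)
      also have "\<dots> = (\<Sum>p\<in>?P. \<zeta> p s * tr (e \<star> delta (\<tau> p s)))"
        by (rule sum.cong) (use zt[OF _ s] in \<open>simp_all only: bilin tr_lin\<close>)
      finally have *: "?k ^ 2 / ?d * tr (e \<star> delta s) = (\<Sum>p\<in>?P. \<zeta> p s * tr (e \<star> delta (\<tau> p s)))" .
      have "?k ^ 2 / ?d * w j = z * (?k ^ 2 / ?d * tr (e \<star> delta s))" by (simp add: j w_def)
      also have "\<dots> = (\<Sum>p\<in>?P. w (\<sigma> p j))" unfolding * by (simp add: j w_def \<sigma>_def sum_distrib_left mult_ac)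
      finally show ?thesis .
    qed
    show "\<exists>j\<in>?J. w j \<noteq> 0"
    proof (rule ccontr)
      assume "\<not> (\<exists>j\<in>?J. w j \<noteq> 0)"
      hence z: "w j = 0" if "j \<in> ?J" for j using that by blast
      have "tr (e \<star> delta s) = 0" if "s \<in> carrier G" for s
        using z[of "(1, s)"] that by (simp add: w_def)
      thus False using tr_nondegenerate[OF primD(2)[OF e]] primD(4)[OF e] by blast
    qed
  qed
  moreover have "?k ^ 2 / ?d \<in> \<rat>" by simp
  ultimately have "?k ^ 2 / ?d \<in> \<int>" by (rule rational_algebraic_int_is_int)
  then obtain i where i: "?k ^ 2 / ?d = of_int i" by (rule Ints_cases)
  have "block_dim e > 0" using block_dim_pos primD(2,4)[OF e] by blast
  hence "?k ^ 2 = of_int i * ?d" using i by (simp add: field_simps)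
  hence "of_int (int (order G ^ 2)) = (of_int (i * int (block_dim e)) :: complex)" by simp
  hence "int (order G ^ 2) = i * int (block_dim e)" by (simp only: of_int_eq_iff)
  hence "int (block_dim e) dvd int (order G ^ 2)" by simp
  thus ?thesis by (simp only: of_nat_dvd_iff)
qed

end

text \<open>The power of \<alpha> with exponent \<open>order G\<close> is the coboundary of
  \<open>l\<close>. Dividing \<alpha> by the coboundary of an \<open>order G\<close>-th root
  \<open>r\<close> of \<open>l\<close> stays in the class and makes that power trivial.\<close>

lemma root_of_unity_cocycle:
  assumes G: "group G" "finite (carrier G)" and a: "\<alpha> \<in> carrier (cocycles2 G)"
  obtains \<beta> where "\<beta> \<in> carrier (cocycles2 G)" "cohomology_class G \<beta> = cohomology_class G \<alpha>"
    "\<And>g h. g \<in> carrier G \<Longrightarrow> h \<in> carrier G \<Longrightarrow> \<beta> (g, h) ^ order G = 1"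
proof -
  interpret group G by fact
  let ?n = "order G"
  have n: "?n > 0" using G(2) order_gt_0_iff_finite by simp
  define l where "l g = (\<Prod>x\<in>carrier G. \<alpha> (g, x))" for g
  have lnz: "l g \<noteq> 0" if "g \<in> carrier G" for g
    using that G(2) cocycle2_nz[OF a] by (simp add: l_def)
  have "\<exists>z. z ^ ?n = l g" if "g \<in> carrier G" for g
  proof -
    have "card {z. z ^ ?n = l g} \<noteq> 0" using card_nth_roots[OF lnz[OF that] n] n by simp
    thus ?thesis by (metis (mono_tags, lifting) Collect_empty_eq card.empty)
  qed
  then obtain r where r: "\<And>g. g \<in> carrier G \<Longrightarrow> r g ^ ?n = l g" by metis
  have rnz: "r g \<noteq> 0" if "g \<in> carrier G" for g
    using r[OF that] lnz[OF that] n by (metis power_0_left less_numeral_extra(3))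
  define \<beta> where "\<beta> = restrict (\<lambda>(g, h). \<alpha> (g, h) * r (g \<otimes>\<^bsub>G\<^esub> h) / (r g * r h)) (carrier G \<times> carrier G)"
  have ap: "\<beta> (g, h) = \<alpha> (g, h) * r (g \<otimes>\<^bsub>G\<^esub> h) / (r g * r h)" if "g \<in> carrier G" "h \<in> carrier G" for g h
    using that by (simp add: \<beta>_def)
  have b: "\<beta> \<in> carrier (cocycles2 G)" unfolding \<beta>_def
  proof (rule restrict_mem_cocycles2[OF _ _ G(1)])
    fix g h k assume ghk: "g \<in> carrier G" "h \<in> carrier G" "k \<in> carrier G"
    show "(case (g, h) of (g, h) \<Rightarrow> \<alpha> (g, h) * r (g \<otimes>\<^bsub>G\<^esub> h) / (r g * r h)) *
        (case (g \<otimes>\<^bsub>G\<^esub> h, k) of (g, h) \<Rightarrow> \<alpha> (g, h) * r (g \<otimes>\<^bsub>G\<^esub> h) / (r g * r h)) =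
      (case (g, h \<otimes>\<^bsub>G\<^esub> k) of (g, h) \<Rightarrow> \<alpha> (g, h) * r (g \<otimes>\<^bsub>G\<^esub> h) / (r g * r h)) *
        (case (h, k) of (g, h) \<Rightarrow> \<alpha> (g, h) * r (g \<otimes>\<^bsub>G\<^esub> h) / (r g * r h))"
      using ghk cocycle2_assoc[OF a ghk] rnz[OF ghk(1)] rnz[OF ghk(2)] rnz[OF ghk(3)] rnz[of "g \<otimes>\<^bsub>G\<^esub> h"] rnz[of "h \<otimes>\<^bsub>G\<^esub> k"]
      by (simp add: m_assoc field_simps)
  qed (use cocycle2_nz[OF a] rnz in auto)
  show thesis
  proof (rule that[OF b])
    show "cohomology_class G \<beta> = cohomology_class G \<alpha>"
      unfolding cohomology_class_eq_iff[OF G(1) a b]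
      by (rule bexI[of _ "\<lambda>g. inverse (r g)"]) (use rnz in \<open>auto simp: ap field_simps\<close>)
    fix g h assume gh: "g \<in> carrier G" "h \<in> carrier G"
    have "\<beta> (g, h) ^ ?n = \<alpha> (g, h) ^ ?n * l (g \<otimes>\<^bsub>G\<^esub> h) / (l g * l h)"
      using gh by (simp add: ap power_divide power_mult_distrib r)
    also have "\<dots> = 1"
      using cocycle2_power_order[OF G a gh] lnz[OF gh(1)] lnz[OF gh(2)] by (simp add: l_def)
    finally show "\<beta> (g, h) ^ ?n = 1" .
  qed
qed

section \<open>Blocks of a tensor product\<close>

text \<open>Condition \<open>difun\<close> makes \<open>R\<close> relate the classes of an equivalence relation on \<open>Xs\<close> with those of one
  on \<open>Ys\<close>; the bijection \<open>\<Phi>\<close> gives corresponding classes the same size up to the factor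
  \<open>card U / card W\<close>, and the weights force this factor to be \<open>1\<close>.\<close>

lemma bij_of_uniform_fibres:
  fixes d :: "'x \<Rightarrow> nat" and d' :: "'y \<Rightarrow> nat"
  assumes fin: "finite Xs" "finite Ys" "finite U" "finite W" and U: "U \<noteq> {}"
    and \<Phi>: "bij_betw \<Phi> (Xs \<times> U) (Ys \<times> W)"
    and R: "\<And>x u. x \<in> Xs \<Longrightarrow> u \<in> U \<Longrightarrow> R x (fst (\<Phi> (x, u)))"
    and difun: "\<And>x x' y y'. R x y \<Longrightarrow> R x' y \<Longrightarrow> R x' y' \<Longrightarrow> R x y'"
    and d: "\<And>x u. x \<in> Xs \<Longrightarrow> u \<in> U \<Longrightarrow> d' (fst (\<Phi> (x, u))) = d x"
    and sum: "sum d Xs = k" "sum d' Ys = k" "k > 0"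
  shows "\<exists>\<sigma>. bij_betw \<sigma> Xs Ys \<and> (\<forall>x\<in>Xs. R x (\<sigma> x))"
proof -
  \<comment> \<open>Classes on both sides are labelled by subsets of \<open>Ys\<close>:
    \<open>s y\<close> is the class of \<open>y\<close>, and \<open>t x\<close> is the class
    corresponding to that of \<open>x\<close>.\<close>
  define t where "t x = {y \<in> Ys. R x y}" for x
  define s where "s y = {y' \<in> Ys. \<exists>x\<in>Xs. R x y \<and> R x y'}" for y
  have st: "s y = t x" if "x \<in> Xs" "R x y" for x y
    unfolding s_def t_def using that difun by blast
  have \<Phi>m: "fst (\<Phi> (x, u)) \<in> Ys" "snd (\<Phi> (x, u)) \<in> W" if "x \<in> Xs" "u \<in> U" for x u
  proof -
    have "\<Phi> (x, u) \<in> Ys \<times> W" using \<Phi> that by (auto simp: bij_betw_def)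
    thus "fst (\<Phi> (x, u)) \<in> Ys" "snd (\<Phi> (x, u)) \<in> W" by (auto simp: mem_Times_iff)
  qed
  have fst_sum: "(\<Sum>p\<in>A \<times> B. f (fst p)) = card B * sum f A" for A and B :: "'q set" and f :: "'p \<Rightarrow> nat"
    using sum.cartesian_product[of "\<lambda>x y. f x" B A] by (simp add: case_prod_beta sum_distrib_left)
  \<comment> \<open>Comparing the total weights of the two products through \<Phi> gives
    \<open>card U = card W\<close>.\<close>
  have "card U * k = (\<Sum>p\<in>Xs \<times> U. d (fst p))"
    using sum(1) by (simp only: fst_sum)
  also have "\<dots> = (\<Sum>p\<in>Xs \<times> U. d' (fst (\<Phi> p)))"
    by (rule sum.cong) (use d in auto)
  also have "\<dots> = (\<Sum>q\<in>Ys \<times> W. d' (fst q))"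
    by (rule sum.reindex_bij_betw[OF \<Phi>])
  also have "\<dots> = card W * k"
    using sum(2) by (simp only: fst_sum)
  finally have UW: "card U = card W" using sum(3) by simp
  have U0: "card U > 0" using U fin by (simp add: card_gt_0_iff)
  hence W: "W \<noteq> {}" using UW by auto
  have ex: "\<exists>x\<in>Xs. R x y" if "y \<in> Ys" for y
  proof -
    obtain w where "w \<in> W" using W by blast
    hence "(y, w) \<in> \<Phi> ` (Xs \<times> U)" using \<Phi> that by (auto simp: bij_betw_def)
    then obtain x u where "x \<in> Xs" "u \<in> U" "\<Phi> (x, u) = (y, w)" by auto
    thus ?thesis using R[of x u] by auto
  qed
  \<comment> \<open>\<Phi> maps the product of a class with \<open>U\<close> onto the product of the
    corresponding class with \<open>W\<close>.\<close>
  have fib: "card {x \<in> Xs. t x = \<tau>} = card {y \<in> Ys. s y = \<tau>}" for \<tau>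
  proof -
    have eq: "\<Phi> ` ({x \<in> Xs. t x = \<tau>} \<times> U) = {y \<in> Ys. s y = \<tau>} \<times> W" (is "?L = ?R")
    proof
      show "?L \<subseteq> ?R"
      proof
        fix q assume "q \<in> ?L"
        then obtain x u where xu: "x \<in> Xs" "t x = \<tau>" "u \<in> U" "q = \<Phi> (x, u)" by auto
        thus "q \<in> ?R" using st[OF xu(1) R[OF xu(1,3)]] \<Phi>m[OF xu(1,3)] by (simp add: mem_Times_iff)
      qed
      show "?R \<subseteq> ?L"
      proof
        fix q assume q: "q \<in> ?R"
        hence "q \<in> \<Phi> ` (Xs \<times> U)" using \<Phi> by (auto simp: bij_betw_def)
        then obtain x u where xu: "x \<in> Xs" "u \<in> U" "q = \<Phi> (x, u)" by auto
        hence "t x = \<tau>" using st[OF xu(1) R[OF xu(1,2)]] q by (auto simp: mem_Times_iff)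
        thus "q \<in> ?L" using xu by blast
      qed
    qed
    have "inj_on \<Phi> ({x \<in> Xs. t x = \<tau>} \<times> U)"
      using \<Phi> by (auto simp: bij_betw_def intro: inj_on_subset)
    from card_image[OF this] have "card {x \<in> Xs. t x = \<tau>} * card U = card {y \<in> Ys. s y = \<tau>} * card W"
      unfolding eq by (simp add: card_cartesian_product)
    thus ?thesis using U0 UW by simp
  qed
  have "\<exists>b. bij_betw b {x \<in> Xs. t x = \<tau>} {y \<in> Ys. s y = \<tau>}" for \<tau>
    by (rule finite_same_card_bij) (use fin fib in auto)
  then obtain b where b: "\<And>\<tau>. bij_betw (b \<tau>) {x \<in> Xs. t x = \<tau>} {y \<in> Ys. s y = \<tau>}" by metis
  define \<sigma> where "\<sigma> x = b (t x) x" for x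
  have \<sigma>: "\<sigma> x \<in> Ys" "s (\<sigma> x) = t x" if "x \<in> Xs" for x
    using b[of "t x"] that by (auto simp: \<sigma>_def bij_betw_def)
  have "bij_betw \<sigma> Xs Ys"
    unfolding bij_betw_def
  proof
    show "inj_on \<sigma> Xs"
    proof (rule inj_onI)
      fix x x' assume xx: "x \<in> Xs" "x' \<in> Xs" "\<sigma> x = \<sigma> x'"
      hence "t x = t x'" using \<sigma>(2) by metis
      thus "x = x'" using xx b[of "t x"] by (auto simp: \<sigma>_def bij_betw_def dest: inj_onD)
    qed
    show "\<sigma> ` Xs = Ys"
    proof
      show "\<sigma> ` Xs \<subseteq> Ys" using \<sigma>(1) by blast
      show "Ys \<subseteq> \<sigma> ` Xs"
      proof
        fix y assume "y \<in> Ys"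
        hence "y \<in> b (s y) ` {x \<in> Xs. t x = s y}" using b[of "s y"] by (auto simp: bij_betw_def)
        then obtain x where "x \<in> Xs" "t x = s y" "y = b (s y) x" by blast
        hence "\<sigma> x = y" "x \<in> Xs" by (simp_all add: \<sigma>_def)
        thus "y \<in> \<sigma> ` Xs" by blast
      qed
    qed
  qed
  moreover have "R x (\<sigma> x)" if x: "x \<in> Xs" for x
  proof -
    have "\<sigma> x \<in> s (\<sigma> x)" using ex[OF \<sigma>(1)[OF x]] \<sigma>(1)[OF x] by (auto simp: s_def)
    thus ?thesis unfolding \<sigma>(2)[OF x] by (simp add: t_def)
  qed
  ultimately show ?thesis by blast
qed

section \<open>Elementary tensors and central idempotents of a tensor product\<close>

definition tens :: "('a \<Rightarrow> complex) \<Rightarrow> ('b \<Rightarrow> complex) \<Rightarrow> 'a \<times> 'b \<Rightarrow> complex"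
  where "tens a b = (\<lambda>(x, y). a x * b y)"

lemma tens_apply: "tens a b (x, y) = a x * b y" by (simp add: tens_def)

lemma tens_mem: "a \<in> fspace C \<Longrightarrow> b \<in> fspace D \<Longrightarrow> tens a b \<in> fspace (C \<times> D)"
  by (auto simp: tens_def fspace_def)

lemma tens_scale_left: "tens (cscale c a) b = cscale c (tens a b)"
  and tens_scale_right: "tens a (cscale c b) = cscale c (tens a b)"
  and tens_add_left: "tens (a + a') b = tens a b + tens a' b"
  by (auto simp: tens_def fun_eq_iff algebra_simps)

lemma tens_sum_left: "tens (\<Sum>i\<in>I. f i) b = (\<Sum>i\<in>I. tens (f i) b)"
  by (auto simp: tens_def fun_eq_iff sum_fun_apply sum_distrib_right)

lemma tens_sum_right: "tens a (\<Sum>i\<in>I. f i) = (\<Sum>i\<in>I. tens a (f i))"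
  by (auto simp: tens_def fun_eq_iff sum_fun_apply sum_distrib_left)

lemma tens_zero: "tens 0 b = 0" "tens a 0 = 0"
  by (auto simp: tens_def fun_eq_iff)

lemma tens_nonzero: "a \<noteq> 0 \<Longrightarrow> b \<noteq> 0 \<Longrightarrow> tens a b \<noteq> 0"
  by (auto simp: tens_def fun_eq_iff)

lemma tens_cancel:
  assumes "b \<noteq> 0" "tens a b = tens a' b"
  shows "a = a'"
proof
  fix x
  obtain y where y: "b y \<noteq> 0" using assms(1) by (auto simp: fun_eq_iff)
  have "a x * b y = a' x * b y" using assms(2) by (metis tens_apply)
  thus "a x = a' x" using y by simp
qed

lemma delta_tens: "delta (g, h) = tens (delta g) (delta h)"
  by (auto simp: delta_def tens_def fun_eq_iff)

locale twisted_pair = A: twisted_alg G \<alpha> + B: twisted_alg K \<beta>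
  for G :: "('a, 'm) monoid_scheme" and \<alpha> and K :: "('b, 'n) monoid_scheme" and \<beta>
begin

abbreviation P where "P \<equiv> G \<times>\<times> K"
abbreviation \<gamma> where "\<gamma> \<equiv> prod_cocycle G K \<alpha> \<beta>"

sublocale R: twisted_alg P \<gamma>
proof -
  interpret P: group P by (rule DirProd_group) unfold_locales
  show "twisted_alg P \<gamma>"
    by unfold_locales (use A.fin B.fin in \<open>auto intro!: prod_cocycle_cocycle A.cocycle B.cocycle A.group_axioms B.group_axioms\<close>)
qed

lemma tens_mul: "tmul P \<gamma> (tens a b) (tens a' b') = tens (tmul G \<alpha> a a') (tmul K \<beta> b b')"
proof (rule fspace_eqI[of _ "carrier G \<times> carrier K"])
  show "tmul P \<gamma> (tens a b) (tens a' b') \<in> fspace (carrier G \<times> carrier K)"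
    using tmul_mem[of P] by simp
  show "tens (tmul G \<alpha> a a') (tmul K \<beta> b b') \<in> fspace (carrier G \<times> carrier K)"
    by (intro tens_mem tmul_mem)
  fix p assume "p \<in> carrier G \<times> carrier K"
  then obtain x y where p: "p = (x, y)" "x \<in> carrier G" "y \<in> carrier K" by auto
  have "tmul P \<gamma> (tens a b) (tens a' b') p = (\<Sum>(g, h)\<in>carrier G \<times> carrier K.
      \<gamma> ((g, h), inv\<^bsub>P\<^esub> (g, h) \<otimes>\<^bsub>P\<^esub> (x, y)) * tens a b (g, h) * tens a' b' (inv\<^bsub>P\<^esub> (g, h) \<otimes>\<^bsub>P\<^esub> (x, y)))"
    using p by (simp add: tmul_def case_prod_beta)
  also have "\<dots> = (\<Sum>(g, h)\<in>carrier G \<times> carrier K.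
      (\<alpha> (g, inv\<^bsub>G\<^esub> g \<otimes>\<^bsub>G\<^esub> x) * a g * a' (inv\<^bsub>G\<^esub> g \<otimes>\<^bsub>G\<^esub> x)) * (\<beta> (h, inv\<^bsub>K\<^esub> h \<otimes>\<^bsub>K\<^esub> y) * b h * b' (inv\<^bsub>K\<^esub> h \<otimes>\<^bsub>K\<^esub> y)))"
    by (rule sum.cong) (use p in \<open>auto simp: prod_cocycle_apply inv_DirProd[OF A.group_axioms B.group_axioms] tens_apply\<close>)
  also have "\<dots> = tens (tmul G \<alpha> a a') (tmul K \<beta> b b') p"
    using p by (simp add: tens_apply A.tmul_apply B.tmul_apply sum_product sum.cartesian_product)
  finally show "tmul P \<gamma> (tens a b) (tens a' b') p = tens (tmul G \<alpha> a a') (tmul K \<beta> b b') p" .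
qed

lemma tens_V: "a \<in> A.V \<Longrightarrow> b \<in> B.V \<Longrightarrow> tens a b \<in> R.V"
  using tens_mem[of a "carrier G" b "carrier K"] by simp

lemma R_expand: "r \<in> R.V \<Longrightarrow> r = (\<Sum>p\<in>carrier P. cscale (r p) (tens (delta (fst p)) (delta (snd p))))"
  using R.V_expand[of r] by (simp only: delta_tens[symmetric] prod.collapse)

lemma R_tr: "R.tr (tens a b) = A.tr a * B.tr b"
  by (simp add: R.tr_def A.tr_def B.tr_def prod_cocycle_apply tens_apply order_def card_cartesian_product)

lemma R_delta_inv: "g \<in> carrier G \<Longrightarrow> h \<in> carrier K \<Longrightarrow> R.delta_inv (g, h) = tens (A.delta_inv g) (B.delta_inv h)"
  by (simp add: R.delta_inv_def A.delta_inv_def B.delta_inv_def prod_cocycle_apply inv_DirProd[OF A.group_axioms B.group_axioms] tens_scale_left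
      tens_scale_right delta_tens mult_ac del: cscale_apply)

lemma R_conj_sum: "R.conj_sum (tens a b) = tens (A.conj_sum a) (B.conj_sum b)"
proof -
  have "R.conj_sum (tens a b) = (\<Sum>(g, h)\<in>carrier G \<times> carrier K.
      tens (tmul G \<alpha> (tmul G \<alpha> (delta g) a) (A.delta_inv g)) (tmul K \<beta> (tmul K \<beta> (delta h) b) (B.delta_inv h)))"
    unfolding R.conj_sum_def carrier_DirProd
    by (rule sum.cong) (auto simp only: R_delta_inv delta_tens tens_mul case_prod_conv mem_Times_iff fst_conv snd_conv)
  thus ?thesis
    unfolding A.conj_sum_def tens_sum_left unfolding B.conj_sum_def tens_sum_right by (simp only: sum.cartesian_product)
qed

lemma tens_Z:
  assumes a: "a \<in> A.Z" and b: "b \<in> B.Z"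
  shows "tens a b \<in> R.Z"
proof (rule R.Z_I)
  show "tens a b \<in> R.V" by (intro tens_V A.Z_mem B.Z_mem a b)
  fix p assume "p \<in> carrier P"
  then obtain g h where p: "p = (g, h)" "g \<in> carrier G" "h \<in> carrier K" by auto
  show "tmul P \<gamma> (tens a b) (delta p) = tmul P \<gamma> (delta p) (tens a b)"
    unfolding p(1) delta_tens tens_mul
    by (simp only: A.Z_commute[OF a delta_mem[OF p(2)]] B.Z_commute[OF b delta_mem[OF p(3)]])
qed

text \<open>Up to the factor \<open>order P\<close>, a central \<open>z\<close> is its own
  conjugation sum. On elementary tensors this sum factors by \<open>R_conj_sum\<close>, and each
  tensor factor acts as a scalar on \<open>e\<close> or \<open>f\<close>. No explicit description of
  the centre of the tensor product enters.\<close>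

lemma tens_prim:
  assumes e: "A.prim e" and f: "B.prim f"
  shows "R.prim (tens e f)"
  unfolding R.prim_def R.idem_def
proof (intro conjI ballI)
  show "tens e f \<in> R.Z" by (rule tens_Z[OF A.primD(1)[OF e] B.primD(1)[OF f]])
  show "tmul P \<gamma> (tens e f) (tens e f) = tens e f" by (simp only: tens_mul A.primD(3)[OF e] B.primD(3)[OF f])
  show "tens e f \<noteq> 0" by (rule tens_nonzero[OF A.primD(4)[OF e] B.primD(4)[OF f]])
  fix z assume z: "z \<in> R.Z"
  have "\<exists>c. tmul P \<gamma> (tens e f) (R.conj_sum (tens a b)) = cscale c (tens e f)" for a b
    unfolding R_conj_sum tens_mul A.prim_conj_sum[OF e] B.prim_conj_sum[OF f] tens_scale_left tens_scale_right cfun.scale_scale by blast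
  then obtain c where c: "\<And>a b. tmul P \<gamma> (tens e f) (R.conj_sum (tens a b)) = cscale (c a b) (tens e f)" by metis
  have conj_sum: "R.conj_sum (\<Sum>p\<in>S. cscale (y p) (f p)) = (\<Sum>p\<in>S. cscale (y p) (R.conj_sum (f p)))" for S y f
    unfolding R.conj_sum_def tmul_sum_left tmul_sum_right R.bilin cfun.scale_sum_right by (rule sum.swap)
  have "R.conj_sum z = (\<Sum>p\<in>carrier P. cscale (z p) (R.conj_sum (tens (delta (fst p)) (delta (snd p)))))"
    by (subst R_expand[OF R.Z_mem[OF z]]) (rule conj_sum)
  hence "tmul P \<gamma> (tens e f) (R.conj_sum z) =
    (\<Sum>p\<in>carrier P. cscale (z p) (cscale (c (delta (fst p)) (delta (snd p))) (tens e f)))"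
    by (simp only: tmul_sum_right tmul_scale_right c)
  also have "\<dots> = cscale (\<Sum>p\<in>carrier P. z p * c (delta (fst p)) (delta (snd p))) (tens e f)"
    by (simp only: cfun.scale_scale cfun.scale_sum_left)
  finally have "cscale (of_nat (order P)) (tmul P \<gamma> (tens e f) z) =
      cscale (\<Sum>p\<in>carrier P. z p * c (delta (fst p)) (delta (snd p))) (tens e f)"
    by (simp only: R.conj_sum_central[OF z] tmul_scale_right)
  hence "cscale (inverse (of_nat (order P))) (cscale (of_nat (order P)) (tmul P \<gamma> (tens e f) z)) =
     cscale (inverse (of_nat (order P))) (cscale (\<Sum>p\<in>carrier P. z p * c (delta (fst p)) (delta (snd p))) (tens e f))"
    by (simp only:)
  hence "tmul P \<gamma> (tens e f) z = cscale (inverse (of_nat (order P)) * (\<Sum>p\<in>carrier P. z p * c (delta (fst p)) (delta (snd p)))) (tens e f)"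
    using R.order_nz by (simp only: cfun.scale_scale left_inverse cfun.scale_one simp_thms)
  thus "\<exists>c. tmul P \<gamma> (tens e f) z = cscale c (tens e f)" by blast
qed

lemma tens_unit: "tens A.e1 B.e1 = R.e1"
  by (auto simp: tens_def tone_def prod_cocycle_apply fun_eq_iff)

text \<open>The unit is the sum of all \<open>tens e f\<close>, so \<open>E\<close> cannot be
  orthogonal to every one of them.\<close>

lemma prim_tens_ex:
  assumes E: "R.prim E"
  shows "\<exists>e f. A.prim e \<and> B.prim f \<and> E = tens e f"
proof (rule ccontr)
  assume H: "\<not> ?thesis"
  have z: "tmul P \<gamma> E (tens e f) = 0" if "A.prim e" "B.prim f" for e f
    using H R.prim_eqI[OF E tens_prim[OF that]] that by blast
  have "E = tmul P \<gamma> E (tens A.e1 B.e1)" using R.unit_r[OF R.primD(2)[OF E]] by (simp only: tens_unit)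
  also have "\<dots> = (\<Sum>f | B.prim f. \<Sum>e | A.prim e. tmul P \<gamma> E (tens e f))"
    by (simp only: A.prims(2)[symmetric] B.prims(2)[symmetric] tens_sum_left tens_sum_right tmul_sum_right)
  also have "\<dots> = 0" by (intro sum.neutral ballI z) auto
  finally show False using R.primD(4)[OF E] by blast
qed

text \<open>\<open>tens e f\<close> is idempotent and nonzero, so neither \<open>e\<close> and
  \<open>e'\<close> nor \<open>f\<close> and \<open>f'\<close> can be orthogonal.\<close>

lemma tens_prim_inj:
  assumes "A.prim e" "B.prim f" "A.prim e'" "B.prim f'" "tens e f = tens e' f'"
  shows "e = e'" "f = f'"
proof -
  have "tens (tmul G \<alpha> e e') (tmul K \<beta> f f') = tens e f"
    using R.primD(3)[OF tens_prim[OF assms(1,2)]] assms(5) by (metis tens_mul)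
  hence "tmul G \<alpha> e e' \<noteq> 0" "tmul K \<beta> f f' \<noteq> 0"
    using R.primD(4)[OF tens_prim[OF assms(1,2)]] tens_zero by metis+
  thus "e = e'" "f = f'" using A.prim_eqI B.prim_eqI assms by blast+
qed

text \<open>Dimensions of blocks are traces, and the trace is multiplicative on elementary
  tensors.\<close>

lemma block_dim_tens:
  assumes e: "A.prim e" and f: "B.prim f"
  shows "R.block_dim (tens e f) = A.block_dim e * B.block_dim f"
proof -
  have "of_nat (R.block_dim (tens e f)) = (of_nat (A.block_dim e * B.block_dim f) :: complex)"
    using R.tr_idem[OF R.primD(3)[OF tens_prim[OF e f]]] A.tr_idem[OF A.primD(3)[OF e]] B.tr_idem[OF B.primD(3)[OF f]]
    by (simp add: R_tr)
  thus ?thesis by (simp only: of_nat_eq_iff)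
qed

end

section \<open>Blocks as ideals and their behaviour under algebra isomorphisms\<close>

context twisted_alg
begin

definition block where "block e = (\<lambda>x. e \<star> x) ` V"

lemma block_V: "x \<in> block e \<Longrightarrow> x \<in> V"
  by (auto simp: block_def)

lemma block_fix: "e \<star> e = e \<Longrightarrow> x \<in> block e \<Longrightarrow> e \<star> x = x"
  by (auto simp: block_def simp flip: assoc)

lemma block_iff: "e \<star> e = e \<Longrightarrow> x \<in> block e \<longleftrightarrow> x \<in> V \<and> e \<star> x = x"
  by (metis block_V block_fix block_def imageI)

lemma mul_in_block: "x \<in> V \<Longrightarrow> e \<star> x \<in> block e"
  by (auto simp: block_def)

lemma subspace_block: "cfun.subspace (block e)"
  unfolding block_def by (rule subspace_image_clinear[OF clinear_tmul_left subspace_fspace])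

lemma block_mul: "e \<star> e = e \<Longrightarrow> x \<in> block e \<Longrightarrow> x \<star> y \<in> block e"
  by (simp add: block_iff flip: assoc)

lemma block_dim_eq: "block_dim e = cfun.dim (block e)"
  by (simp add: block_dim_def block_def)

lemma prim_orth: "prim p \<Longrightarrow> prim q \<Longrightarrow> p \<noteq> q \<Longrightarrow> p \<star> q = 0"
  using prim_eqI by blast

text \<open>A one-dimensional block is the line through its idempotent.\<close>

lemma block_dim_one:
  assumes f: "prim f" and d: "block_dim f = 1" and x: "x \<in> V"
  shows "\<exists>c. f \<star> x = cscale c f"
proof -
  obtain b where b: "block f = cfun.span {b}"
    using dim_one_span[OF subspace_block] d by (metis block_dim_eq)
  have "f \<in> block f" using mul_in_block[OF primD(2)[OF f]] primD(3)[OF f] by metis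
  then obtain k where k: "f = cscale k b" unfolding b cfun.span_singleton by blast
  have "k \<noteq> 0" using k primD(4)[OF f] cscale_zero by metis
  have "f \<star> x \<in> block f" by (rule mul_in_block[OF x])
  then obtain c where c: "f \<star> x = cscale c b" unfolding b cfun.span_singleton by blast
  have "cscale (c / k) (cscale k b) = cscale c b" using \<open>k \<noteq> 0\<close> by (auto simp: fun_eq_iff)
  hence "f \<star> x = cscale (c / k) f" using c k by metis
  thus ?thesis by blast
qed

end

text \<open>Linearity of \<open>F\<close> is known on \<open>fspace C\<close> only. Composed with
  extension by zero it becomes a linear map of the whole function space, to which the theory of
  linear maps applies.\<close>

lemma dim_algebra_iso_image:
  assumes F: "algebra_iso_map F (fspace C) mul (fspace D) mul'" and S: "cfun.subspace S" "S \<subseteq> fspace C"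
  shows "cfun.dim (F ` S) = cfun.dim S"
proof -
  define g where "g = F \<circ> zext C"
  note D = algebra_iso_mapD[OF F]
  have za: "zext C (a + b) = zext C a + zext C b" "zext C (cscale c a) = cscale c (zext C a)" for a b c
    by (auto simp: zext_def fun_eq_iff)
  have "clinear g"
    by unfold_locales (simp_all only: g_def comp_apply za D(3,4) zext_mem)
  then interpret g: Vector_Spaces.linear cscale cscale g .
  have gF: "g a = F a" if "a \<in> fspace C" for a using that by (simp add: g_def zext_fspace)
  have inj: "inj_on g (fspace C)" using D(1) gF by (auto simp: bij_betw_def inj_on_def)
  obtain B where B: "B \<subseteq> S" "cfun.independent B" "S \<subseteq> cfun.span B" "card B = cfun.dim S"
    using cfun.basis_exists by metis
  have span: "cfun.span B = S" using B(3) cfun.span_minimal[OF B(1) S(1)] by blast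
  have "cfun.independent (g ` B)"
    by (rule g.independent_injective_image[OF B(2)]) (use inj S(2) span in \<open>auto intro: inj_on_subset\<close>)
  moreover have "cfun.span (g ` B) = g ` S" by (simp only: g.span_image span)
  ultimately have "cfun.dim (g ` S) = card (g ` B)" using cfun.dim_span_eq_card_independent by metis
  also have "\<dots> = card B" by (rule card_image) (use inj S(2) B(1) in \<open>auto intro: inj_on_subset\<close>)
  also have "g ` S = F ` S" by (rule image_cong) (use gF S(2) in auto)
  finally show ?thesis using B(4) by (rule trans)
qed

locale twisted_iso = X: twisted_alg G \<alpha> + Y: twisted_alg H \<beta>
  for G :: "('a, 'm) monoid_scheme" and \<alpha> and H :: "('b, 'n) monoid_scheme" and \<beta> +
  fixes F
  assumes F: "algebra_iso_map F (talg G) (tmul G \<alpha>) (talg H) (tmul H \<beta>)"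
begin

lemmas FD = algebra_iso_mapD[OF F]

lemma F_zero: "F 0 = 0"
  using FD(4)[OF X.V_closed(4), of 0] by (simp only: cscale_zero)

lemma F_inj: "a \<in> X.V \<Longrightarrow> b \<in> X.V \<Longrightarrow> F a = F b \<Longrightarrow> a = b"
  using FD(1) by (auto simp: bij_betw_def dest: inj_onD)

lemma F_surj: "b \<in> Y.V \<Longrightarrow> \<exists>a\<in>X.V. b = F a"
  using FD(1) by (auto simp: bij_betw_def)

lemma F_Z:
  assumes z: "z \<in> X.Z"
  shows "F z \<in> Y.Z"
proof -
  have zV: "z \<in> X.V" by (rule X.Z_mem[OF z])
  have "tmul H \<beta> (F z) y = tmul H \<beta> y (F z)" if yV: "y \<in> Y.V" for y
  proof -
    obtain x where x: "x \<in> X.V" "y = F x" using F_surj[OF yV] by blast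
    show ?thesis unfolding x(2) FD(5)[OF zV x(1), symmetric] FD(5)[OF x(1) zV, symmetric] X.Z_commute[OF z x(1)] ..
  qed
  thus ?thesis using FD(2)[OF zV] by (simp add: Y.Z_def)
qed

lemma twisted_iso_inv: "twisted_iso H \<beta> G \<alpha> (inv_into (talg G) F)"
  by unfold_locales (rule algebra_iso_map_inv[OF F], auto simp: subspace_fspace)

lemma inv_F: "a \<in> X.V \<Longrightarrow> inv_into (talg G) F (F a) = a"
  using FD(1) by (auto simp: bij_betw_def)

lemma F_inv: "b \<in> Y.V \<Longrightarrow> inv_into (talg G) F b \<in> X.V" "b \<in> Y.V \<Longrightarrow> F (inv_into (talg G) F b) = b"
  using FD(1) by (auto simp: bij_betw_def inv_into_into f_inv_into_f)

lemma Z_ex: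
  assumes z: "z \<in> Y.Z"
  shows "\<exists>x\<in>X.Z. z = F x"
  using twisted_iso.F_Z[OF twisted_iso_inv z] F_inv(2)[OF Y.Z_mem[OF z]] by metis

lemma F_prim:
  assumes e: "X.prim e"
  shows "Y.prim (F e)"
  unfolding Y.prim_def Y.idem_def
proof (intro conjI ballI)
  note eV = X.primD(2)[OF e]
  show "F e \<in> Y.Z" by (rule F_Z[OF X.primD(1)[OF e]])
  show "tmul H \<beta> (F e) (F e) = F e" by (simp only: FD(5)[OF eV eV, symmetric] X.primD(3)[OF e])
  show "F e \<noteq> 0" using F_inj[OF eV X.V_closed(4)] F_zero X.primD(4)[OF e] by metis
  fix z assume "z \<in> Y.Z"
  then obtain x where x: "x \<in> X.Z" "z = F x" using Z_ex by blast
  obtain c where "tmul G \<alpha> e x = cscale c e" using X.primD(5)[OF e x(1)] by blast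
  hence "tmul H \<beta> (F e) z = cscale c (F e)"
    unfolding x(2) by (simp only: FD(5)[OF eV X.Z_mem[OF x(1)], symmetric] FD(4)[OF eV])
  thus "\<exists>c. tmul H \<beta> (F e) z = cscale c (F e)" by blast
qed

lemma F_prim_bij: "bij_betw F {e. X.prim e} {e. Y.prim e}"
proof (rule bij_betw_byWitness[of _ "inv_into (talg G) F"])
  show "\<forall>a\<in>{e. X.prim e}. inv_into (talg G) F (F a) = a" using inv_F X.primD(2) by blast
  show "\<forall>b\<in>{e. Y.prim e}. F (inv_into (talg G) F b) = b" using F_inv Y.primD(2) by blast
  show "F ` {e. X.prim e} \<subseteq> {e. Y.prim e}" using F_prim by blast
  show "inv_into (talg G) F ` {e. Y.prim e} \<subseteq> {e. X.prim e}"
    using twisted_iso.F_prim[OF twisted_iso_inv] by blast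
qed

lemma F_block:
  assumes e: "e \<in> X.V"
  shows "F ` X.block e = Y.block (F e)"
proof -
  have "F ` X.V = Y.V" using FD(1) by (simp add: bij_betw_def)
  hence "Y.block (F e) = (\<lambda>x. tmul H \<beta> (F e) (F x)) ` X.V"
    unfolding Y.block_def by (metis image_image)
  also have "\<dots> = F ` X.block e"
    unfolding X.block_def image_image by (rule image_cong) (simp_all only: FD(5)[OF e])
  finally show ?thesis ..
qed

lemma F_block_dim: "e \<in> X.V \<Longrightarrow> Y.block_dim (F e) = X.block_dim e"
  unfolding X.block_dim_eq Y.block_dim_eq F_block[symmetric]
  by (rule dim_algebra_iso_image[OF F X.subspace_block]) (use X.block_V in blast)

lemma F_block_iso:
  assumes e: "e \<in> X.V"
  shows "algebra_isomorphic (X.block e) (tmul G \<alpha>) (Y.block (F e)) (tmul H \<beta>)"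
  unfolding algebra_isomorphic_def algebra_iso_map_def
proof (intro exI[of _ F] conjI ballI allI)
  show "bij_betw F (X.block e) (Y.block (F e))"
    using FD(1) F_block[OF e] X.block_V by (auto simp: bij_betw_def intro: inj_on_subset)
qed (use FD(3-5) X.block_V in blast)+

end

context twisted_pair
begin

text \<open>Tensoring with \<open>f\<close> is the isomorphism. It is onto because \<open>f\<close>
  times each basis element of the second algebra is a multiple of \<open>f\<close>, so the second
  tensor factor collapses to scalars.\<close>

lemma tens_block_iso:
  assumes e: "A.prim e" and f: "B.prim f" and d: "B.block_dim f = 1"
  shows "algebra_isomorphic (A.block e) (tmul G \<alpha>) (R.block (tens e f)) (tmul P \<gamma>)"
  unfolding algebra_isomorphic_def
proof (rule exI[of _ "\<lambda>x. tens x f"])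
  note ee = A.primD(3)[OF e] and ff = B.primD(3)[OF f]
  have im: "tens x f \<in> R.block (tens e f)" if "x \<in> A.block e" for x
  proof -
    have "tmul P \<gamma> (tens e f) (tens x f) = tens x f"
      by (simp only: tens_mul ff A.block_fix[OF ee that])
    thus ?thesis using R.mul_in_block[OF tens_V[OF A.block_V[OF that] B.primD(2)[OF f]]] by metis
  qed
  have surj: "\<exists>x\<in>A.block e. y = tens x f" if y: "y \<in> R.block (tens e f)" for y
  proof -
    obtain r where r: "r \<in> R.V" "y = tmul P \<gamma> (tens e f) r" using y by (auto simp: R.block_def)
    have "\<exists>c. tmul K \<beta> f (delta h) = cscale c f" if "h \<in> carrier K" for h
      by (rule B.block_dim_one[OF f d delta_mem[OF that]])
    then obtain c where c: "\<And>h. h \<in> carrier K \<Longrightarrow> tmul K \<beta> f (delta h) = cscale (c h) f" by metis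
    have "y = (\<Sum>p\<in>carrier P. cscale (r p) (tens (tmul G \<alpha> e (delta (fst p))) (tmul K \<beta> f (delta (snd p)))))"
      unfolding r(2) by (subst R_expand[OF r(1)]) (simp only: tmul_sum_right tmul_scale_right tens_mul)
    also have "\<dots> = (\<Sum>p\<in>carrier P. tens (tmul G \<alpha> e (cscale (r p * c (snd p)) (delta (fst p)))) f)"
    proof (rule sum.cong)
      fix p assume "p \<in> carrier P"
      hence "snd p \<in> carrier K" by auto
      thus "cscale (r p) (tens (tmul G \<alpha> e (delta (fst p))) (tmul K \<beta> f (delta (snd p)))) =
        tens (tmul G \<alpha> e (cscale (r p * c (snd p)) (delta (fst p)))) f"
        by (simp only: c tens_scale_right tens_scale_left tmul_scale_right cfun.scale_scale)
    qed simp
    also have "\<dots> = tens (tmul G \<alpha> e (\<Sum>p\<in>carrier P. cscale (r p * c (snd p)) (delta (fst p)))) f"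
      by (simp only: tens_sum_left tmul_sum_right)
    finally have "y = tens (tmul G \<alpha> e (\<Sum>p\<in>carrier P. cscale (r p * c (snd p)) (delta (fst p)))) f" .
    moreover have "(\<Sum>p\<in>carrier P. cscale (r p * c (snd p)) (delta (fst p))) \<in> A.V"
      by (intro cfun.subspace_sum[OF subspace_fspace] A.V_closed delta_mem) auto
    ultimately show ?thesis using A.mul_in_block by blast
  qed
  show "algebra_iso_map (\<lambda>x. tens x f) (A.block e) (tmul G \<alpha>) (R.block (tens e f)) (tmul P \<gamma>)"
    unfolding algebra_iso_map_def
  proof (intro conjI ballI allI)
    show "bij_betw (\<lambda>x. tens x f) (A.block e) (R.block (tens e f))"
      unfolding bij_betw_def
    proof
      show "inj_on (\<lambda>x. tens x f) (A.block e)"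
        by (rule inj_onI) (rule tens_cancel[OF B.primD(4)[OF f]])
      show "(\<lambda>x. tens x f) ` A.block e = R.block (tens e f)" using im surj by blast
    qed
  qed (simp_all only: tens_add_left tens_scale_left tens_mul ff)
qed

text \<open>The dimension of \<open>f\<close> divides a power of \<open>order K\<close>, so it is
  prime to \<open>order K\<close> only if it is 1; the dimension of \<open>e\<close> divides a power
  of \<open>order G\<close> and is prime to \<open>order K\<close> in any case.\<close>

lemma coprime_block_dim:
  assumes e: "A.prim e" and f: "B.prim f" and cop: "coprime (order G) (order K)"
    and dA: "A.block_dim e dvd order G ^ 2" and dB: "B.block_dim f dvd order K ^ 2"
  shows "coprime (R.block_dim (tens e f)) (order K) \<longleftrightarrow> B.block_dim f = 1"
proof
  assume "coprime (R.block_dim (tens e f)) (order K)"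
  hence "coprime (B.block_dim f) (order K)" unfolding block_dim_tens[OF e f] by simp
  hence "coprime (B.block_dim f) (order K ^ 2)" by simp
  thus "B.block_dim f = 1" using dB by (metis coprime_absorb_left nat_dvd_1_iff_1)
next
  assume "B.block_dim f = 1"
  moreover have "coprime (A.block_dim e) (order K)"
    by (rule coprime_divisors[OF dA dvd_refl]) (use cop in simp)
  ultimately show "coprime (R.block_dim (tens e f)) (order K)" unfolding block_dim_tens[OF e f] by simp
qed

end

text \<open>The algebra is the direct sum of its blocks, so block isomorphisms glue: \<Theta>
  applies the one for \<open>e\<close> to the component \<open>e \<star> x\<close> and adds the
  results.\<close>

lemma (in twisted_alg) isomorphic_of_blocks:
  fixes H :: "('c, 'd) monoid_scheme"
  assumes Y: "twisted_alg H \<beta>"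
    and \<sigma>: "bij_betw \<sigma> {e. prim e} {e. twisted_alg.prim H \<beta> e}"
    and iso: "\<And>e. prim e \<Longrightarrow> algebra_isomorphic (block e) (tmul G \<alpha>) (twisted_alg.block H \<beta> (\<sigma> e)) (tmul H \<beta>)"
  shows "algebra_isomorphic V (tmul G \<alpha>) (talg H) (tmul H \<beta>)"
proof -
  interpret Y: twisted_alg H \<beta> by fact
  let ?I = "{e. prim e}"
  have \<sigma>p: "Y.prim (\<sigma> e)" if "prim e" for e using \<sigma> that by (auto simp: bij_betw_def)
  have \<sigma>i: "\<sigma> e = \<sigma> e' \<longleftrightarrow> e = e'" if "prim e" "prim e'" for e e'
    using \<sigma> that by (auto simp: bij_betw_def dest: inj_onD)
  obtain \<theta> where \<theta>: "\<And>e. prim e \<Longrightarrow> algebra_iso_map (\<theta> e) (block e) (tmul G \<alpha>) (Y.block (\<sigma> e)) (tmul H \<beta>)"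
    using iso unfolding algebra_isomorphic_def by metis
  note \<theta>D = algebra_iso_mapD[OF \<theta>]
  define \<eta> where "\<eta> e = inv_into (block e) (\<theta> e)" for e
  have \<eta>\<theta>: "\<eta> e (\<theta> e x) = x" if "prim e" "x \<in> block e" for e x
    using \<theta>D(1)[OF that(1)] that(2) by (auto simp: \<eta>_def bij_betw_def)
  have \<theta>\<eta>: "\<theta> e (\<eta> e y) = y" "\<eta> e y \<in> block e" if "prim e" "y \<in> Y.block (\<sigma> e)" for e y
    using \<theta>D(1)[OF that(1)] that(2) by (auto simp: \<eta>_def bij_betw_def f_inv_into_f inv_into_into)
  define \<Theta> where "\<Theta> x = (\<Sum>e | prim e. \<theta> e (e \<star> x))" for x
  define \<Xi> where "\<Xi> y = (\<Sum>e | prim e. \<eta> e (tmul H \<beta> (\<sigma> e) y))" for y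
  have \<theta>m: "\<theta> e (e \<star> x) \<in> Y.block (\<sigma> e)" if "prim e" "x \<in> V" for e x
    by (rule \<theta>D(2)[OF that(1) mul_in_block[OF that(2)]])
  have \<eta>m: "\<eta> e (tmul H \<beta> (\<sigma> e) y) \<in> block e" if "prim e" "y \<in> Y.V" for e y
    by (rule \<theta>\<eta>(2)[OF that(1) Y.mul_in_block[OF that(2)]])
  have orthY: "tmul H \<beta> (\<sigma> e) y = (if e = e' then y else 0)" if "prim e" "prim e'" "y \<in> Y.block (\<sigma> e')" for e e' y
  proof (cases "e = e'")
    case True
    thus ?thesis using Y.block_fix[OF Y.primD(3)[OF \<sigma>p[OF that(1)]]] that(3) by simp
  next
    case False
    have "tmul H \<beta> (\<sigma> e) y = tmul H \<beta> (tmul H \<beta> (\<sigma> e) (\<sigma> e')) y"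
      by (simp only: Y.assoc Y.block_fix[OF Y.primD(3)[OF \<sigma>p[OF that(2)]] that(3)])
    also have "\<dots> = 0" using Y.prim_orth[OF \<sigma>p[OF that(1)] \<sigma>p[OF that(2)]] \<sigma>i[OF that(1,2)] False
      by (simp only: simp_thms Y.bilin)
    finally show ?thesis using False by simp
  qed
  have orthX: "e \<star> y = (if e = e' then y else 0)" if "prim e" "prim e'" "y \<in> block e'" for e e' y
  proof (cases "e = e'")
    case True
    thus ?thesis using block_fix[OF primD(3)[OF that(1)]] that(3) by simp
  next
    case False
    have "e \<star> y = (e \<star> e') \<star> y"
      by (simp only: assoc block_fix[OF primD(3)[OF that(2)] that(3)])
    also have "\<dots> = 0" using prim_orth[OF that(1,2) False] by (simp only: bilin)
    finally show ?thesis using False by simp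
  qed
  have \<Theta>V: "\<Theta> x \<in> Y.V" if "x \<in> V" for x
    unfolding \<Theta>_def by (intro cfun.subspace_sum[OF subspace_fspace] Y.block_V[OF \<theta>m] that) simp_all
  have \<Xi>V: "\<Xi> y \<in> V" if "y \<in> Y.V" for y
    unfolding \<Xi>_def by (intro cfun.subspace_sum[OF subspace_fspace] block_V[OF \<eta>m] that) simp_all
  \<comment> \<open>Different blocks annihilate each other, so multiplication by
    \<open>\<sigma> e\<close> isolates one summand.\<close>
  have proj\<Theta>: "tmul H \<beta> (\<sigma> e) (\<Theta> x) = \<theta> e (e \<star> x)" if e: "prim e" and x: "x \<in> V" for e x
  proof -
    have "tmul H \<beta> (\<sigma> e) (\<Theta> x) = (\<Sum>e' | prim e'. if e = e' then \<theta> e' (e' \<star> x) else 0)"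
      unfolding \<Theta>_def tmul_sum_right
      by (rule sum.cong) (use orthY[OF e _ \<theta>m[OF _ x]] in auto)
    thus ?thesis using prims(1) e by simp
  qed
  have proj\<Xi>: "e \<star> \<Xi> y = \<eta> e (tmul H \<beta> (\<sigma> e) y)" if e: "prim e" and y: "y \<in> Y.V" for e y
  proof -
    have "e \<star> \<Xi> y = (\<Sum>e' | prim e'. if e = e' then \<eta> e' (tmul H \<beta> (\<sigma> e') y) else 0)"
      unfolding \<Xi>_def tmul_sum_right
      by (rule sum.cong) (use orthX[OF e _ \<eta>m[OF _ y]] in auto)
    thus ?thesis using prims(1) e by simp
  qed
  have "\<Xi> (\<Theta> x) = x" if x: "x \<in> V" for x
  proof -
    have "\<Xi> (\<Theta> x) = (\<Sum>e | prim e. e \<star> x)" unfolding \<Xi>_def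
      by (rule sum.cong) (use proj\<Theta>[OF _ x] \<eta>\<theta> mul_in_block[OF x] in auto)
    also have "\<dots> = x" by (simp only: tmul_sum_left[symmetric] prims(2) unit_l[OF x])
    finally show ?thesis .
  qed
  moreover have "\<Theta> (\<Xi> y) = y" if y: "y \<in> Y.V" for y
  proof -
    have "\<Theta> (\<Xi> y) = (\<Sum>e | prim e. tmul H \<beta> (\<sigma> e) y)" unfolding \<Theta>_def
      by (rule sum.cong) (use proj\<Xi>[OF _ y] \<theta>\<eta> Y.mul_in_block[OF y] in auto)
    also have "\<dots> = (\<Sum>e' | Y.prim e'. tmul H \<beta> e' y)"
      using sum.reindex_bij_betw[OF \<sigma>, of "\<lambda>e'. tmul H \<beta> e' y"] .
    also have "\<dots> = y" by (simp only: tmul_sum_left[symmetric] Y.prims(2) Y.unit_l[OF y])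
    finally show ?thesis .
  qed
  ultimately have "bij_betw \<Theta> V Y.V"
    by (intro bij_betw_byWitness[of _ \<Xi>]) (use \<Theta>V \<Xi>V in auto)
  moreover have "\<Theta> (x + y) = \<Theta> x + \<Theta> y" if "x \<in> V" "y \<in> V" for x y
    unfolding \<Theta>_def sum.distrib[symmetric]
    by (rule sum.cong) (simp_all only: mem_Collect_eq bilin \<theta>D(3) mul_in_block that)
  moreover have "\<Theta> (cscale c x) = cscale c (\<Theta> x)" if "x \<in> V" for c x
    unfolding \<Theta>_def cfun.scale_sum_right
    by (rule sum.cong) (simp_all only: mem_Collect_eq bilin \<theta>D(4) mul_in_block that)
  moreover have "\<Theta> (x \<star> y) = tmul H \<beta> (\<Theta> x) (\<Theta> y)" if x: "x \<in> V" and y: "y \<in> V" for x y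
  proof -
    have "tmul H \<beta> (\<Theta> x) (\<Theta> y) = (\<Sum>e | prim e. tmul H \<beta> (\<theta> e (e \<star> x)) (\<Theta> y))"
      unfolding \<Theta>_def[of x] by (rule tmul_sum_left)
    also have "\<dots> = (\<Sum>e | prim e. \<theta> e (e \<star> (x \<star> y)))"
    proof (rule sum.cong)
      fix e assume "e \<in> {e. prim e}"
      hence e: "prim e" by simp
      let ?t = "\<theta> e (e \<star> x)"
      \<comment> \<open>The central idempotent \<open>\<sigma> e\<close> fixes the left factor and
        can be handed over to the right one, of which only the component in the same block
        survives.\<close>
      have "?t = tmul H \<beta> (\<sigma> e) ?t"
        using Y.block_fix[OF Y.primD(3)[OF \<sigma>p[OF e]] \<theta>m[OF e x]] by simp
      also have "\<dots> = tmul H \<beta> ?t (\<sigma> e)"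
        by (rule Y.Z_commute[OF Y.primD(1)[OF \<sigma>p[OF e]] Y.block_V[OF \<theta>m[OF e x]]])
      finally have "tmul H \<beta> ?t (\<Theta> y) = tmul H \<beta> ?t (tmul H \<beta> (\<sigma> e) (\<Theta> y))"
        by (metis Y.assoc)
      also have "\<dots> = \<theta> e ((e \<star> x) \<star> (e \<star> y))"
        unfolding proj\<Theta>[OF e y] by (rule \<theta>D(5)[OF e mul_in_block[OF x] mul_in_block[OF y], symmetric])
      also have "(e \<star> x) \<star> (e \<star> y) = e \<star> (x \<star> e) \<star> y" by (simp only: assoc)
      also have "\<dots> = e \<star> (x \<star> y)"
        by (simp only: Z_commute[OF primD(1)[OF e] x, symmetric]) (simp only: assoc[symmetric] primD(3)[OF e])
      finally show "tmul H \<beta> ?t (\<Theta> y) = \<theta> e (e \<star> (x \<star> y))" .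
    qed simp
    finally show ?thesis by (simp only: \<Theta>_def)
  qed
  ultimately show ?thesis
    unfolding algebra_isomorphic_def algebra_iso_map_def by blast
qed

section \<open>Cancellation and the main theorem\<close>

text \<open>The average \<open>f\<close> of the basis elements is the idempotent of the trivial
  representation: it absorbs every basis element and has trace 1.\<close>

lemma (in twisted_alg) trivial_prim:
  assumes \<alpha>1: "\<And>g h. g \<in> carrier G \<Longrightarrow> h \<in> carrier G \<Longrightarrow> \<alpha> (g, h) = 1"
  shows "\<exists>f. prim f \<and> block_dim f = 1"
proof -
  let ?k = "of_nat (order G) :: complex"
  define s where "s = (\<Sum>h\<in>carrier G. delta h)"
  define f where "f = cscale (inverse ?k) s"
  have d: "delta g \<star> delta h = delta (g \<otimes> h)" if "g \<in> carrier G" "h \<in> carrier G" for g h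
    using delta_mul[OF that] by (simp only: \<alpha>1[OF that] cfun.scale_one)
  have sl: "delta g \<star> s = s" if g: "g \<in> carrier G" for g
  proof -
    have "delta g \<star> s = (\<Sum>h\<in>carrier G. delta (g \<otimes> h))"
      unfolding s_def tmul_sum_right by (rule sum.cong) (simp_all only: d[OF g])
    also have "\<dots> = s" unfolding s_def
      by (rule sum.reindex_bij_witness[where i = "\<lambda>h. inv g \<otimes> h" and j = "\<lambda>h. g \<otimes> h"])
        (use g in \<open>auto simp: m_assoc[symmetric]\<close>)
    finally show ?thesis .
  qed
  have sr: "s \<star> delta g = s" if g: "g \<in> carrier G" for g
  proof -
    have "s \<star> delta g = (\<Sum>h\<in>carrier G. delta (h \<otimes> g))"
      unfolding s_def tmul_sum_left by (rule sum.cong) (simp_all only: d[OF _ g])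
    also have "\<dots> = s" unfolding s_def
      by (rule sum.reindex_bij_witness[where i = "\<lambda>h. h \<otimes> inv g" and j = "\<lambda>h. h \<otimes> g"])
        (use g in \<open>auto simp: m_assoc\<close>)
    finally show ?thesis .
  qed
  have fr: "f \<star> delta g = f" "delta g \<star> f = f" if "g \<in> carrier G" for g
    unfolding f_def by (simp_all only: bilin sl[OF that] sr[OF that])
  have sV: "s \<in> V" unfolding s_def by (intro cfun.subspace_sum[OF subspace_fspace] delta_mem)
  hence fV: "f \<in> V" unfolding f_def by (rule V_closed(3))
  have fZ: "f \<in> Z" by (rule Z_I[OF fV]) (simp only: fr)
  have fx: "f \<star> x = cscale (\<Sum>g\<in>carrier G. x g) f" if "x \<in> V" for x
  proof -
    have "f \<star> x = f \<star> (\<Sum>g\<in>carrier G. cscale (x g) (delta g))"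
      by (rule arg_cong[of _ _ "\<lambda>v. f \<star> v"]) (rule V_expand[OF that])
    also have "\<dots> = (\<Sum>g\<in>carrier G. cscale (x g) f)"
      unfolding tmul_sum_right by (rule sum.cong) (simp_all only: bilin fr)
    finally show ?thesis by (simp only: cfun.scale_sum_left)
  qed
  have f_ap: "f g = inverse ?k" if "g \<in> carrier G" for g
    using that fin by (simp add: f_def s_def sum_fun_apply delta_def of_bool_def)
  have "(\<Sum>g\<in>carrier G. f g) = 1" using f_ap order_nz by (simp add: order_def)
  hence ff: "f \<star> f = f" using fx[OF fV] by (simp only: cfun.scale_one)
  have "f \<noteq> 0"
  proof
    assume "f = 0"
    hence "f \<one> = 0" by simp
    thus False using f_ap[of \<one>] order_nz by simp
  qed
  hence p: "prim f" unfolding prim_def idem_def using fZ ff fx Z_mem by blast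
  have "tr f = 1" using f_ap[of \<one>] order_nz by (simp add: tr_def \<alpha>1)
  hence "of_nat (block_dim f) = (of_nat 1 :: complex)" using tr_idem[OF ff] by simp
  hence "block_dim f = 1" by (simp only: of_nat_eq_iff)
  with p show ?thesis by blast
qed

text \<open>The right-hand set is described by dimensions in the tensor product alone, without
  reference to its factors, so algebra isomorphisms preserve it.\<close>

lemma (in twisted_pair) tens_bij:
  assumes cop: "coprime (order G) (order K)"
    and dA: "\<And>e. A.prim e \<Longrightarrow> A.block_dim e dvd order G ^ 2" and dB: "\<And>f. B.prim f \<Longrightarrow> B.block_dim f dvd order K ^ 2"
  shows "bij_betw (\<lambda>p. tens (fst p) (snd p)) ({e. A.prim e} \<times> {f. B.prim f \<and> B.block_dim f = 1})
    {E. R.prim E \<and> coprime (R.block_dim E) (order K)}"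
  unfolding bij_betw_def
proof
  show "inj_on (\<lambda>p. tens (fst p) (snd p)) ({e. A.prim e} \<times> {f. B.prim f \<and> B.block_dim f = 1})"
  proof (rule inj_onI)
    fix p q assume pq: "p \<in> {e. A.prim e} \<times> {f. B.prim f \<and> B.block_dim f = 1}"
      "q \<in> {e. A.prim e} \<times> {f. B.prim f \<and> B.block_dim f = 1}" "tens (fst p) (snd p) = tens (fst q) (snd q)"
    hence "A.prim (fst p)" "B.prim (snd p)" "A.prim (fst q)" "B.prim (snd q)" by auto
    from tens_prim_inj[OF this pq(3)] show "p = q" by (rule prod_eqI)
  qed
  show "(\<lambda>p. tens (fst p) (snd p)) ` ({e. A.prim e} \<times> {f. B.prim f \<and> B.block_dim f = 1}) =
    {E. R.prim E \<and> coprime (R.block_dim E) (order K)}" (is "?L = ?R")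
  proof
    show "?L \<subseteq> ?R"
    proof
      fix E assume "E \<in> ?L"
      then obtain e f where ef: "A.prim e" "B.prim f" "B.block_dim f = 1" "E = tens e f" by auto
      thus "E \<in> ?R"
        using tens_prim[OF ef(1,2)] coprime_block_dim[OF ef(1,2) cop dA[OF ef(1)] dB[OF ef(2)]] by simp
    qed
    show "?R \<subseteq> ?L"
    proof
      fix E assume E: "E \<in> ?R"
      then obtain e f where ef: "A.prim e" "B.prim f" "E = tens e f" using prim_tens_ex by blast
      hence "B.block_dim f = 1" using coprime_block_dim[OF ef(1,2) cop dA[OF ef(1)] dB[OF ef(2)]] E by simp
      thus "E \<in> ?L" using ef by (intro image_eqI[of _ _ "(e, f)"]) simp_all
    qed
  qed
qed

text \<open>An isomorphism of the tensor products matches the blocks selected by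
  \<open>tens_bij\<close>. This matches pairs of idempotents, and the partner of \<open>e\<close>
  may depend on \<open>f\<close>; only its isomorphism type is under control. The counting in
  \<open>bij_of_uniform_fibres\<close> turns this into a bijection between the blocks of the first
  factors.\<close>

lemma talg_cancel_roots:
  assumes T: "twisted_pair G \<alpha> K \<beta>" and T': "twisted_pair G' \<alpha>' K' \<beta>'"
    and ord: "order G' = order G" "order K' = order K" and cop: "coprime (order G) (order K)"
    and roots: "\<And>g h. g \<in> carrier G \<Longrightarrow> h \<in> carrier G \<Longrightarrow> \<alpha> (g, h) ^ order G = 1"
    and roots': "\<And>g h. g \<in> carrier G' \<Longrightarrow> h \<in> carrier G' \<Longrightarrow> \<alpha>' (g, h) ^ order G' = 1"
    and triv: "\<And>g h. g \<in> carrier K \<Longrightarrow> h \<in> carrier K \<Longrightarrow> \<beta> (g, h) = 1"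
    and triv': "\<And>g h. g \<in> carrier K' \<Longrightarrow> h \<in> carrier K' \<Longrightarrow> \<beta>' (g, h) = 1"
    and iso: "talg_isomorphic (G \<times>\<times> K) (prod_cocycle G K \<alpha> \<beta>) (G' \<times>\<times> K') (prod_cocycle G' K' \<alpha>' \<beta>')"
  shows "talg_isomorphic G \<alpha> G' \<alpha>'"
proof -
  interpret T: twisted_pair G \<alpha> K \<beta> by fact
  interpret T': twisted_pair G' \<alpha>' K' \<beta>' by fact
  obtain F where F: "algebra_iso_map F (talg (G \<times>\<times> K)) (tmul (G \<times>\<times> K) (prod_cocycle G K \<alpha> \<beta>))
      (talg (G' \<times>\<times> K')) (tmul (G' \<times>\<times> K') (prod_cocycle G' K' \<alpha>' \<beta>'))"
    using iso by (auto simp: algebra_isomorphic_def)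
  interpret I: twisted_iso "G \<times>\<times> K" "prod_cocycle G K \<alpha> \<beta>" "G' \<times>\<times> K'" "prod_cocycle G' K' \<alpha>' \<beta>'" F
    by unfold_locales (rule F)
  have pos: "order G > 0" using T.A.order_gt_0_iff_finite T.A.fin by simp
  have dA: "T.A.block_dim e dvd order G ^ 2" if "T.A.prim e" for e by (rule T.A.block_dim_dvd[OF pos roots that])
  have dA': "T'.A.block_dim e dvd order G' ^ 2" if "T'.A.prim e" for e
    by (rule T'.A.block_dim_dvd[OF _ roots' that]) (simp_all add: pos ord)
  \<comment> \<open>The trivial cocycle takes values in the roots of unity of exponent 1.\<close>
  have dB: "T.B.block_dim e dvd order K ^ 2" if "T.B.prim e" for e
    by (rule T.B.block_dim_dvd[of 1]) (simp_all add: triv that)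
  have dB': "T'.B.block_dim e dvd order K' ^ 2" if "T'.B.prim e" for e
    by (rule T'.B.block_dim_dvd[of 1]) (simp_all add: triv' that)
  let ?M = "{e. T.A.prim e}" and ?N = "{e. T'.A.prim e}"
  let ?U = "{f. T.B.prim f \<and> T.B.block_dim f = 1}" and ?W = "{f. T'.B.prim f \<and> T'.B.block_dim f = 1}"
  let ?L = "{E. T.R.prim E \<and> coprime (T.R.block_dim E) (order K)}" and ?L' = "{E. T'.R.prim E \<and> coprime (T'.R.block_dim E) (order K)}"
  let ?t = "\<lambda>p. tens (fst p) (snd p)"
  have b1: "bij_betw ?t (?M \<times> ?U) ?L" by (rule T.tens_bij[OF cop dA dB])
  have b3: "bij_betw ?t (?N \<times> ?W) ?L'"
    using T'.tens_bij[OF _ dA' dB'] cop by (simp add: ord)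
  have dimF: "T'.R.block_dim (F E) = T.R.block_dim E" if "T.R.prim E" for E by (rule I.F_block_dim[OF T.R.primD(2)[OF that]])
  have b2: "bij_betw F ?L ?L'"
    unfolding bij_betw_def
  proof
    show "inj_on F ?L" using I.F_prim_bij by (auto simp: bij_betw_def intro: inj_on_subset)
    show "F ` ?L = ?L'"
    proof
      show "F ` ?L \<subseteq> ?L'" using I.F_prim dimF by auto
      show "?L' \<subseteq> F ` ?L"
      proof
        fix E assume E: "E \<in> ?L'"
        then obtain D where D: "T.R.prim D" "E = F D" using I.F_prim_bij by (auto simp: bij_betw_def)
        thus "E \<in> F ` ?L" using E dimF[OF D(1)] by auto
      qed
    qed
  qed
  \<comment> \<open>A pair of idempotents is tensored, sent through \<open>F\<close> and split
    again.\<close>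
  define \<Phi> where "\<Phi> = inv_into (?N \<times> ?W) ?t \<circ> (F \<circ> ?t)"
  have b\<Phi>: "bij_betw \<Phi> (?M \<times> ?U) (?N \<times> ?W)"
    unfolding \<Phi>_def by (rule bij_betw_trans[OF bij_betw_trans[OF b1 b2] bij_betw_inv_into[OF b3]])
  define rel where "rel e e' \<longleftrightarrow> T.A.prim e \<and> T'.A.prim e' \<and>
    algebra_isomorphic (T.A.block e) (tmul G \<alpha>) (T'.A.block e') (tmul G' \<alpha>')" for e e'
  have rel: "rel e (fst (\<Phi> (e, f)))" "T'.A.block_dim (fst (\<Phi> (e, f))) = T.A.block_dim e" if e: "e \<in> ?M" and f: "f \<in> ?U" for e f
  proof -
    obtain e' f' where q: "\<Phi> (e, f) = (e', f')" by (cases "\<Phi> (e, f)")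
    have mem: "(e, f) \<in> ?M \<times> ?U" using e f by (rule SigmaI)
    have "(e', f') \<in> ?N \<times> ?W" using bij_betw_apply[OF b\<Phi> mem] unfolding q .
    hence ef: "e' \<in> ?N" "f' \<in> ?W" by (rule SigmaD1, rule SigmaD2)
    have "F (?t (e, f)) \<in> ?t ` (?N \<times> ?W)"
      unfolding bij_betw_imp_surj_on[OF b3] by (rule bij_betw_apply[OF b2 bij_betw_apply[OF b1 mem]])
    hence "?t (\<Phi> (e, f)) = F (?t (e, f))" unfolding \<Phi>_def comp_apply by (rule f_inv_into_f)
    hence Ft: "F (tens e f) = tens e' f'" using q by simp
    have p: "T.A.prim e" "T.B.prim f" "T.B.block_dim f = 1" "T'.A.prim e'" "T'.B.prim f'" "T'.B.block_dim f' = 1"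
      using e f ef by auto
    have tV: "tens e f \<in> T.R.V" by (rule T.tens_V[OF T.A.primD(2)[OF p(1)] T.B.primD(2)[OF p(2)]])
    have 1: "algebra_isomorphic (T.A.block e) (tmul G \<alpha>) (T'.R.block (tens e' f')) (tmul T'.P T'.\<gamma>)"
      using algebra_isomorphic_trans[OF T.tens_block_iso[OF p(1-3)] I.F_block_iso[OF tV]] unfolding Ft .
    have 2: "algebra_isomorphic (T'.R.block (tens e' f')) (tmul T'.P T'.\<gamma>) (T'.A.block e') (tmul G' \<alpha>')"
      by (rule algebra_isomorphic_sym[OF T'.tens_block_iso[OF p(4-6)] T'.A.subspace_block T'.A.block_mul[OF T'.A.primD(3)[OF p(4)]]])
    show "rel e (fst (\<Phi> (e, f)))"
      unfolding rel_def q fst_conv using p(1,4) algebra_isomorphic_trans[OF 1 2] by blast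
    have "T.A.block_dim e = T.R.block_dim (tens e f)" using T.block_dim_tens[OF p(1,2)] p(3) by simp
    also have "\<dots> = T'.R.block_dim (tens e' f')" unfolding Ft[symmetric] by (rule I.F_block_dim[OF tV, symmetric])
    also have "\<dots> = T'.A.block_dim e'" using T'.block_dim_tens[OF p(4,5)] p(6) by simp
    finally show "T'.A.block_dim (fst (\<Phi> (e, f))) = T.A.block_dim e" by (simp add: q)
  qed
  have difun: "rel x y'" if "rel x y" "rel x' y" "rel x' y'" for x x' y y'
  proof -
    have yx: "algebra_isomorphic (T'.A.block y) (tmul G' \<alpha>') (T.A.block x') (tmul G \<alpha>)"
      by (rule algebra_isomorphic_sym[OF _ T.A.subspace_block T.A.block_mul])
        (use that in \<open>auto simp: rel_def T.A.primD\<close>)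
    have "algebra_isomorphic (T.A.block x) (tmul G \<alpha>) (T'.A.block y) (tmul G' \<alpha>')"
      "algebra_isomorphic (T.A.block x') (tmul G \<alpha>) (T'.A.block y') (tmul G' \<alpha>')"
      using that by (simp_all add: rel_def)
    note xy = this
    have "algebra_isomorphic (T.A.block x) (tmul G \<alpha>) (T'.A.block y') (tmul G' \<alpha>')"
      by (rule algebra_isomorphic_trans[OF algebra_isomorphic_trans[OF xy(1) yx] xy(2)])
    thus ?thesis using that by (simp add: rel_def)
  qed
  have "\<exists>\<sigma>. bij_betw \<sigma> ?M ?N \<and> (\<forall>x\<in>?M. rel x (\<sigma> x))"
  proof (rule bij_of_uniform_fibres[where R = rel and d = T.A.block_dim and d' = T'.A.block_dim and k = "order G", OF _ _ _ _ _ b\<Phi> rel(1) difun rel(2)])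
    show "finite ?M" "finite ?N" by (rule T.A.prims T'.A.prims)+
    show "finite ?U" "finite ?W"
      by (rule finite_subset[OF _ T.B.prims(1)] finite_subset[OF _ T'.B.prims(1)], blast)+
    show "?U \<noteq> {}" using T.B.trivial_prim[OF triv] by blast
    show "sum T.A.block_dim ?M = order G" "sum T'.A.block_dim ?N = order G"
      using T.A.sum_block_dim T'.A.sum_block_dim ord(1) by simp_all
  qed (use pos in auto)
  then obtain \<sigma> where \<sigma>: "bij_betw \<sigma> ?M ?N" "\<And>e. T.A.prim e \<Longrightarrow> rel e (\<sigma> e)" by auto
  show ?thesis
    by (rule T.A.isomorphic_of_blocks[OF T'.A.twisted_alg_axioms \<sigma>(1)]) (use \<sigma>(2) in \<open>simp add: rel_def\<close>)
qed

text \<open>Both cocycles are replaced by cohomologous ones with values in roots of unity, as the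
  divisibility of block dimensions requires.\<close>

lemma talg_cancel:
  assumes G: "group G" "finite (carrier G)" and K: "group K" "finite (carrier K)"
    and G': "group G'" "finite (carrier G')" and K': "group K'" "finite (carrier K')"
    and ord: "order G' = order G" "order K' = order K" and cop: "coprime (order G) (order K)"
    and a: "\<alpha> \<in> carrier (cocycles2 G)" and a': "\<alpha>' \<in> carrier (cocycles2 G')"
    and iso: "talg_isomorphic (G \<times>\<times> K) (prod_cocycle G K \<alpha> \<one>\<^bsub>cocycles2 K\<^esub>) (G' \<times>\<times> K') (prod_cocycle G' K' \<alpha>' \<one>\<^bsub>cocycles2 K'\<^esub>)"
  shows "talg_isomorphic G \<alpha> G' \<alpha>'"
proof -
  interpret ZK: comm_group "cocycles2 K" by (rule comm_group_cocycles2[OF K(1)])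
  interpret ZK': comm_group "cocycles2 K'" by (rule comm_group_cocycles2[OF K'(1)])
  obtain b where b: "b \<in> carrier (cocycles2 G)" "cohomology_class G b = cohomology_class G \<alpha>"
    "\<And>g h. g \<in> carrier G \<Longrightarrow> h \<in> carrier G \<Longrightarrow> b (g, h) ^ order G = 1"
    using root_of_unity_cocycle[OF G a] by metis
  obtain b' where b': "b' \<in> carrier (cocycles2 G')" "cohomology_class G' b' = cohomology_class G' \<alpha>'"
    "\<And>g h. g \<in> carrier G' \<Longrightarrow> h \<in> carrier G' \<Longrightarrow> b' (g, h) ^ order G' = 1"
    using root_of_unity_cocycle[OF G' a'] by metis
  have e: "talg_isomorphic G b G \<alpha>"
    by (rule talg_isomorphic_cohomologous[OF G a b(1,2)])
  have e': "talg_isomorphic G' \<alpha>' G' b'"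
    by (rule talg_isomorphic_cohomologous[OF G' b'(1) a' b'(2)[symmetric]])
  have isob: "talg_isomorphic (G \<times>\<times> K) (prod_cocycle G K b \<one>\<^bsub>cocycles2 K\<^esub>) (G' \<times>\<times> K') (prod_cocycle G' K' b' \<one>\<^bsub>cocycles2 K'\<^esub>)"
    by (rule algebra_isomorphic_trans[OF algebra_isomorphic_trans[OF
          talg_isomorphic_DirProd_left[OF G(1) G(1) K(1) e] iso] talg_isomorphic_DirProd_left[OF G'(1) G'(1) K'(1) e']])
  have tp: "twisted_pair G b K \<one>\<^bsub>cocycles2 K\<^esub>" "twisted_pair G' b' K' \<one>\<^bsub>cocycles2 K'\<^esub>"
    using G K G' K' b(1) b'(1) by (auto simp: twisted_pair_def twisted_alg_def twisted_alg_axioms_def)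
  have "talg_isomorphic G b G' b'"
    by (rule talg_cancel_roots[OF tp ord cop b(3) b'(3) cocycles2_one_apply[of _ K] cocycles2_one_apply[of _ K'] isob])
  thus ?thesis
    by (rule algebra_isomorphic_trans[OF algebra_isomorphic_trans[OF talg_isomorphic_sym[OF e]] talg_isomorphic_sym[OF e']])
qed

text \<open>Inflation before \<psi> and restriction after it give the map on the first factors, and
  torsion makes it bijective. The class of \<alpha> inflates to the class of the product of \<alpha>
  with the trivial cocycle, which is the situation of \<open>talg_cancel\<close>.\<close>

lemma twisted_equivalent_DirProd_factor:
  assumes G: "group G" "finite (carrier G)" and K: "group K" "finite (carrier K)"
    and G': "group G'" "finite (carrier G')" and K': "group K'" "finite (carrier K')"
    and ord: "order G' = order G" "order K' = order K" and cop: "coprime (order G) (order K)"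
    and PP: "G \<times>\<times> K \<sim>\<^sub>\<complex> G' \<times>\<times> K'"
  shows "G \<sim>\<^sub>\<complex> G'"
proof -
  let ?P = "G \<times>\<times> K" and ?P' = "G' \<times>\<times> K'"
  have P: "group ?P" "finite (carrier ?P)" and P': "group ?P'" "finite (carrier ?P')"
    using G K G' K' DirProd_group by auto
  have cop': "coprime (order G') (order K')" using cop ord by simp
  interpret HP: comm_group "H2 ?P" by (rule comm_group_H2[OF P(1)])
  interpret HP': comm_group "H2 ?P'" by (rule comm_group_H2[OF P'(1)])
  interpret HG: comm_group "H2 G" by (rule comm_group_H2[OF G(1)])
  interpret HG': comm_group "H2 G'" by (rule comm_group_H2[OF G'(1)])
  interpret HK: comm_group "H2 K" by (rule comm_group_H2[OF K(1)])
  interpret HK': comm_group "H2 K'" by (rule comm_group_H2[OF K'(1)])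
  obtain \<psi> where p: "\<psi> \<in> iso (H2 ?P) (H2 ?P')"
    "\<And>\<alpha> \<beta>. \<alpha> \<in> carrier (cocycles2 ?P) \<Longrightarrow> \<beta> \<in> carrier (cocycles2 ?P') \<Longrightarrow>
      \<psi> (cohomology_class ?P \<alpha>) = cohomology_class ?P' \<beta> \<Longrightarrow>
      talg_isomorphic ?P \<alpha> ?P' \<beta>"
    using twisted_equivalentD[OF P P' PP] by metis
  have ph: "\<psi> \<in> hom (H2 ?P) (H2 ?P')" and pb: "bij_betw \<psi> (carrier (H2 ?P)) (carrier (H2 ?P'))"
    using p(1) by (auto simp: iso_def)
  let ?i = "H2_map ?P fst" and ?i' = "H2_map ?P' fst"
  let ?r = "H2_map G (\<lambda>g. (g, \<one>\<^bsub>K\<^esub>))" and ?r' = "H2_map G' (\<lambda>g. (g, \<one>\<^bsub>K'\<^esub>))"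
  interpret i: group_hom "H2 G" "H2 ?P" ?i using H2_map_hom[OF P(1) G(1) fst_hom] by unfold_locales
  interpret i': group_hom "H2 G'" "H2 ?P'" ?i' using H2_map_hom[OF P'(1) G'(1) fst_hom] by unfold_locales
  interpret s: group_hom "H2 K" "H2 ?P" "H2_map ?P snd" using H2_map_hom[OF P(1) K(1) snd_hom] by unfold_locales
  interpret s': group_hom "H2 K'" "H2 ?P'" "H2_map ?P' snd" using H2_map_hom[OF P'(1) K'(1) snd_hom] by unfold_locales
  interpret r: group_hom "H2 ?P" "H2 G" ?r using H2_map_hom[OF G(1) P(1) inl_hom[OF K(1)]] by unfold_locales
  interpret r': group_hom "H2 ?P'" "H2 G'" ?r' using H2_map_hom[OF G'(1) P'(1) inl_hom[OF K'(1)]] by unfold_locales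
  interpret \<psi>: group_hom "H2 ?P" "H2 ?P'" \<psi> using ph by unfold_locales
  have ri: "?r (?i c) = c" if "c \<in> carrier (H2 G)" for c
    using H2_DirProd_project(2)[OF G(1) K(1) that HK.one_closed] that by simp
  have ri': "?r' (?i' c) = c" if "c \<in> carrier (H2 G')" for c
    using H2_DirProd_project(2)[OF G'(1) K'(1) that HK'.one_closed] that by simp
  \<comment> \<open>The order of \<open>G\<close> kills \<open>c\<close>, hence also
    \<open>\<psi> (?i c)\<close>, which is therefore inflated from \<open>G'\<close>.\<close>
  have ir': "?i' (?r' (\<psi> (?i c))) = \<psi> (?i c)" if c: "c \<in> carrier (H2 G)" for c
  proof (rule H2_DirProd_torsion[OF G' K' cop'])
    have "\<psi> (?i c) [^]\<^bsub>H2 ?P'\<^esub> order G = \<psi> (?i (c [^]\<^bsub>H2 G\<^esub> order G))"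
      using c by (simp add: \<psi>.hom_nat_pow i.hom_nat_pow)
    thus "\<psi> (?i c) [^]\<^bsub>H2 ?P'\<^esub> order G' = \<one>\<^bsub>H2 ?P'\<^esub>"
      using H2_pow_order[OF G c] ord by simp
  qed (use c in simp)
  define \<theta> where "\<theta> c = ?r' (\<psi> (?i c))" for c
  have \<theta>hom: "\<theta> \<in> hom (H2 G) (H2 G')"
    by (rule homI) (auto simp: \<theta>_def)
  have "bij_betw \<theta> (carrier (H2 G)) (carrier (H2 G'))"
    unfolding bij_betw_def
  proof
    show "inj_on \<theta> (carrier (H2 G))"
    proof (rule inj_onI)
      fix x y assume xy: "x \<in> carrier (H2 G)" "y \<in> carrier (H2 G)" and e: "\<theta> x = \<theta> y"
      hence "\<psi> (?i x) = \<psi> (?i y)" using ir' by (metis \<theta>_def)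
      hence "?i x = ?i y" using pb xy by (auto simp: bij_betw_def dest: inj_onD)
      thus "x = y" using ri xy by metis
    qed
    show "\<theta> ` carrier (H2 G) = carrier (H2 G')"
    proof
      show "\<theta> ` carrier (H2 G) \<subseteq> carrier (H2 G')" using \<theta>hom by (auto simp: hom_def)
      show "carrier (H2 G') \<subseteq> \<theta> ` carrier (H2 G)"
      proof
        fix d assume d: "d \<in> carrier (H2 G')"
        have "?i' d \<in> carrier (H2 ?P')" using d by simp
        then obtain x where x: "x \<in> carrier (H2 ?P)" "\<psi> x = ?i' d"
          using pb by (metis (no_types, lifting) bij_betw_def imageE)
        \<comment> \<open>Torsion in the other direction: \<psi> is injective, so the preimage of an
          inflated class is killed by the order of \<open>G\<close> and is inflated itself.\<close>
        have "\<psi> (x [^]\<^bsub>H2 ?P\<^esub> order G) = ?i' (d [^]\<^bsub>H2 G'\<^esub> order G')"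
          using x d by (simp add: \<psi>.hom_nat_pow i'.hom_nat_pow ord)
        also have "\<dots> = \<psi> \<one>\<^bsub>H2 ?P\<^esub>" using H2_pow_order[OF G' d] by simp
        finally have "x [^]\<^bsub>H2 ?P\<^esub> order G = \<one>\<^bsub>H2 ?P\<^esub>"
          using pb x by (intro inj_onD[of \<psi> "carrier (H2 ?P)"]) (simp_all add: bij_betw_def)
        hence "?i (?r x) = x" by (intro H2_DirProd_torsion[OF G K cop x(1)])
        hence "\<theta> (?r x) = d" using x ri' d by (simp add: \<theta>_def)
        thus "d \<in> \<theta> ` carrier (H2 G)" using x(1) by (metis image_eqI r.hom_closed)
      qed
    qed
  qed
  hence "\<theta> \<in> iso (H2 G) (H2 G')" using \<theta>hom by (simp add: iso_def)
  thus ?thesis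
  proof (rule twisted_equivalentI[OF G G'])
    fix \<alpha> assume a: "\<alpha> \<in> carrier (cocycles2 G)"
    let ?c = "cohomology_class G \<alpha>"
    have c: "?c \<in> carrier (H2 G)" using a by (simp add: carrier_H2)
    have "\<theta> ?c \<in> carrier (H2 G')" using c by (simp add: \<theta>_def)
    then obtain \<alpha>' where a': "\<alpha>' \<in> carrier (cocycles2 G')" "\<theta> ?c = cohomology_class G' \<alpha>'"
      by (auto simp: carrier_H2)
    interpret ZK: comm_group "cocycles2 K" by (rule comm_group_cocycles2[OF K(1)])
    interpret ZK': comm_group "cocycles2 K'" by (rule comm_group_cocycles2[OF K'(1)])
    have 1: "cohomology_class ?P (prod_cocycle G K \<alpha> \<one>\<^bsub>cocycles2 K\<^esub>) = ?i ?c"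
      using H2_DirProd_inject[OF G(1) K(1) a ZK.one_closed] c by (simp add: cohomology_class_one[OF K(1)])
    have 2: "cohomology_class ?P' (prod_cocycle G' K' \<alpha>' \<one>\<^bsub>cocycles2 K'\<^esub>) = ?i' (\<theta> ?c)"
      using H2_DirProd_inject[OF G'(1) K'(1) a'(1) ZK'.one_closed] c a'(2)
      by (simp add: cohomology_class_one[OF K'(1)] \<theta>_def flip: a'(2))
    have "talg_isomorphic ?P (prod_cocycle G K \<alpha> \<one>\<^bsub>cocycles2 K\<^esub>) ?P' (prod_cocycle G' K' \<alpha>' \<one>\<^bsub>cocycles2 K'\<^esub>)"
      by (rule p(2)[OF prod_cocycle_cocycle prod_cocycle_cocycle])
        (use G K G' K' a a' 1 2 ir'[OF c] in \<open>simp_all add: \<theta>_def\<close>)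
    hence "talg_isomorphic G \<alpha> G' \<alpha>'"
      by (rule talg_cancel[OF G K G' K' ord cop a a'(1)])
    thus "\<exists>\<alpha>1\<in>carrier (cocycles2 G). \<exists>\<alpha>2\<in>carrier (cocycles2 G').
        cohomology_class G \<alpha>1 = ?c \<and> \<theta> ?c = cohomology_class G' \<alpha>2 \<and>
        talg_isomorphic G \<alpha>1 G' \<alpha>2"
      using a a' by blast
  qed
qed

lemma twisted_equivalent_iso_cong:
  assumes G: "group G" "finite (carrier G)" and H: "group H" "finite (carrier H)"
    and G': "group G'" "finite (carrier G')" and H': "group H'" "finite (carrier H')"
    and iso: "G \<cong> G'" "H \<cong> H'" and GH: "G \<sim>\<^sub>\<complex> H"
  shows "G' \<sim>\<^sub>\<complex> H'"
proof -
  have "G' \<sim>\<^sub>\<complex> G" by (rule twisted_equivalent_of_iso[OF G G' iso(1)])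
  hence "G' \<sim>\<^sub>\<complex> H" by (rule twisted_equivalent_trans[OF G' G H _ GH])
  moreover have "H \<sim>\<^sub>\<complex> H'"
    by (rule twisted_equivalent_sym[OF H' H twisted_equivalent_of_iso[OF H H' iso(2)]])
  ultimately show ?thesis by (rule twisted_equivalent_trans[OF G' H H'])
qed

text \<open>The factor lemma extracts the left factor; the right one is obtained by applying it to
  the swapped products.\<close>

lemma twisted_equivalent_DirProd_iff:
  assumes G: "group G" "finite (carrier G)" and K: "group K" "finite (carrier K)"
    and G': "group G'" "finite (carrier G')" and K': "group K'" "finite (carrier K')"
    and ord: "order G' = order G" "order K' = order K" and cop: "coprime (order G) (order K)"
  shows "G \<times>\<times> K \<sim>\<^sub>\<complex> G' \<times>\<times> K' \<longleftrightarrow> G \<sim>\<^sub>\<complex> G' \<and> K \<sim>\<^sub>\<complex> K'"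
proof
  assume "G \<sim>\<^sub>\<complex> G' \<and> K \<sim>\<^sub>\<complex> K'"
  thus "G \<times>\<times> K \<sim>\<^sub>\<complex> G' \<times>\<times> K'"
    using twisted_equivalent_DirProd[OF G K G' K' ord cop] by blast
next
  assume PP: "G \<times>\<times> K \<sim>\<^sub>\<complex> G' \<times>\<times> K'"
  have cop': "coprime (order K) (order G)" using cop by (simp add: coprime_commute)
  have PP': "K \<times>\<times> G \<sim>\<^sub>\<complex> K' \<times>\<times> G'"
  proof (rule twisted_equivalent_iso_cong[OF _ _ _ _ _ _ _ _ _ _ PP])
    show "G \<times>\<times> K \<cong> K \<times>\<times> G" "G' \<times>\<times> K' \<cong> K' \<times>\<times> G'"
      using DirProd_swap_iso by (auto simp: is_iso_def)
  qed (use G K G' K' DirProd_group in auto)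
  have "G \<sim>\<^sub>\<complex> G'"
    by (rule twisted_equivalent_DirProd_factor[OF G K G' K' ord cop PP])
  moreover have "K \<sim>\<^sub>\<complex> K'"
    by (rule twisted_equivalent_DirProd_factor[OF K G K' G' ord(2,1) cop' PP'])
  ultimately show "G \<sim>\<^sub>\<complex> G' \<and> K \<sim>\<^sub>\<complex> K'" ..
qed

section \<open>From two factors to finite products\<close>

lemma product_group_insert_iso:
  assumes "i \<notin> I"
  shows "product_group (insert i I) G \<cong> product_group I G \<times>\<times> G i"
proof -
  have "(\<lambda>f. (restrict f I, f i)) \<in> iso (product_group (insert i I) G) (product_group I G \<times>\<times> G i)"
    unfolding iso_def
  proof (intro CollectI conjI)
    show "(\<lambda>f. (restrict f I, f i)) \<in> hom (product_group (insert i I) G) (product_group I G \<times>\<times> G i)"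
      by (rule homI) (auto simp: fun_eq_iff PiE_iff)
    show "bij_betw (\<lambda>f. (restrict f I, f i)) (carrier (product_group (insert i I) G)) (carrier (product_group I G \<times>\<times> G i))"
      by (rule bij_betw_byWitness[of _ "\<lambda>p. (fst p)(i := snd p)"])
        (use assms in \<open>auto simp: fun_eq_iff PiE_iff extensional_def split: if_splits\<close>)
  qed
  thus ?thesis by (auto simp: is_iso_def)
qed

lemma order_product_group: "finite I \<Longrightarrow> order (product_group I G) = (\<Prod>i\<in>I. order (G i))"
  by (simp add: order_def card_PiE)

lemma finite_product_group:
  "finite I \<Longrightarrow> (\<And>i. i \<in> I \<Longrightarrow> finite (carrier (G i))) \<Longrightarrow> finite (carrier (product_group I G))"
  by (simp add: finite_PiE)

theorem theorem1p4:
  fixes r :: nat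
    and k :: "nat \<Rightarrow> nat"
    and G :: "nat \<Rightarrow> ('a, 'm) monoid_scheme"
    and H :: "nat \<Rightarrow> ('b, 'n) monoid_scheme"
  assumes "\<And>i. i \<in> {1..r} \<Longrightarrow> group (G i)"
    and "\<And>i. i \<in> {1..r} \<Longrightarrow> group (H i)"
    and "\<And>i. i \<in> {1..r} \<Longrightarrow> finite (carrier (G i))"
    and "\<And>i. i \<in> {1..r} \<Longrightarrow> finite (carrier (H i))"
    and "\<And>i. i \<in> {1..r} \<Longrightarrow> order (G i) = k i"
    and "\<And>i. i \<in> {1..r} \<Longrightarrow> order (H i) = k i"
    and "\<And>i j. i \<in> {1..r} \<Longrightarrow> j \<in> {1..r} \<Longrightarrow> i \<noteq> j \<Longrightarrow> gcd (k i) (k j) = 1"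
  shows "product_group {1..r} G \<sim>\<^sub>\<complex> product_group {1..r} H \<longleftrightarrow>
    (\<forall>i\<in>{1..r}. G i \<sim>\<^sub>\<complex> H i)"
  using assms
proof (induction r)
  case 0
  \<comment> \<open>The only element of an empty product is the function that is
    \<open>undefined\<close> everywhere, so both sides are trivial groups.\<close>
  have "(\<lambda>_ _. undefined) \<in> iso (product_group {} H) (product_group {} G)"
    by (auto simp: iso_def hom_def bij_betw_def)
  hence "product_group {} H \<cong> product_group {} G" by (auto simp: is_iso_def)
  moreover have "group (product_group {} G)" "group (product_group {} H)" by (rule product_group, simp)+
  ultimately have "product_group {} G \<sim>\<^sub>\<complex> product_group {} H"
    by (intro twisted_equivalent_of_iso) simp_all
  thus ?case by simp
next
  case (Suc r)
  let ?G = "product_group {1..r} G" and ?H = "product_group {1..r} H" and ?s = "Suc r"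
  have ins: "{1..Suc r} = insert ?s {1..r}" by auto
  note A = Suc.prems
  have g: "group ?G" "finite (carrier ?G)" and h: "group ?H" "finite (carrier ?H)"
    by (intro product_group finite_product_group A; simp)+
  have gs: "group (G ?s)" "finite (carrier (G ?s))" and hs: "group (H ?s)" "finite (carrier (H ?s))"
    using A by auto
  have gi: "group (product_group {1..Suc r} G)" "finite (carrier (product_group {1..Suc r} G))"
    and hi: "group (product_group {1..Suc r} H)" "finite (carrier (product_group {1..Suc r} H))"
    by (intro product_group finite_product_group A; simp)+
  have gp: "group (?G \<times>\<times> G ?s)" "finite (carrier (?G \<times>\<times> G ?s))"
    and hp: "group (?H \<times>\<times> H ?s)" "finite (carrier (?H \<times>\<times> H ?s))"
    using g gs h hs DirProd_group by auto
  have og: "order ?G = (\<Prod>i\<in>{1..r}. k i)" and oh: "order ?H = (\<Prod>i\<in>{1..r}. k i)"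
    using A(5,6) by (simp_all add: order_product_group)
  have os: "order (G ?s) = k ?s" "order (H ?s) = k ?s" using A(5,6) by auto
  have cop: "coprime (order ?G) (order (G ?s))"
    unfolding og os by (rule prod_coprime_left) (use A(7) in \<open>auto simp: coprime_iff_gcd_eq_1\<close>)
  have ig: "product_group {1..Suc r} G \<cong> ?G \<times>\<times> G ?s" and ih: "product_group {1..Suc r} H \<cong> ?H \<times>\<times> H ?s"
    unfolding ins by (rule product_group_insert_iso; simp)+
  have "product_group {1..Suc r} G \<sim>\<^sub>\<complex> product_group {1..Suc r} H \<longleftrightarrow> ?G \<times>\<times> G ?s \<sim>\<^sub>\<complex> ?H \<times>\<times> H ?s"
    by (rule iffI[OF twisted_equivalent_iso_cong[OF gi hi gp hp ig ih]
          twisted_equivalent_iso_cong[OF gp hp gi hi group.iso_sym[OF gi(1) ig] group.iso_sym[OF hi(1) ih]]])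
  also have "\<dots> \<longleftrightarrow> ?G \<sim>\<^sub>\<complex> ?H \<and> G ?s \<sim>\<^sub>\<complex> H ?s"
    by (rule twisted_equivalent_DirProd_iff[OF g gs h hs _ _ cop]) (simp_all only: og oh os)
  also have "?G \<sim>\<^sub>\<complex> ?H \<longleftrightarrow> (\<forall>i\<in>{1..r}. G i \<sim>\<^sub>\<complex> H i)"
    by (rule Suc.IH) (use A in auto)
  finally show ?case unfolding ins by blast
qed

end
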